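(* Assume that $\bar A_k$ is invertible for every $k\in[\![0,N-1]\!]$ and that $\{\Pi_k\}_{k=0}^N$, $\{H_k\}_{k=0}^N$ in $\mathcal S^n$ satisfy, for $k\in[\![0,N-1]\!]$, $$\Pi_k=\bar A_k^\top\Pi_{k+1}\bar A_k-\bar A_k^\top\Pi_{k+1}B_k(I+B_k^\top\Pi_{k+1}B_k)^{-1}B_k^\top\Pi_{k+1}\bar A_k+\bar Q_k,$$ $$H_k=\bar A_k^\top H_{k+1}\bar A_k-\bar A_k^\top H_{k+1}B_k(-I+B_k^\top H_{k+1}B_k)^{-1}B_k^\top H_{k+1}\bar A_k-\bar Q_k.$$ Then $J_k:=H_k+\bar Q_k$ and $P_k:=\Pi_k-\bar Q_k$ ($k\in[\![0,N]\!]$) solve, for $k\in[\![0,N-1]\!]$, $$J_{k+1}=\bar A_k^{-\top}J_k\bar A_k^{-1}-\bar A_k^{-\top}J_k\bar A_k^{-1}B_k(I+B_k^\top\bar A_k^{-\top}J_k\bar A_k^{-1}B_k)^{-1}B_k^\top\bar A_k^{-\top}J_k\bar A_k^{-1}+\bar Q_{k+1},$$ $$P_{k+1}=\bar A_k^{-\top}P_k\bar A_k^{-1}-\bar A_k^{-\top}P_k\bar A_k^{-1}B_k(-I+B_k^\top\bar A_k^{-\top}P_k\bar A_k^{-1}B_k)^{-1}B_k^\top\bar A_k^{-\top}P_k\bar A_k^{-1}-\bar Q_{k+1},$$ respectively, and for every $k\in[\![0,N-1]\!]$, $$I+B_k^\top\Pi_{k+1}B_k=(I-B_k^\top\bar A_k^{-\top}P_k\bar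 A_k^{-1}B_k)^{-1},\qquad I-B_k^\top H_{k+1}B_k=(I+B_k^\top\bar A_k^{-\top}J_k\bar A_k^{-1}B_k)^{-1}.$$ In addition, assume that $\bar\Sigma_0^{-1}=\Pi_0+H_0$ and $\bar\Sigma_N^{-1}=\Pi_N+H_N$. Then $\bar\Sigma_0^{-1}=J_0+P_0$ and $\bar\Sigma_N^{-1}=J_N+P_N$. Assume further that $I-B_k^\top H_{k+1}B_k\succ0$ for every $k\in[\![0,N-1]\!]$. Then the policy $$\varpi_k^*(v|\xi_{k+1})=\mathcal N\bigl(v\,\big|\,B_k^\top H_{k+1}\xi_{k+1},\ I-B_k^\top H_{k+1}B_k\bigr),\quad k\in[\![0,N-1]\!],\ v\in\mathbb R^m,\ \xi_{k+1}\in\mathbb R^n,$$ is the unique optimal policy of the backward MaxEnt density control problem described in the context. Moreover, let $\{\xi_k^*\}$ be the backward state process driven by $\varpi^*$ and let $\{x_k^*\}$ be the optimal forward state process driven by the policy $$\pi_k^*(u|x_k)=\mathcal N\bigl(u\,\big|\,-(I+B_k^\top\Pi_{k+1}B_k)^{-1}(B_k^\top\Pi_{k+1}A_k+S_k^\top)x_k,\ (I+B_k^\top\Pi_{k+1}B_k)^{-1}\bigr),$$ i.e. $x_{k+1}^*=A_kx_k^*+B_ku_k$, $u_k\sim\pi_k^*(\cdot|x_k^* )$, $x_0^*\sim\mathcal N(0,\bar\Sigma_0)$. Then $\xi_k^*$ has the same distribution as $x_k^*$, that is, $\xi_k^*\sim\mathcal N\bigl(0,\mathbb E[x_k^*(x_k^*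 )^\top]\bigr)$ for every $k\in[\![0,N]\!]$.
   Context: Notation: $n,m,N$ are positive integers; $[\![k,l]\!]=\{k,k+1,\dots,l\}$; $\mathcal S^n$ is the set of real symmetric $n\times n$ matrices; $\succ,\succeq$ denote the positive (semi)definite order; $X^{-\top}$ is the transpose of the inverse; $\mathcal N(\cdot|\mu,\Sigma)$ is the Gaussian density with mean $\mu$ and covariance $\Sigma\succ0$. A solution of a Riccati equation is understood to be such that the inverse appearing in it exists at every step. Data: for $k\in[\![0,N-1]\!]$, $A_k\in\mathbb R^{n\times n}$, $B_k\in\mathbb R^{n\times m}$, $S_k\in\mathbb R^{n\times m}$, $Q_k\in\mathcal S^n$ (and $R_k\equiv I$, $\varepsilon=1$); $\bar A_k:=A_k-B_kS_k^\top$, $\bar Q_k:=Q_k-S_kS_k^\top$, with $\bar Q_k\succeq0$, and $\bar Q_N:=0$; $\bar\Sigma_0,\bar\Sigma_N\in\mathcal S^n$ are positive definite. Backward MaxEnt density control problem: find a policy $\varpi=\{\varpi_k\}_{k=N-1,\dots,0}$ minimizing $$\mathbb E\Bigl[\sum_{k=1}^{N}\Bigl(\tfrac12\xi_k^\top\bar Q_k\xi_k+\tfrac12\|v_{k-1}\|^2-\mathcal H(\varpi_{k-1}(\cdot|\xi_k))\Bigr)\Bigr]$$ subject to $\xi_k=\bar A_k^{-1}\xi_{k+1}-\bar A_k^{-1}B_kv_k$, $v_k\sim\varpi_k(\cdot|\xi_{k+1})$ given $\xi_{k+1}$ ($k=N-1,\dots,0$), and $\xi_N\sim\mathcal N(0,\bar\Sigma_N)$,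 $\xi_0\sim\mathcal N(0,\bar\Sigma_0)$. Here $\varpi_k(\cdot|\xi_{k+1})$ is the conditional density of $v_k$ given $\xi_{k+1}$ (as such determined only up to null sets) and $\mathcal H(p)=-\int_{\mathbb R^m}p(v)\log p(v)\,dv$ is the entropy of a density $p$. *)

theory Defs
  imports "HOL-Probability.Probability"
begin

definition pos_def :: "real^'n^'n \<Rightarrow> bool" where
  "pos_def M \<longleftrightarrow> transpose M = M \<and> (\<forall>x. x \<noteq> 0 \<longrightarrow> 0 < x \<bullet> (M *v x))"

definition pos_semidef :: "real^'n^'n \<Rightarrow> bool" where
  "pos_semidef M \<longleftrightarrow> transpose M = M \<and> (\<forall>x. 0 \<le> x \<bullet> (M *v x))"

text \<open>The Gaussian density; it is only meaningful for positive definite \<open>C\<close>.\<close>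

definition gaussian_density :: "real^'d \<Rightarrow> real^'d^'d \<Rightarrow> real^'d \<Rightarrow> real" where
  "gaussian_density \<mu> C x =
     exp (- ((x - \<mu>) \<bullet> (matrix_inv C *v (x - \<mu>))) / 2) / sqrt ((2 * pi) ^ CARD('d) * det C)"

text \<open>The Bochner integral is \<open>0\<close> for a non-integrable integrand, so this is the entropy only
  of a density \<open>p\<close> for which \<open>p ln p\<close> is integrable.\<close>

definition diff_entropy :: "(real^'m \<Rightarrow> real) \<Rightarrow> real" where
  "diff_entropy p = - (\<integral>v. p v * ln (p v) \<partial>lborel)"

definition second_moment :: "'w measure \<Rightarrow> ('w \<Rightarrow> real^'n) \<Rightarrow> real^'n^'n" where
  "second_moment M X = (\<integral>\<omega>. (\<chi> i j. X \<omega> $ i * X \<omega> $ j) \<partial>M)"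

text \<open>A policy maps a time, a state and a control to the conditional density of the control
  at that time given the state.  Policies that agree up to null sets represent the same
  conditional densities, so it is no restriction to ask for a probability density at every state.\<close>

type_synonym ('n, 'm) policy = "nat \<Rightarrow> real^'n \<Rightarrow> real^'m \<Rightarrow> real"

definition is_policy :: "nat \<Rightarrow> ('n::finite, 'm::finite) policy \<Rightarrow> bool" where
  "is_policy N p \<longleftrightarrow> (\<forall>k<N.
     (\<lambda>(x, v). p k x v) \<in> borel_measurable (borel \<Otimes>\<^sub>M borel) \<and>
     (\<forall>x v. 0 \<le> p k x v) \<and>
     (\<forall>x. (\<integral>\<^sup>+ v. ennreal (p k x v) \<partial>lborel) = 1))"

text \<open>The processes live on the canonical sample space of pairs \<open>\<omega> = (z, v)\<close> of a starting state
  \<open>z\<close> and a control sequence \<open>v\<close>; the states are functions of \<open>\<omega>\<close> through the dynamics.  If the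
  control at time \<open>k\<close> is drawn from \<open>p k (X k)\<close>, where \<open>X k\<close> is the state in which it is applied,
  then by the chain rule \<open>\<omega>\<close> has density \<open>f z * (\<Prod>k<N. p k (X k \<omega>) (v k))\<close>,
  \<open>f\<close> being the density of the starting state.\<close>

type_synonym ('n, 'm) path = "(real^'n) \<times> (nat \<Rightarrow> real^'m)"

definition path_law ::
  "nat \<Rightarrow> (real^'n \<Rightarrow> real) \<Rightarrow> (nat \<Rightarrow> ('n::finite, 'm::finite) path \<Rightarrow> real^'n) \<Rightarrow> ('n::finite, 'm::finite) policy
    \<Rightarrow> ('n, 'm) path measure" where
  "path_law N f X p =
     density (lborel \<Otimes>\<^sub>M (\<Pi>\<^sub>M k\<in>{..<N}. lborel))
       (\<lambda>\<omega>. ennreal (f (fst \<omega>) * (\<Prod>k<N. p k (X k \<omega>) (snd \<omega> k))))"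

primrec fwd_state ::
  "(nat \<Rightarrow> real^'n^'n) \<Rightarrow> (nat \<Rightarrow> real^'m^'n) \<Rightarrow> nat \<Rightarrow> ('n::finite, 'm::finite) path \<Rightarrow> real^'n" where
  "fwd_state A B 0 \<omega> = fst \<omega>"
| "fwd_state A B (Suc k) \<omega> = A k *v fwd_state A B k \<omega> + B k *v snd \<omega> k"

definition fwd_law ::
  "nat \<Rightarrow> (nat \<Rightarrow> real^'n^'n) \<Rightarrow> (nat \<Rightarrow> real^'m^'n) \<Rightarrow> real^'n^'n \<Rightarrow> ('n::finite, 'm::finite) policy
    \<Rightarrow> ('n, 'm) path measure" where
  "fwd_law N A B \<Sigma>0 p = path_law N (gaussian_density 0 \<Sigma>0) (fwd_state A B) p"

function bwd_state ::
  "nat \<Rightarrow> (nat \<Rightarrow> real^'n^'n) \<Rightarrow> (nat \<Rightarrow> real^'m^'n) \<Rightarrow> nat \<Rightarrow> ('n::finite, 'm::finite) path \<Rightarrow> real^'n"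
where
  "bwd_state N A B k \<omega> =
     (if k < N
      then matrix_inv (A k) *v bwd_state N A B (Suc k) \<omega> - (matrix_inv (A k) ** B k) *v snd \<omega> k
      else fst \<omega>)"
  by pat_completeness auto
termination
  by (relation "Wellfounded.measure (\<lambda>(N, A, B, k, \<omega>). N - k)") auto

declare bwd_state.simps [simp del]

definition bwd_law ::
  "nat \<Rightarrow> (nat \<Rightarrow> real^'n^'n) \<Rightarrow> (nat \<Rightarrow> real^'m^'n) \<Rightarrow> real^'n^'n \<Rightarrow> ('n::finite, 'm::finite) policy
    \<Rightarrow> ('n, 'm) path measure" where
  "bwd_law N A B \<Sigma>N p =
     path_law N (gaussian_density 0 \<Sigma>N) (\<lambda>k. bwd_state N A B (Suc k)) p"

definition bwd_path_cost ::
  "nat \<Rightarrow> (nat \<Rightarrow> real^'n^'n) \<Rightarrow> (nat \<Rightarrow> real^'m^'n) \<Rightarrow> (nat \<Rightarrow> real^'n^'n) \<Rightarrow> ('n::finite, 'm::finite) policy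
    \<Rightarrow> ('n::finite, 'm::finite) path \<Rightarrow> real" where
  "bwd_path_cost N A B Q p \<omega> =
     (\<Sum>k=1..N. (bwd_state N A B k \<omega> \<bullet> (Q k *v bwd_state N A B k \<omega>)) / 2
        + (norm (snd \<omega> (k - 1)))\<^sup>2 / 2
        - diff_entropy (p (k - 1) (bwd_state N A B k \<omega>)))"

definition bwd_cost ::
  "nat \<Rightarrow> (nat \<Rightarrow> real^'n^'n) \<Rightarrow> (nat \<Rightarrow> real^'m^'n) \<Rightarrow> (nat \<Rightarrow> real^'n^'n) \<Rightarrow> real^'n^'n
    \<Rightarrow> ('n::finite, 'm::finite) policy \<Rightarrow> real" where
  "bwd_cost N A B Q \<Sigma>N p = (\<integral>\<omega>. bwd_path_cost N A B Q p \<omega> \<partial>bwd_law N A B \<Sigma>N p)"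

text \<open>The last two conditions say that the entropies and the expected cost are well defined and
  finite: policies of cost \<open>\<infinity>\<close> do not compete for the minimum, and for those with an infinite
  differential entropy the cost is not well defined.  No separate moment condition is imposed.
  The distribution of the state at time \<open>N\<close> is built into \<^const>\<open>bwd_law\<close>.\<close>

definition bwd_admissible ::
  "nat \<Rightarrow> (nat \<Rightarrow> real^'n^'n) \<Rightarrow> (nat \<Rightarrow> real^'m^'n) \<Rightarrow> (nat \<Rightarrow> real^'n^'n)
    \<Rightarrow> real^'n^'n \<Rightarrow> real^'n^'n \<Rightarrow> ('n::finite, 'm::finite) policy \<Rightarrow> bool" where
  "bwd_admissible N A B Q \<Sigma>0 \<Sigma>N p \<longleftrightarrow>
     is_policy N p \<and>
     distributed (bwd_law N A B \<Sigma>N p) lborel (bwd_state N A B 0) (gaussian_density 0 \<Sigma>0) \<and>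
     (AE \<omega> in bwd_law N A B \<Sigma>N p. \<forall>k<N.
        integrable lborel
          (\<lambda>v. p k (bwd_state N A B (Suc k) \<omega>) v * ln (p k (bwd_state N A B (Suc k) \<omega>) v))) \<and>
     integrable (bwd_law N A B \<Sigma>N p) (bwd_path_cost N A B Q p)"

definition bwd_optimal ::
  "nat \<Rightarrow> (nat \<Rightarrow> real^'n^'n) \<Rightarrow> (nat \<Rightarrow> real^'m^'n) \<Rightarrow> (nat \<Rightarrow> real^'n^'n)
    \<Rightarrow> real^'n^'n \<Rightarrow> real^'n^'n \<Rightarrow> ('n::finite, 'm::finite) policy \<Rightarrow> bool" where
  "bwd_optimal N A B Q \<Sigma>0 \<Sigma>N p \<longleftrightarrow>
     bwd_admissible N A B Q \<Sigma>0 \<Sigma>N p \<and>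
     (\<forall>q. bwd_admissible N A B Q \<Sigma>0 \<Sigma>N q \<longrightarrow> bwd_cost N A B Q \<Sigma>N p \<le> bwd_cost N A B Q \<Sigma>N q)"

text \<open>Uniqueness is that of conditional densities: up to null sets of the state distribution
  (under the competing policy) and Lebesgue null sets of controls.\<close>

definition bwd_unique_optimal ::
  "nat \<Rightarrow> (nat \<Rightarrow> real^'n^'n) \<Rightarrow> (nat \<Rightarrow> real^'m^'n) \<Rightarrow> (nat \<Rightarrow> real^'n^'n)
    \<Rightarrow> real^'n^'n \<Rightarrow> real^'n^'n \<Rightarrow> ('n::finite, 'm::finite) policy \<Rightarrow> bool" where
  "bwd_unique_optimal N A B Q \<Sigma>0 \<Sigma>N p \<longleftrightarrow>
     bwd_optimal N A B Q \<Sigma>0 \<Sigma>N p \<and>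
     (\<forall>q. bwd_optimal N A B Q \<Sigma>0 \<Sigma>N q \<longrightarrow>
        (\<forall>k<N. AE x in distr (bwd_law N A B \<Sigma>N q) borel (bwd_state N A B (Suc k)).
           AE v in lborel. q k x v = p k x v))"

end

theory Submission
  imports Defs
begin

text \<open>Write \<open>x\<close>, \<open>y\<close> for two consecutive states and \<open>v\<close> for the control between them, so that
  \<open>y = A x + B v\<close> with the invertible closed loop matrix \<open>A\<close>.  Everything follows from two
  completions of squares, one for each Riccati recursion, with \<open>W = I - B\<^sup>T H B\<close>,
  \<open>V = I + B\<^sup>T \<Pi> B\<close> and \<open>K = - V\<^sup>-\<^sup>1 B\<^sup>T \<Pi> A\<close> (\<open>riccati_quadratic_identity\<close> and
  \<open>feedback_quadratic_identity\<close>):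

  \<^item> \<open>|v|\<^sup>2 + x\<^sup>T J x = y\<^sup>T H y + (v - B\<^sup>T H y)\<^sup>T W\<^sup>-\<^sup>1 (v - B\<^sup>T H y)\<close>,
  \<^item> \<open>|v|\<^sup>2 + y\<^sup>T \<Pi> y = x\<^sup>T P x + (v - K x)\<^sup>T V (v - K x)\<close>.

  Duality.  The matrix \<open>A\<^sup>-\<^sup>T J A\<^sup>-\<^sup>1 = H + H B W\<^sup>-\<^sup>1 B\<^sup>T H\<close> is formally \<open>(H\<^sup>-\<^sup>1 - B B\<^sup>T)\<^sup>-\<^sup>1\<close>, and
  adding \<open>B B\<^sup>T\<close> to its inverse leads back to \<open>H\<close>.  \<open>riccati_duality\<close> makes this precise
  without inverting \<open>H\<close>; the second pair of recursions is the case of \<open>- \<Pi>\<close>.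

  Optimality.  The first identity telescopes along a path.  It turns the cost into terms that
  depend on the two end states only, plus the terms
  \<open>- ln \<varpi>\<^sup>*(v | y) - entropy of the policy at y\<close>.  The end states have prescribed distributions, so up
  to a constant the cost of every admissible policy is the sum over time of its expected
  relative entropies with respect to \<open>\<varpi>\<^sup>*\<close> (\<open>bwd_cost_decomposition\<close>).  These are nonnegative and
  vanish only for \<open>\<varpi>\<^sup>*\<close>.  The delicate point is integrability: only the total cost is known to be
  integrable, not its summands.  Removing the controls one at a time, the most recently drawn one
  first, solves this: given the past, all earlier terms are constants, so Fubini's theorem
  for the total controls the one remaining term (\<open>relative_entropy_peel\<close>).

  State distributions.  The sum of the two identities reads
  \<open>y\<^sup>T (\<Pi> + H) y + (v - B\<^sup>T H y)\<^sup>T W\<^sup>-\<^sup>1 (v - B\<^sup>T H y) = x\<^sup>T M x + (v - K x)\<^sup>T V (v - K x)\<close>, where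
  \<open>M = J + P\<close> is the matrix \<open>\<Pi> + H\<close> one step earlier.  Hence positive definiteness of
  \<open>\<Pi> + H\<close> propagates backwards in time, and a joint Gaussian law of \<open>(x, y)\<close> has two
  disintegrations: the law \<open>N(0, (\<Pi> + H)\<^sup>-\<^sup>1)\<close> of \<open>y\<close> followed by the backward policy, and
  the law \<open>N(0, M\<^sup>-\<^sup>1)\<close> of \<open>x\<close> followed by the forward policy (\<open>gaussian_time_reversal\<close>).  The two
  processes therefore have the same Gaussian marginals at every time.\<close>

section \<open>Matrices and the duality of the two Riccati recursions\<close>

lemma inner_transpose_mv: "x \<bullet> (transpose M *v y) = (M *v x) \<bullet> (y :: real^'n)" for M :: "real^'m^'n"
  by (simp add: dot_lmul_matrix[symmetric] inner_commute)

text \<open>Transposes stay on the left of a vector, so that all matrix identities can be normalised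
  to nested matrix-vector products and compared pointwise.\<close>

declare transpose_matrix_vector [simp del]

lemma inner_symmetric_mv:
  fixes M :: "real^'n^'n"
  assumes "transpose M = M"
  shows "x \<bullet> (M *v y) = (M *v x) \<bullet> y"
  using inner_transpose_mv[of x M y] assms by simp

lemma neg_matrix_vector_mult: "(- M) *v x = - (M *v x)" for M :: "real^'m^'n"
  by (simp add: matrix_vector_mult_def vec_eq_iff sum_negf)

lemma matrix_vector_mult_neg: "M *v (- x) = - (M *v x)" for M :: "real^'m^'n"
  by (simp add: matrix_vector_mult_def vec_eq_iff sum_negf)

lemmas mv_simps = matrix_vector_mul_assoc[symmetric] matrix_vector_right_distrib
  matrix_vector_mult_diff_distrib matrix_vector_mult_add_rdistrib
  matrix_vector_mult_diff_rdistrib neg_matrix_vector_mult matrix_vector_mult_neg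

lemma matrix_mul_assoc_subst:
  fixes T J' K Y :: "real^'n^'n" and X :: "real^'n^'k"
  assumes "T ** J' ** K = Y"
  shows "X ** T ** J' ** K = X ** Y"
  using assms by (metis matrix_mul_assoc)

lemma invertible_matrix_inv:
  fixes A :: "real^'n^'n"
  assumes "invertible A"
  shows "A ** matrix_inv A = mat 1" "matrix_inv A ** A = mat 1"
  using someI_ex[of "\<lambda>A'. A ** A' = mat 1 \<and> A' ** A = mat 1"] assms
  unfolding invertible_def matrix_inv_def by auto

lemma matrix_inv_vector:
  fixes A :: "real^'n^'n"
  assumes "invertible A"
  shows "A *v (matrix_inv A *v x) = x" "matrix_inv A *v (A *v x) = x"
  by (simp_all add: matrix_vector_mul_assoc invertible_matrix_inv[OF assms])

lemma right_inverse_matrix_inv: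
  fixes A B :: "real^'n^'n"
  assumes "A ** B = mat 1"
  shows "invertible A" "matrix_inv A = B"
proof -
  show inv: "invertible A"
    using assms by (auto simp: invertible_right_inverse)
  have "matrix_inv A = matrix_inv A ** (A ** B)" using assms by simp
  then show "matrix_inv A = B"
    by (simp add: matrix_mul_assoc invertible_matrix_inv[OF inv])
qed

lemma invertible_matrix_inv_self:
  fixes A :: "real^'n^'n"
  assumes "invertible A"
  shows "invertible (matrix_inv A)" "matrix_inv (matrix_inv A) = A"
  using right_inverse_matrix_inv[OF invertible_matrix_inv(2)[OF assms]] by auto

lemma matrix_inv_uminus:
  fixes A :: "real^'n^'n"
  assumes "invertible A"
  shows "invertible (- A)" "matrix_inv (- A) = - matrix_inv A"
proof -
  have "(- A) ** (- matrix_inv A) = mat 1"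
    by (simp add: matrix_eq mv_simps matrix_inv_vector[OF assms])
  then show "invertible (- A)" "matrix_inv (- A) = - matrix_inv A"
    using right_inverse_matrix_inv by blast+
qed

lemma transpose_matrix_inv:
  fixes A :: "real^'n^'n"
  assumes "invertible A"
  shows "transpose (matrix_inv A) = matrix_inv (transpose A)"
proof -
  have "transpose A ** transpose (matrix_inv A) = transpose (matrix_inv A ** A)"
    by (simp add: matrix_transpose_mul)
  then have "transpose A ** transpose (matrix_inv A) = mat 1"
    by (simp add: invertible_matrix_inv[OF assms])
  then show ?thesis using right_inverse_matrix_inv by metis
qed

lemma pos_def_transpose: "pos_def C \<Longrightarrow> transpose C = C"
  by (simp add: pos_def_def)

lemma pos_def_nonneg: "pos_def C \<Longrightarrow> 0 \<le> x \<bullet> (C *v x)"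
  by (cases "x = 0") (auto simp: pos_def_def less_imp_le)

lemma pos_def_invertible:
  fixes C :: "real^'n^'n"
  assumes "pos_def C"
  shows "invertible C"
proof -
  have "inj ((*v) C)"
  proof (rule injI)
    fix x y assume "C *v x = C *v y"
    then have "C *v (x - y) = 0" by (simp add: mv_simps)
    then have "(x - y) \<bullet> (C *v (x - y)) = 0" by simp
    then have "x - y = 0" using assms unfolding pos_def_def by (metis less_irrefl)
    then show "x = y" by simp
  qed
  then show ?thesis
    using matrix_left_invertible_injective[of C] invertible_left_inverse[of C] by blast
qed

lemma pos_def_matrix_inv:
  fixes C :: "real^'n^'n"
  assumes "pos_def C"
  shows "pos_def (matrix_inv C)"
  unfolding pos_def_def
proof (intro conjI allI impI)
  have inv: "invertible C" by (rule pos_def_invertible[OF assms])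
  have sym: "transpose C = C" using assms by (rule pos_def_transpose)
  show "transpose (matrix_inv C) = matrix_inv C"
    by (simp add: transpose_matrix_inv[OF inv] sym)
  fix x :: "real^'n" assume "x \<noteq> 0"
  define y where "y = matrix_inv C *v x"
  have x: "x = C *v y" by (simp add: y_def matrix_inv_vector[OF inv])
  with \<open>x \<noteq> 0\<close> have "y \<noteq> 0" by auto
  then have "0 < y \<bullet> (C *v y)" using assms by (simp add: pos_def_def)
  then show "0 < x \<bullet> (matrix_inv C *v x)"
    unfolding y_def[symmetric] by (simp add: x inner_commute)
qed

text \<open>Gram-Schmidt for the inner product that \<open>M\<close> defines: a family indexed by a proper subset
  of the coordinates cannot span, so it can be extended by a vector outside its span after
  subtracting the components of that vector.\<close>

lemma pos_def_orthonormal_family: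
  fixes M :: "real^'n^'n" and I :: "'n set"
  assumes M: "pos_def M"
  shows "\<exists>e :: 'n \<Rightarrow> real^'n. \<forall>i\<in>I. \<forall>j\<in>I. e i \<bullet> (M *v e j) = (if i = j then 1 else 0)"
proof -
  have "finite I" by simp
  then show ?thesis
  proof (induction I)
    case empty then show ?case by simp
  next
    case (insert a I)
    then obtain e :: "'n \<Rightarrow> real^'n"
      where e: "\<And>i j. i \<in> I \<Longrightarrow> j \<in> I \<Longrightarrow> e i \<bullet> (M *v e j) = (if i = j then 1 else 0)"
      by blast
    have sym: "x \<bullet> (M *v y) = y \<bullet> (M *v x)" for x y
      using inner_symmetric_mv[OF pos_def_transpose[OF M], of x y] by (simp add: inner_commute)
    have "card (e ` I) \<le> card I" by (simp add: card_image_le)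
    also have "\<dots> < card (UNIV :: 'n set)"
      by (rule psubset_card_mono) (use insert in auto)
    finally have "dim (e ` I) < DIM(real^'n)"
      using dim_le_card[of "e ` I" "e ` I"] by (simp add: span_superset) 
    then have "span (e ` I) \<noteq> UNIV"
      using dim_eq_full[of "e ` I"] by simp
    then obtain x where x: "x \<notin> span (e ` I)" by blast
    define y where "y = x - (\<Sum>i\<in>I. (x \<bullet> (M *v e i)) *\<^sub>R e i)"
    have "(\<Sum>i\<in>I. (x \<bullet> (M *v e i)) *\<^sub>R e i) \<in> span (e ` I)"
      by (intro span_sum span_scale span_base) simp
    with x have "y \<noteq> 0" by (auto simp: y_def)
    then have pos: "0 < y \<bullet> (M *v y)" using M by (simp add: pos_def_def)
    have orth: "y \<bullet> (M *v e j) = 0" if "j \<in> I" for j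
      using that \<open>finite I\<close>
      by (simp add: y_def inner_diff_left inner_sum_left e if_distrib[of "\<lambda>t. _ * t"] cong: if_cong)
    \<comment> \<open>The new vector is normalised so that its own quadratic form is 1.\<close>
    define e' where "e' = e(a := (1 / sqrt (y \<bullet> (M *v y))) *\<^sub>R y)"
    have "e' a \<bullet> (M *v e' a) = 1"
      using pos by (simp add: e'_def matrix_vector_mult_scaleR real_sqrt_mult_self field_simps flip: power2_eq_square)
    moreover have "e' a \<bullet> (M *v e' j) = 0" "e' j \<bullet> (M *v e' a) = 0" if "j \<in> I" for j
      using that insert.hyps orth[OF that] sym[of "e j" y]
      by (auto simp: e'_def matrix_vector_mult_scaleR)
    moreover have "e' i = e i" if "i \<in> I" for i
      using that insert.hyps by (auto simp: e'_def)
    ultimately show ?case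
      using e insert.hyps by (intro exI[of _ e']) auto
  qed
qed

text \<open>The columns of \<open>L\<close> are orthonormal for the inner product given by the inverse of \<open>C\<close>.  This
  replaces the spectral theorem: it reduces Gaussian integrals to the standard Gaussian.\<close>

lemma pos_def_factorization:
  fixes C :: "real^'n^'n"
  assumes C: "pos_def C"
  obtains L :: "real^'n^'n" where "invertible L" "C = L ** transpose L"
proof -
  define M where "M = matrix_inv C"
  have M: "pos_def M" unfolding M_def by (rule pos_def_matrix_inv[OF C])
  obtain e :: "'n \<Rightarrow> real^'n"
    where e: "\<And>i j. e i \<bullet> (M *v e j) = (if i = j then 1 else 0)"
    using pos_def_orthonormal_family[OF M, of UNIV] by auto
  define L :: "real^'n^'n" where "L = (\<chi> i j. e j $ i)"
  have col: "L *v x = (\<Sum>j\<in>UNIV. x $ j *\<^sub>R e j)" for x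
    by (simp add: L_def matrix_vector_mult_def vec_eq_iff mult.commute)
  have "(L *v x) \<bullet> (M *v (L *v y)) = x \<bullet> y" for x y
  proof -
    have "M *v (L *v y) = (\<Sum>j\<in>UNIV. y $ j *\<^sub>R (M *v e j))"
      by (simp add: col linear_sum[OF matrix_vector_mul_linear] matrix_vector_mult_scaleR)
    then have "(L *v x) \<bullet> (M *v (L *v y)) = (\<Sum>i\<in>UNIV. \<Sum>j\<in>UNIV. x $ i * (y $ j * (e i \<bullet> (M *v e j))))"
      unfolding col[of x] inner_sum_left by (simp add: inner_sum_right sum_distrib_left mult_ac)
    then show ?thesis
      by (simp add: e if_distrib[of "\<lambda>t. _ * t"] cong: if_cong) (simp add: inner_vec_def)
  qed
  then have q: "x \<bullet> (transpose L *v (M *v (L *v y))) = x \<bullet> y" for x y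
    by (simp add: inner_transpose_mv)
  then have "transpose L *v (M *v (L *v y)) = y" for y
    by (metis vector_eq_rdot inner_commute)
  then have LML: "(transpose L ** M) ** L = mat 1"
    by (simp add: matrix_eq mv_simps)
  then have L: "invertible L" "invertible (transpose L ** M)"
    using invertible_left_inverse invertible_right_inverse by blast+
  have "L ** (transpose L ** M) = mat 1"
    using LML matrix_left_right_inverse by blast
  then have "(L ** transpose L) ** M = mat 1" by (simp add: matrix_mul_assoc)
  then have "M ** (L ** transpose L) = mat 1" using matrix_left_right_inverse by blast
  then have "matrix_inv M = L ** transpose L" by (rule right_inverse_matrix_inv)
  then have "C = L ** transpose L"
    by (simp add: M_def invertible_matrix_inv_self pos_def_invertible[OF C])
  then show ?thesis using that[OF L(1)] by blast
qed

text \<open>With \<open>G = B\<^sup>T X B = I - W\<close> one has \<open>Y B = X B W\<^sup>-\<^sup>1 (W + G) = X B W\<^sup>-\<^sup>1\<close>, and symmetrically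
  \<open>W B\<^sup>T Y = B\<^sup>T X\<close>.  These two equations reduce the three claims to cancellation of \<open>W\<close>; they
  are a Woodbury identity that remains valid for singular \<open>X\<close>.\<close>

lemma riccati_duality:
  fixes X :: "real^'n^'n" and B :: "real^'m^'n"
  assumes W: "W = mat 1 - transpose B ** X ** B" and inv: "invertible W"
    and Y: "Y = X + X ** B ** matrix_inv W ** transpose B ** X"
  shows "matrix_inv (mat 1 + transpose B ** Y ** B) = W"
    and "invertible (mat 1 + transpose B ** Y ** B)"
    and "X = Y - Y ** B ** W ** transpose B ** Y"
proof -
  define Bt where "Bt = transpose B"
  note i = matrix_inv_vector[OF inv]
  have G: "Bt *v (X *v (B *v v)) = v - W *v v" for v
    by (simp add: W mv_simps Bt_def)
  have YB: "Y *v (B *v v) = X *v (B *v (matrix_inv W *v v))" for v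
    by (simp add: Y mv_simps G i flip: Bt_def)
  have WBY: "W *v (Bt *v (Y *v v)) = Bt *v (X *v v)" for v
    by (simp add: Y mv_simps G i flip: Bt_def)
  have r: "(mat 1 + transpose B ** Y ** B) ** W = mat 1"
    by (simp add: matrix_eq mv_simps YB G i flip: Bt_def)
  show "matrix_inv (mat 1 + transpose B ** Y ** B) = W"
       "invertible (mat 1 + transpose B ** Y ** B)"
    using right_inverse_matrix_inv[OF r] by auto
  show "X = Y - Y ** B ** W ** transpose B ** Y"
    unfolding matrix_eq
  proof
    fix v
    have "Y *v v = X *v v + X *v (B *v (matrix_inv W *v (Bt *v (X *v v))))"
      by (simp add: Y mv_simps flip: Bt_def)
    moreover have "(Y - Y ** B ** W ** transpose B ** Y) *v v
        = Y *v v - X *v (B *v (matrix_inv W *v (Bt *v (X *v v))))"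
      by (simp add: mv_simps WBY YB flip: Bt_def)
    ultimately show "X *v v = (Y - Y ** B ** W ** transpose B ** Y) *v v" by simp
  qed
qed

section \<open>Linear change of variables for Lebesgue measure\<close>

lemma borel_measurable_matrix_vector_mult [measurable (raw)]:
  fixes A :: "real^'m^'n"
  assumes "f \<in> borel_measurable M"
  shows "(\<lambda>x. A *v f x) \<in> borel_measurable M"
  using assms by (rule borel_measurable_continuous_on[rotated])
    (intro linear_continuous_on matrix_vector_mul_bounded_linear)

lemma borel_measurable_vec_component [measurable (raw)]:
  fixes f :: "'a \<Rightarrow> real^'n"
  assumes "f \<in> borel_measurable M"
  shows "(\<lambda>x. f x $ i) \<in> borel_measurable M"
  using assms by (rule borel_measurable_continuous_on[rotated])
    (intro linear_continuous_on bounded_linear_vec_nth)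

lemma borel_measurable_vec_lambda [measurable (raw)]:
  fixes f :: "'i::finite \<Rightarrow> 'a \<Rightarrow> real"
  assumes "\<And>i. f i \<in> borel_measurable M"
  shows "(\<lambda>x. \<chi> i. f i x) \<in> borel_measurable M"
proof (subst borel_measurable_euclidean_space, intro ballI)
  fix b :: "real^'i" assume "b \<in> Basis"
  then obtain i where "b = axis i 1" by (auto simp: Basis_vec_def)
  then show "(\<lambda>x. (\<chi> i. f i x) \<bullet> b) \<in> borel_measurable M"
    using assms[of i] by (simp add: inner_axis)
qed

text \<open>Lebesgue measure is a product over the basis directions; here one direction is integrated
  first, with the others fixed.\<close>

lemma nn_integral_lborel_slice:
  fixes f :: "'a::euclidean_space \<Rightarrow> ennreal"
  assumes b: "b \<in> Basis" and [measurable]: "f \<in> borel_measurable borel"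
  shows "(\<integral>\<^sup>+ x. f x \<partial>lborel) =
    (\<integral>\<^sup>+ g. (\<integral>\<^sup>+ t. f (t *\<^sub>R b + (\<Sum>j\<in>Basis - {b}. g j *\<^sub>R j)) \<partial>lborel)
      \<partial>(\<Pi>\<^sub>M j\<in>Basis - {b}. lborel))"
proof -
  interpret product_sigma_finite "\<lambda>_::'a. lborel :: real measure" ..
  have B: "insert b (Basis - {b}) = Basis" using b by auto
  have "(\<integral>\<^sup>+ x. f x \<partial>lborel)
      = (\<integral>\<^sup>+ g. f (\<Sum>j\<in>Basis. g j *\<^sub>R j) \<partial>(\<Pi>\<^sub>M j\<in>Basis. lborel))"
    by (subst lborel_eq) (simp add: nn_integral_distr)
  also have "\<dots> = (\<integral>\<^sup>+ g. (\<integral>\<^sup>+ t. f (\<Sum>j\<in>Basis. (g(b := t)) j *\<^sub>R j) \<partial>lborel)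
      \<partial>(\<Pi>\<^sub>M j\<in>Basis - {b}. lborel))"
    using product_nn_integral_insert[of "Basis - {b}" b "\<lambda>g. f (\<Sum>j\<in>Basis. g j *\<^sub>R j)"]
    unfolding B by simp
  finally have "(\<integral>\<^sup>+ x. f x \<partial>lborel) = (\<integral>\<^sup>+ g. (\<integral>\<^sup>+ t. f (\<Sum>j\<in>Basis. (g(b := t)) j *\<^sub>R j) \<partial>lborel)
      \<partial>(\<Pi>\<^sub>M j\<in>Basis - {b}. lborel))" .
  moreover have "(\<Sum>j\<in>Basis. (g(b := t)) j *\<^sub>R j) = t *\<^sub>R b + (\<Sum>j\<in>Basis - {b}. g j *\<^sub>R j)" for g t
    using b by (subst sum.remove[of _ b]) auto
  ultimately show ?thesis by (simp only:)
qed

text \<open>The map \<open>x \<mapsto> x + \<phi>(x) b\<close> moves points along \<open>b\<close> only.  On each line parallel to \<open>b\<close> it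
  is affine with slope \<open>1 + \<phi>(b)\<close>, so the one-dimensional substitution rule suffices.  Shears,
  reflections and coordinate swaps are all composed of such maps.\<close>

lemma nn_integral_lborel_transvection:
  fixes f :: "'a::euclidean_space \<Rightarrow> ennreal"
  assumes b: "b \<in> Basis" and [measurable]: "f \<in> borel_measurable borel"
    and \<phi>: "linear \<phi>" and ne: "1 + \<phi> b \<noteq> 0"
  shows "(\<integral>\<^sup>+ x. f x \<partial>lborel) = ennreal \<bar>1 + \<phi> b\<bar> * (\<integral>\<^sup>+ x. f (x + \<phi> x *\<^sub>R b) \<partial>lborel)"
proof -
  have [measurable]: "\<phi> \<in> borel_measurable borel"
    using \<phi> by (intro borel_measurable_continuous_onI linear_continuous_on) (simp add: linear_conv_bounded_linear)
  let ?y = "\<lambda>g. \<Sum>j\<in>Basis - {b}. g j *\<^sub>R j"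
  have "(\<integral>\<^sup>+ t. f (t *\<^sub>R b + ?y g) \<partial>lborel) =
      ennreal \<bar>1 + \<phi> b\<bar> * (\<integral>\<^sup>+ t. f (t *\<^sub>R b + ?y g + \<phi> (t *\<^sub>R b + ?y g) *\<^sub>R b) \<partial>lborel)"
    for g :: "'a \<Rightarrow> real"
  proof -
    have "(\<integral>\<^sup>+ t. f (t *\<^sub>R b + ?y g) \<partial>lborel) =
      ennreal \<bar>1 + \<phi> b\<bar> * (\<integral>\<^sup>+ t. f ((\<phi> (?y g) + (1 + \<phi> b) * t) *\<^sub>R b + ?y g) \<partial>lborel)"
      by (rule nn_integral_real_affine[OF _ ne]) measurable
    moreover have "(\<phi> (?y g) + (1 + \<phi> b) * t) *\<^sub>R b + ?y g = t *\<^sub>R b + ?y g + \<phi> (t *\<^sub>R b + ?y g) *\<^sub>R b" for t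
      using \<phi> by (simp add: linear_add linear_scale algebra_simps)
    ultimately show ?thesis by (simp only:)
  qed
  then show ?thesis
    using b by (simp add: nn_integral_lborel_slice[OF b] nn_integral_cmult)
qed

lemma nn_integral_lborel_add_component:
  fixes f :: "real^'n \<Rightarrow> ennreal"
  assumes [measurable]: "f \<in> borel_measurable borel" and "m \<noteq> n"
  shows "(\<integral>\<^sup>+ x. f x \<partial>lborel) = (\<integral>\<^sup>+ x. f (x + (c * x $ n) *\<^sub>R axis m 1) \<partial>lborel)"
proof -
  have "linear (\<lambda>x :: real^'n. c * x $ n)" by (rule linearI) (auto simp: algebra_simps)
  from nn_integral_lborel_transvection[OF _ assms(1) this, of "axis m 1"] assms(2) show ?thesis
    by (simp add: axis_in_Basis_iff) (simp add: axis_def)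
qed

lemma nn_integral_lborel_diagonal:
  fixes f :: "real^'n \<Rightarrow> ennreal" and A :: "real^'n^'n"
  assumes [measurable]: "f \<in> borel_measurable borel"
    and diag: "\<And>i j. i \<noteq> j \<Longrightarrow> A $ i $ j = 0" and ne: "det A \<noteq> 0"
  shows "(\<integral>\<^sup>+ x. f x \<partial>lborel) = ennreal \<bar>det A\<bar> * (\<integral>\<^sup>+ x. f (A *v x) \<partial>lborel)"
proof -
  have det: "det A = (\<Prod>i\<in>UNIV. A $ i $ i)" by (rule det_diagonal[OF diag])
  define c where "c j = (A *v j) \<bullet> j" for j
  have c: "c (axis i 1) = A $ i $ i" for i
    by (simp add: c_def inner_axis matrix_vector_mult_basis column_def)
  have Ax: "A *v x = 0 + (\<Sum>j\<in>Basis. (c j * (x \<bullet> j)) *\<^sub>R j)" for x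
  proof -
    have "(A *v x) $ i = (0 + (\<Sum>j\<in>Basis. (c j * (x \<bullet> j)) *\<^sub>R j)) $ i" for i
    proof -
      have "(A *v x) $ i = A $ i $ i * x $ i"
        by (simp add: matrix_vector_mult_def sum.remove[of _ i] diag)
      moreover have "(\<Sum>j\<in>Basis. (c j * (x \<bullet> j)) *\<^sub>R j) $ i = c (axis i 1) * x $ i"
        unfolding cart_eq_inner_axis[of _ i]
        by (simp add: inner_sum_left_Basis axis_in_Basis_iff)
      ultimately show ?thesis by (simp add: c)
    qed
    then show ?thesis by (simp add: vec_eq_iff)
  qed
  have B: "(Basis :: (real^'n) set) = range (\<lambda>i. axis i 1)"
    by (auto simp: Basis_vec_def)
  have "inj (\<lambda>i::'n. axis i (1::real))" by (auto simp: inj_def axis_eq_axis)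
  then have prod: "(\<Prod>j\<in>Basis. \<bar>c j\<bar>) = \<bar>det A\<bar>"
    by (simp add: B prod.reindex c det abs_prod)
  have c0: "c j \<noteq> 0" if "j \<in> Basis" for j
    using that ne unfolding B det by (auto simp: c)
  have "lborel = density (distr lborel borel (\<lambda>x. A *v x)) (\<lambda>_. ennreal \<bar>det A\<bar>)"
    using lborel_affine_euclidean[of c 0] c0 unfolding Ax[symmetric] prod[symmetric]
    by (simp add: prod_ennreal)
  then have "(\<integral>\<^sup>+ x. f x \<partial>lborel) = (\<integral>\<^sup>+ x. f x \<partial>density (distr lborel borel (\<lambda>x. A *v x)) (\<lambda>_. ennreal \<bar>det A\<bar>))"
    by simp
  then show ?thesis
    by (simp add: nn_integral_density nn_integral_distr nn_integral_cmult)
qed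

text \<open>Up to a sign, a swap of two coordinates is a product of three shears.\<close>

lemma nn_integral_lborel_swap:
  fixes f :: "real^'n \<Rightarrow> ennreal"
  assumes [measurable]: "f \<in> borel_measurable borel" and mn: "m \<noteq> n"
  shows "(\<integral>\<^sup>+ x. f x \<partial>lborel) = (\<integral>\<^sup>+ x. f (\<chi> i. x $ Transposition.transpose m n i) \<partial>lborel)"
proof -
  note nm = mn[symmetric]
  let ?add = "\<lambda>c i j x. x + (c * x $ j) *\<^sub>R axis i 1 :: real^'n"
  have lin: "linear (\<lambda>x :: real^'n. - 2 * x $ n)"
    by (rule linearI) (auto simp: algebra_simps)
  \<comment> \<open>Three shears give the swap with one coordinate negated; this reflection corrects the sign.\<close>
  let ?neg = "\<lambda>x :: real^'n. x + (- 2 * x $ n) *\<^sub>R axis n 1"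
  have "(\<integral>\<^sup>+ x. f x \<partial>lborel) = (\<integral>\<^sup>+ x. f (?neg x) \<partial>lborel)"
    using nn_integral_lborel_transvection[OF _ assms(1) lin, of "axis n 1"]
    by (simp add: axis_in_Basis_iff)
  also have "\<dots> = (\<integral>\<^sup>+ x. f (?neg (?add 1 m n x)) \<partial>lborel)"
    by (rule nn_integral_lborel_add_component[OF _ mn, of "\<lambda>x. f (?neg x)"]; measurable)
  also have "\<dots> = (\<integral>\<^sup>+ x. f (?neg (?add 1 m n (?add (- 1) n m x))) \<partial>lborel)"
    by (rule nn_integral_lborel_add_component[OF _ nm, of "\<lambda>x. f (?neg (?add 1 m n x))"]; measurable)
  also have "\<dots> = (\<integral>\<^sup>+ x. f (?neg (?add 1 m n (?add (- 1) n m (?add 1 m n x)))) \<partial>lborel)"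
    by (rule nn_integral_lborel_add_component[OF _ mn, of "\<lambda>x. f (?neg (?add 1 m n (?add (- 1) n m x)))"]; measurable)
  finally have "(\<integral>\<^sup>+ x. f x \<partial>lborel) = (\<integral>\<^sup>+ x. f (?neg (?add 1 m n (?add (- 1) n m (?add 1 m n x)))) \<partial>lborel)" .
  moreover have "?neg (?add 1 m n (?add (- 1) n m (?add 1 m n x))) = (\<chi> i. x $ Transposition.transpose m n i)" for x
    using mn by (auto simp: vec_eq_iff axis_def Transposition.transpose_def)
  ultimately show ?thesis by (simp only:)
qed

text \<open>The class of matrices that satisfy the formula is closed under row operations and column
  swaps, and contains the diagonal matrices, so Gaussian elimination reaches every invertible matrix.\<close>

theorem nn_integral_lborel_matrix:
  fixes f :: "real^'n \<Rightarrow> ennreal" and A :: "real^'n^'n"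
  assumes "f \<in> borel_measurable borel" and "invertible A"
  shows "(\<integral>\<^sup>+ x. f x \<partial>lborel) = ennreal \<bar>det A\<bar> * (\<integral>\<^sup>+ x. f (A *v x) \<partial>lborel)"
proof -
  have "det A \<noteq> 0 \<longrightarrow> (\<forall>f :: real^'n \<Rightarrow> ennreal. f \<in> borel_measurable borel \<longrightarrow>
    (\<integral>\<^sup>+ x. f x \<partial>lborel) = ennreal \<bar>det A\<bar> * (\<integral>\<^sup>+ x. f (A *v x) \<partial>lborel))" (is "?P A")
  proof (induction A rule: induct_matrix_row_operations)
    case (1 A i)
    then show ?case by (simp add: det_zero_row row_def vec_eq_iff)
  next
    case (2 A)
    then show ?case using nn_integral_lborel_diagonal by blast
  next
    case (3 A m n)
    let ?A = "\<chi> i j. A $ i $ Transposition.transpose m n j"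
    let ?S = "\<lambda>x :: real^'n. \<chi> i. x $ Transposition.transpose m n i"
    have det: "\<bar>det ?A\<bar> = \<bar>det A\<bar>"
      using 3 by (simp add: det_permute_columns permutes_swap_id sign_swap_id abs_mult)
    have Ax: "?A *v x = A *v ?S x" for x
      unfolding matrix_vector_mult_def
      by (auto simp: vec_eq_iff intro!: sum.reindex_bij_witness[of _ "Transposition.transpose m n" "Transposition.transpose m n"])
    show ?case
    proof (intro impI allI)
      fix f :: "real^'n \<Rightarrow> ennreal" assume "det ?A \<noteq> 0" and f[measurable]: "f \<in> borel_measurable borel"
      then have "det A \<noteq> 0" using det by linarith
      then have "(\<integral>\<^sup>+ x. f x \<partial>lborel) = ennreal \<bar>det A\<bar> * (\<integral>\<^sup>+ x. f (A *v x) \<partial>lborel)"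
        using 3(1) f by blast
      also have "(\<integral>\<^sup>+ x. f (A *v x) \<partial>lborel) = (\<integral>\<^sup>+ x. f (A *v ?S x) \<partial>lborel)"
        using 3(2) by (intro nn_integral_lborel_swap) auto
      finally show "(\<integral>\<^sup>+ x. f x \<partial>lborel) = ennreal \<bar>det ?A\<bar> * (\<integral>\<^sup>+ x. f (?A *v x) \<partial>lborel)"
        unfolding det Ax .
    qed
  next
    case (4 A m n c)
    let ?A = "\<chi> i. if i = m then row m A + c *\<^sub>R row n A else row i A"
    have det: "det ?A = det A" using 4(2) det_row_operation[of m n A c] by (simp add: scalar_mult_eq_scaleR cong: if_cong)
    have Ax: "?A *v x = A *v x + (c * (A *v x) $ n) *\<^sub>R axis m 1" for x
      by (auto simp: vec_eq_iff matrix_vector_mul_component row_def axis_def inner_left_distrib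
          vec_lambda_eta)
    show ?case
    proof (intro impI allI)
      fix f :: "real^'n \<Rightarrow> ennreal" assume ne: "det ?A \<noteq> 0" and f[measurable]: "f \<in> borel_measurable borel"
      have "(\<integral>\<^sup>+ x. f x \<partial>lborel) = (\<integral>\<^sup>+ x. f (x + (c * x $ n) *\<^sub>R axis m 1) \<partial>lborel)"
        by (rule nn_integral_lborel_add_component[OF f]) (use 4 in auto)
      also have "\<dots> = ennreal \<bar>det A\<bar> * (\<integral>\<^sup>+ x. f (A *v x + (c * (A *v x) $ n) *\<^sub>R axis m 1) \<partial>lborel)"
      proof -
        have "(\<lambda>x :: real^'n. f (x + (c * x $ n) *\<^sub>R axis m 1)) \<in> borel_measurable borel" by measurable
        with 4 ne show ?thesis unfolding det by blast
      qed
      finally show "(\<integral>\<^sup>+ x. f x \<partial>lborel) = ennreal \<bar>det ?A\<bar> * (\<integral>\<^sup>+ x. f (?A *v x) \<partial>lborel)"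
        unfolding det Ax .
    qed
  qed
  then show ?thesis using assms invertible_det_nz[of A] by blast
qed

lemma nn_integral_lborel_add:
  fixes f :: "'a::euclidean_space \<Rightarrow> ennreal"
  assumes [measurable]: "f \<in> borel_measurable borel"
  shows "(\<integral>\<^sup>+ x. f (c + x) \<partial>lborel) = (\<integral>\<^sup>+ x. f x \<partial>lborel)"
  by (subst (2) lborel_distr_plus[symmetric, of c]) (simp add: nn_integral_distr)

section \<open>Multivariate Gaussian densities\<close>

abbreviation gaussian_measure :: "real^'d \<Rightarrow> real^'d^'d \<Rightarrow> (real^'d) measure" where
  "gaussian_measure \<mu> C \<equiv> density lborel (\<lambda>x. ennreal (gaussian_density \<mu> C x))"

lemma borel_measurable_gaussian_density [measurable (raw)]:
  assumes [measurable]: "f \<in> borel_measurable M" "g \<in> borel_measurable M"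
  shows "(\<lambda>x. gaussian_density (f x) C (g x)) \<in> borel_measurable M"
  unfolding gaussian_density_def by measurable

lemma pos_def_det_pos:
  fixes C :: "real^'d^'d"
  assumes "pos_def C"
  shows "0 < det C"
proof -
  obtain L :: "real^'d^'d" where L: "invertible L" "C = L ** transpose L"
    using pos_def_factorization[OF assms] by metis
  then have "det C = (det L)\<^sup>2" by (simp add: det_mul power2_eq_square)
  then show ?thesis using L(1) invertible_det_nz[of L] by simp
qed

lemma gaussian_density_pos:
  assumes "pos_def C" shows "0 < gaussian_density \<mu> C x"
  using pos_def_det_pos[OF assms] by (simp add: gaussian_density_def)

lemma gaussian_density_nonneg [simp]:
  assumes "pos_def C" shows "0 \<le> gaussian_density \<mu> C x"
  using gaussian_density_pos[OF assms] by (simp add: less_imp_le)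

lemma gaussian_density_translate: "gaussian_density (\<mu> + c) C (x + c) = gaussian_density \<mu> C x"
  by (simp add: gaussian_density_def)

lemma pos_def_mat_1: "pos_def (mat 1)"
  by (simp add: pos_def_def)

lemma invertible_mult_transpose_pos_def:
  fixes L :: "real^'n^'n"
  assumes "invertible L" shows "pos_def (L ** transpose L)"
  unfolding pos_def_def
proof (intro conjI allI impI)
  show "transpose (L ** transpose L) = L ** transpose L" by (simp add: matrix_transpose_mul)
  fix x :: "real^'n" assume "x \<noteq> 0"
  have "invertible (transpose L)" using assms by (rule transpose_invertible)
  then have "transpose L *v x \<noteq> 0"
    using \<open>x \<noteq> 0\<close> matrix_inv_vector(2) by (metis matrix_vector_mult_0_right)
  then have "0 < (transpose L *v x) \<bullet> (transpose L *v x)" by simp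
  then show "0 < x \<bullet> (L ** transpose L *v x)"
    using inner_transpose_mv[of x "transpose L" "transpose L *v x"]
    by (simp add: matrix_vector_mul_assoc[symmetric])
qed

text \<open>The change of variables \<open>x \<mapsto> \<mu> + L x\<close> turns the density with covariance \<open>L L\<^sup>T\<close> into the standard
  one; the Jacobian cancels the square root of the determinant of the covariance.\<close>

lemma gaussian_density_standard:
  fixes L :: "real^'d^'d"
  assumes L: "invertible L"
  shows "\<bar>det L\<bar> * gaussian_density \<mu> (L ** transpose L) (\<mu> + L *v x) = gaussian_density 0 (mat 1) x"
proof -
  let ?C = "L ** transpose L"
  have Lt: "invertible (transpose L)" using L by (rule transpose_invertible)
  have "?C *v (matrix_inv (transpose L) *v (matrix_inv L *v y)) = y" for y
    by (simp add: mv_simps matrix_inv_vector[OF L] matrix_inv_vector[OF Lt])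
  then have "?C ** (matrix_inv (transpose L) ** matrix_inv L) = mat 1"
    by (simp add: matrix_eq mv_simps)
  then have inv: "matrix_inv ?C = transpose (matrix_inv L) ** matrix_inv L"
    using right_inverse_matrix_inv(2) by (metis transpose_matrix_inv[OF L])
  have q: "(L *v x) \<bullet> (matrix_inv ?C *v (L *v x)) = x \<bullet> x"
    by (simp add: inv mv_simps matrix_inv_vector[OF L] inner_transpose_mv)
  have "det ?C = (det L)\<^sup>2" by (simp add: det_mul power2_eq_square)
  then have "sqrt ((2 * pi) ^ CARD('d) * det ?C) = sqrt ((2 * pi) ^ CARD('d)) * \<bar>det L\<bar>"
    by (simp add: real_sqrt_mult)
  moreover have "matrix_inv (mat 1 :: real^'d^'d) = mat 1"
    by (rule right_inverse_matrix_inv) simp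
  moreover have "det L \<noteq> 0" using L by (simp add: invertible_det_nz)
  ultimately show ?thesis by (simp add: gaussian_density_def q)
qed

lemma standard_gaussian_prod:
  fixes x :: "real^'d"
  shows "gaussian_density 0 (mat 1) x = (\<Prod>b\<in>Basis. std_normal_density (x \<bullet> b))"
proof -
  have "matrix_inv (mat 1 :: real^'d^'d) = mat 1"
    by (rule right_inverse_matrix_inv) simp
  moreover have "(\<Prod>b\<in>Basis. std_normal_density (x \<bullet> b))
      = (1 / sqrt (2 * pi)) ^ CARD('d) * exp (\<Sum>b\<in>Basis. - (x \<bullet> b)\<^sup>2 / 2)"
    unfolding std_normal_density_def prod.distrib by (simp add: exp_sum)
  moreover have "(\<Sum>b\<in>Basis. - (x \<bullet> b)\<^sup>2 / 2) = - (x \<bullet> x) / 2"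
    using euclidean_inner[of x x] by (simp add: sum_divide_distrib sum_negf power2_eq_square)
  moreover have "sqrt ((2 * pi) ^ CARD('d)) = sqrt (2 * pi) ^ CARD('d)" by (rule real_sqrt_power)
  ultimately show ?thesis
    by (simp add: gaussian_density_def power_divide del: power_mult_distrib)
qed

lemma nn_integral_standard_gaussian: "(\<integral>\<^sup>+ x. ennreal (gaussian_density 0 (mat 1) x) \<partial>lborel) = 1"
proof -
  have 1: "(\<integral>\<^sup>+ t. ennreal (std_normal_density t) \<partial>lborel) = 1"
    by (subst nn_integral_eq_integral) auto
  show ?thesis
    unfolding standard_gaussian_prod
    by (subst prod_ennreal[symmetric], simp, subst nn_integral_lborel_prod) (simp_all add: 1)
qed

lemma nn_integral_gaussian_affine:
  fixes L :: "real^'d^'d"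
  assumes L: "invertible L" and [measurable]: "f \<in> borel_measurable borel"
  shows "(\<integral>\<^sup>+ x. ennreal (gaussian_density \<mu> (L ** transpose L) x) * f x \<partial>lborel)
    = (\<integral>\<^sup>+ x. ennreal (gaussian_density 0 (mat 1) x) * f (\<mu> + L *v x) \<partial>lborel)"
proof -
  note nn = gaussian_density_nonneg[OF invertible_mult_transpose_pos_def[OF L]]
  let ?g = "\<lambda>x. ennreal (gaussian_density \<mu> (L ** transpose L) x) * f x"
  have "(\<integral>\<^sup>+ x. ?g x \<partial>lborel) = (\<integral>\<^sup>+ x. ?g (\<mu> + x) \<partial>lborel)"
    by (rule nn_integral_lborel_add[symmetric]) measurable
  also have "\<dots> = ennreal \<bar>det L\<bar> * (\<integral>\<^sup>+ x. ?g (\<mu> + L *v x) \<partial>lborel)"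
    by (rule nn_integral_lborel_matrix[OF _ L]) measurable
  also have "\<dots> = (\<integral>\<^sup>+ x. ennreal \<bar>det L\<bar> * ?g (\<mu> + L *v x) \<partial>lborel)"
    by (rule nn_integral_cmult[symmetric]) measurable
  also have "\<dots> = (\<integral>\<^sup>+ x. ennreal (gaussian_density 0 (mat 1) x) * f (\<mu> + L *v x) \<partial>lborel)"
    by (simp add: gaussian_density_standard[OF L, symmetric, of _ \<mu>] ennreal_mult' nn mult.assoc)
  finally show ?thesis .
qed

lemma gaussian_measure_affine:
  fixes L :: "real^'d^'d"
  assumes L: "invertible L"
  shows "gaussian_measure \<mu> (L ** transpose L)
    = distr (gaussian_measure 0 (mat 1)) borel (\<lambda>x. \<mu> + L *v x)"
proof (rule measure_eqI)
  fix A :: "(real^'d) set" assume "A \<in> sets (gaussian_measure \<mu> (L ** transpose L))"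
  then have [measurable]: "A \<in> sets borel" by simp
  have "emeasure (distr (gaussian_measure 0 (mat 1)) borel (\<lambda>x. \<mu> + L *v x)) A
    = (\<integral>\<^sup>+ x. indicator A x \<partial>distr (gaussian_measure 0 (mat 1)) borel (\<lambda>x. \<mu> + L *v x))"
    by simp
  also have "\<dots> = (\<integral>\<^sup>+ x. ennreal (gaussian_density 0 (mat 1) x) * indicator A (\<mu> + L *v x) \<partial>lborel)"
    by (subst nn_integral_distr, simp_all) (subst nn_integral_density, simp_all)
  finally show "emeasure (gaussian_measure \<mu> (L ** transpose L)) A
      = emeasure (distr (gaussian_measure 0 (mat 1)) borel (\<lambda>x. \<mu> + L *v x)) A"
    by (simp add: emeasure_density nn_integral_gaussian_affine[OF L, of "indicator A"])
qed simp

lemma nn_integral_gaussian: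
  fixes C :: "real^'d^'d"
  assumes "pos_def C"
  shows "(\<integral>\<^sup>+ x. ennreal (gaussian_density \<mu> C x) \<partial>lborel) = 1"
proof -
  obtain L :: "real^'d^'d" where L: "invertible L" "C = L ** transpose L"
    using pos_def_factorization[OF assms] by metis
  show ?thesis
    using nn_integral_gaussian_affine[OF L(1), of "\<lambda>_. 1" \<mu>] nn_integral_standard_gaussian
    by (simp add: L(2))
qed

lemma prob_space_gaussian_measure:
  assumes "pos_def C" shows "prob_space (gaussian_measure \<mu> C)"
  by (rule prob_spaceI) (simp add: emeasure_density nn_integral_gaussian[OF assms])

lemma standard_gaussian_coordinate_square:
  fixes a :: "'d::finite"
  shows "integrable (gaussian_measure 0 (mat 1)) (\<lambda>x :: real^'d. (x $ a)\<^sup>2)"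
    and "(\<integral>x. (x $ a)\<^sup>2 \<partial>gaussian_measure 0 (mat 1 :: real^'d^'d)) = 1"
proof -
  let ?h = "\<lambda>b t. if b = axis a (1::real) then std_normal_density t * t\<^sup>2 else std_normal_density t"
  have one: "(\<integral>\<^sup>+ t. ennreal (std_normal_density t) \<partial>lborel) = 1"
    by (subst nn_integral_eq_integral) auto
  have two: "(\<integral>\<^sup>+ t. ennreal (std_normal_density t * t\<^sup>2) \<partial>lborel) = 1"
    using integrable_std_normal_moment[of 2] integral_std_normal_moment_even[of 1]
    by (subst nn_integral_eq_integral) (auto simp: fact_numeral)
  have "(\<integral>\<^sup>+ x. ennreal ((x $ a)\<^sup>2) \<partial>gaussian_measure 0 (mat 1 :: real^'d^'d))
      = (\<integral>\<^sup>+ x. (\<Prod>b\<in>Basis. ennreal (?h b (x \<bullet> b))) \<partial>(lborel :: (real^'d) measure))"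
  proof (subst nn_integral_density; (measurable)?; intro nn_integral_cong)
    fix x :: "real^'d"
    have a: "axis a 1 \<in> (Basis :: (real^'d) set)" by (simp add: axis_in_Basis_iff)
    have "(\<Prod>b\<in>Basis. ?h b (x \<bullet> b)) = gaussian_density 0 (mat 1) x * (x $ a)\<^sup>2"
      unfolding standard_gaussian_prod
      by (subst (1 2) prod.remove[OF _ a]) (auto simp: inner_axis intro!: prod.cong)
    then show "ennreal (gaussian_density 0 (mat 1) x) * ennreal ((x $ a)\<^sup>2) = (\<Prod>b\<in>Basis. ennreal (?h b (x \<bullet> b)))"
      by (subst prod_ennreal) (auto simp: ennreal_mult' gaussian_density_nonneg[OF pos_def_mat_1])
  qed
  also have "\<dots> = (\<Prod>b\<in>(Basis :: (real^'d) set). \<integral>\<^sup>+ t. ennreal (?h b t) \<partial>lborel)"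
    by (rule nn_integral_lborel_prod) auto
  also have "\<dots> = (\<Prod>b\<in>(Basis :: (real^'d) set). 1)"
  proof (rule prod.cong)
    fix b :: "real^'d"
    show "(\<integral>\<^sup>+ t. ennreal (?h b t) \<partial>lborel) = 1"
      by (cases "b = axis a 1") (simp_all only: one two if_True if_False simp_thms)
  qed simp
  finally have *: "(\<integral>\<^sup>+ x. ennreal ((x $ a)\<^sup>2) \<partial>gaussian_measure 0 (mat 1 :: real^'d^'d)) = ennreal 1"
    by simp
  have "has_bochner_integral (gaussian_measure 0 (mat 1 :: real^'d^'d)) (\<lambda>x. (x $ a)\<^sup>2) 1"
    by (rule has_bochner_integral_nn_integral[OF _ _ _ *]) auto
  then show "integrable (gaussian_measure 0 (mat 1)) (\<lambda>x :: real^'d. (x $ a)\<^sup>2)"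
    "(\<integral>x. (x $ a)\<^sup>2 \<partial>gaussian_measure 0 (mat 1 :: real^'d^'d)) = 1"
    by (auto simp: has_bochner_integral_iff)
qed

text \<open>The diagonal entries are one-dimensional variances.  The other entries vanish because
  the reflection of one coordinate preserves the standard Gaussian but changes their sign.\<close>

lemma standard_gaussian_second_moment:
  fixes a b :: "'d::finite"
  shows "integrable (gaussian_measure 0 (mat 1)) (\<lambda>x :: real^'d. x $ a * x $ b)"
    and "(\<integral>x. x $ a * x $ b \<partial>gaussian_measure 0 (mat 1 :: real^'d^'d)) = (if a = b then 1 else 0)"
proof -
  let ?G = "gaussian_measure 0 (mat 1 :: real^'d^'d)"
  show int: "integrable ?G (\<lambda>x. x $ a * x $ b)"
  proof (rule Bochner_Integration.integrable_bound)
    show "integrable ?G (\<lambda>x. (x $ a)\<^sup>2 + (x $ b)\<^sup>2)"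
      by (intro Bochner_Integration.integrable_add standard_gaussian_coordinate_square)
    have "\<bar>s * t\<bar> \<le> s\<^sup>2 + t\<^sup>2" for s t :: real
    proof -
      have "2 * \<bar>s * t\<bar> \<le> s\<^sup>2 + t\<^sup>2"
        using sum_squares_bound[of "\<bar>s\<bar>" "\<bar>t\<bar>"] by (simp add: abs_mult mult.assoc)
      then show ?thesis by linarith
    qed
    then show "AE x in ?G. norm (x $ a * x $ b) \<le> norm ((x $ a)\<^sup>2 + (x $ b)\<^sup>2)" by simp
  qed measurable
  show "(\<integral>x. x $ a * x $ b \<partial>?G) = (if a = b then 1 else 0)"
  proof (cases "a = b")
    case True
    then show ?thesis
      using standard_gaussian_coordinate_square(2)[of b] by (simp add: power2_eq_square)
  next
    case False
    \<comment> \<open>The reflection of coordinate a; it satisfies \<open>R R\<^sup>T = I\<close>.\<close>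
    define R :: "real^'d^'d" where "R = (\<chi> i j. if i = j then (if i = a then -1 else 1) else 0)"
    have Rv: "R *v x = (\<chi> i. if i = a then - x $ i else x $ i)" for x
      by (auto simp: R_def matrix_vector_mult_def vec_eq_iff if_distrib[of "\<lambda>t. t * _"] cong: if_cong)
    have "transpose R = R" by (auto simp: R_def transpose_def vec_eq_iff)
    moreover have RR: "R ** R = mat 1"
      by (auto simp: matrix_eq mv_simps Rv vec_eq_iff)
    ultimately have "?G = distr ?G borel (\<lambda>x. 0 + R *v x)"
      using gaussian_measure_affine[of R 0] right_inverse_matrix_inv(1)[OF RR] by simp
    then have "(\<integral>x. x $ a * x $ b \<partial>?G) = (\<integral>x. x $ a * x $ b \<partial>distr ?G borel (\<lambda>x. 0 + R *v x))"
      by simp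
    also have "\<dots> = - (\<integral>x. x $ a * x $ b \<partial>?G)"
      using False by (subst integral_distr) (auto simp: Rv)
    finally show ?thesis using False by simp
  qed
qed

lemma gaussian_second_moment:
  fixes C :: "real^'d^'d"
  assumes "pos_def C"
  shows "integrable (gaussian_measure 0 C) (\<lambda>x. x $ i * x $ j)"
    and "(\<integral>x. x $ i * x $ j \<partial>gaussian_measure 0 C) = C $ i $ j"
proof -
  obtain L :: "real^'d^'d" where L: "invertible L" "C = L ** transpose L"
    using pos_def_factorization[OF assms] by metis
  let ?G = "gaussian_measure 0 (mat 1 :: real^'d^'d)"
  have G: "gaussian_measure 0 C = distr ?G borel (\<lambda>x. L *v x)"
    using gaussian_measure_affine[OF L(1), of 0] by (simp add: L(2))
  have e: "(L *v x) $ i * (L *v x) $ j = (\<Sum>a\<in>UNIV. \<Sum>b\<in>UNIV. (L $ i $ a * L $ j $ b) * (x $ a * x $ b))" for x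
    by (simp add: matrix_vector_mult_def sum_product mult_ac)
  show "integrable (gaussian_measure 0 C) (\<lambda>x. x $ i * x $ j)"
    unfolding G
    by (subst integrable_distr_eq, simp, simp, unfold e)
      (intro Bochner_Integration.integrable_sum integrable_mult_right standard_gaussian_second_moment)
  have "(\<integral>x. x $ i * x $ j \<partial>gaussian_measure 0 C)
      = (\<integral>x. (\<Sum>a\<in>UNIV. \<Sum>b\<in>UNIV. (L $ i $ a * L $ j $ b) * (x $ a * x $ b)) \<partial>?G)"
    unfolding G by (subst integral_distr, simp, simp, unfold e) simp
  also have "\<dots> = (\<Sum>a\<in>UNIV. \<Sum>b\<in>UNIV. (L $ i $ a * L $ j $ b) * (\<integral>x. x $ a * x $ b \<partial>?G))"
    by (simp add: Bochner_Integration.integral_sum Bochner_Integration.integrable_sum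
        integrable_mult_right standard_gaussian_second_moment(1))
  also have "\<dots> = C $ i $ j"
    by (simp add: standard_gaussian_second_moment(2) L(2) matrix_matrix_mult_def transpose_def
        if_distrib[of "\<lambda>t. _ * t"] cong: if_cong)
  finally show "(\<integral>x. x $ i * x $ j \<partial>gaussian_measure 0 C) = C $ i $ j" .
qed

lemma integrable_gaussian_quadratic_form:
  fixes C M :: "real^'d^'d"
  assumes "pos_def C"
  shows "integrable (gaussian_measure 0 C) (\<lambda>x. x \<bullet> (M *v x))"
proof -
  have "x \<bullet> (M *v x) = (\<Sum>i\<in>UNIV. \<Sum>j\<in>UNIV. M $ i $ j * (x $ i * x $ j))" for x
    by (simp add: inner_vec_def matrix_vector_mult_def sum_distrib_left mult_ac)
  then show ?thesis
    by (simp add: Bochner_Integration.integrable_sum integrable_mult_right gaussian_second_moment(1)[OF assms])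
qed

lemma second_moment_gaussian:
  fixes C :: "real^'d^'d"
  assumes C: "pos_def C" and [measurable]: "X \<in> borel_measurable M"
    and D: "distr M borel X = gaussian_measure 0 C"
  shows "second_moment M X = C"
proof -
  let ?Y = "\<lambda>x :: real^'d. (\<chi> i j. x $ i * x $ j) :: real^'d^'d"
  have Y: "?Y x = (\<Sum>i\<in>UNIV. \<Sum>j\<in>UNIV. (x $ i * x $ j) *\<^sub>R axis i (axis j 1))" for x
    by (auto simp: vec_eq_iff axis_def if_distrib[of "\<lambda>v. v $ _"] if_distrib[of "\<lambda>t. _ * t"] sum.If_cases cong: if_cong)
  have int: "integrable (gaussian_measure 0 C) ?Y"
    unfolding Y
    by (intro Bochner_Integration.integrable_sum integrable_scaleR_left gaussian_second_moment(1)[OF C])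
  have "second_moment M X = (\<integral>x. ?Y x \<partial>gaussian_measure 0 C)"
    unfolding second_moment_def D[symmetric]
    by (subst integral_distr) (use borel_measurable_integrable[OF int] in simp_all)
  also have "\<dots> = (\<Sum>i\<in>UNIV. \<Sum>j\<in>UNIV. C $ i $ j *\<^sub>R axis i (axis j 1))"
    unfolding Y
    by (simp add: Bochner_Integration.integral_sum Bochner_Integration.integrable_sum
        gaussian_second_moment[OF C])
  also have "\<dots> = C"
  proof -
    have "(\<Sum>b\<in>UNIV. if P then g b else 0) = (if P then (\<Sum>b\<in>UNIV. g b) else 0)"
      for P and g :: "'d \<Rightarrow> real" by simp
    then show ?thesis
      by (simp add: vec_eq_iff axis_def if_distrib[of "\<lambda>v. v $ _"] if_distrib[of "\<lambda>t. _ * t"] cong: if_cong)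
  qed
  finally show ?thesis .
qed

section \<open>Completion of squares and time reversal\<close>

text \<open>For \<open>u = y - B v\<close> and \<open>e = B\<^sup>T X y - v\<close> one has \<open>B\<^sup>T X u = e + W v\<close>.  Hence the term with
  \<open>W\<^sup>-\<^sup>1\<close> in \<open>u\<^sup>T Y u\<close> expands to \<open>e\<^sup>T W\<^sup>-\<^sup>1 e\<close> plus terms without inverses, and these combine
  with \<open>|v|\<^sup>2 + u\<^sup>T X u\<close> to \<open>y\<^sup>T X y\<close>.\<close>

lemma riccati_quadratic_identity:
  fixes X :: "real^'n^'n" and B :: "real^'m^'n"
  assumes symX: "transpose X = X" and W: "W = mat 1 - transpose B ** X ** B" and inv: "invertible W"
    and Y: "Y = X + X ** B ** matrix_inv W ** transpose B ** X"
  shows "v \<bullet> v + (y - B *v v) \<bullet> (Y *v (y - B *v v)) =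
    y \<bullet> (X *v y) + (v - transpose B *v (X *v y)) \<bullet> (matrix_inv W *v (v - transpose B *v (X *v y)))"
proof -
  define Bt where "Bt = transpose B"
  note i = matrix_inv_vector[OF inv]
  have X: "x \<bullet> (X *v z) = (X *v x) \<bullet> z" for x z by (rule inner_symmetric_mv[OF symX])
  have Bt: "x \<bullet> (Bt *v z) = (B *v x) \<bullet> z" for x z unfolding Bt_def by (rule inner_transpose_mv)
  have Bt': "(Bt *v x) \<bullet> z = x \<bullet> (B *v z)" for x z
    using Bt[of z x] by (simp only: inner_commute)
  have Wv: "W *v x = x - Bt *v (X *v (B *v x))" for x
    by (simp add: W mv_simps Bt_def)
  then have G: "Bt *v (X *v (B *v x)) = x - W *v x" for x by simp
  have symW: "x \<bullet> (W *v z) = (W *v x) \<bullet> z" for x z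
    unfolding Wv inner_diff_left inner_diff_right Bt Bt' X ..
  define b where "b = Bt *v (X *v y)"
  define u where "u = y - B *v v"
  define e where "e = b - v"
  have Bu: "Bt *v (X *v u) = e + W *v v"
    by (simp add: u_def e_def b_def mv_simps G)
  have "u \<bullet> (Y *v u) = u \<bullet> (X *v u) + (e + W *v v) \<bullet> (matrix_inv W *v (e + W *v v))"
  proof -
    have "u \<bullet> (X *v (B *v z)) = (Bt *v (X *v u)) \<bullet> z" for z
      unfolding X Bt' ..
    then show ?thesis
      by (simp add: Y mv_simps inner_add_right Bu flip: Bt_def)
  qed
  also have "(e + W *v v) \<bullet> (matrix_inv W *v (e + W *v v)) = e \<bullet> (matrix_inv W *v e) + 2 * (e \<bullet> v) + v \<bullet> (W *v v)"
    using symW[of v "matrix_inv W *v e"]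
    by (simp add: mv_simps i inner_add_left inner_add_right inner_commute)
  also have "u \<bullet> (X *v u) = y \<bullet> (X *v y) - 2 * (v \<bullet> b) + (v \<bullet> v - v \<bullet> (W *v v))"
  proof -
    have "v \<bullet> v - v \<bullet> (W *v v) = (B *v v) \<bullet> (X *v (B *v v))"
      unfolding Wv by (simp add: inner_diff_right Bt)
    moreover have "v \<bullet> b = (B *v v) \<bullet> (X *v y)" "v \<bullet> b = y \<bullet> (X *v (B *v v))"
      unfolding b_def Bt using X[of y "B *v v"] by (simp_all add: inner_commute)
    ultimately show ?thesis
      by (simp add: u_def mv_simps inner_diff_left inner_diff_right)
  qed
  finally have "v \<bullet> v + u \<bullet> (Y *v u) = y \<bullet> (X *v y) + e \<bullet> (matrix_inv W *v e)"
    by (simp add: e_def inner_diff_left inner_diff_right inner_commute algebra_simps)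
  moreover have "e \<bullet> (matrix_inv W *v e) = (v - b) \<bullet> (matrix_inv W *v (v - b))"
  proof -
    have "e = - (v - b)" by (simp add: e_def)
    then show ?thesis by (simp only: matrix_vector_mult_neg inner_minus_left inner_minus_right minus_minus)
  qed
  ultimately show ?thesis by (simp add: u_def b_def flip: Bt_def)
qed

lemma feedback_quadratic_identity:
  fixes Z :: "real^'n^'n" and B :: "real^'m^'n"
  assumes symZ: "transpose Z = Z" and V: "V = mat 1 + transpose B ** Z ** B" and inv: "invertible V"
    and s: "s = matrix_inv V *v (transpose B *v (Z *v a))"
  shows "v \<bullet> v + (a + B *v v) \<bullet> (Z *v (a + B *v v)) =
    a \<bullet> ((Z - Z ** B ** matrix_inv V ** transpose B ** Z) *v a) + (v + s) \<bullet> (V *v (v + s))"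
proof -
  define Bt where "Bt = transpose B"
  note i = matrix_inv_vector[OF inv]
  have Z: "x \<bullet> (Z *v z) = (Z *v x) \<bullet> z" for x z by (rule inner_symmetric_mv[OF symZ])
  have Bt: "x \<bullet> (Bt *v z) = (B *v x) \<bullet> z" for x z unfolding Bt_def by (rule inner_transpose_mv)
  have Bt': "(Bt *v x) \<bullet> z = x \<bullet> (B *v z)" for x z
    using Bt[of z x] by (simp only: inner_commute)
  have Vv: "V *v x = x + Bt *v (Z *v (B *v x))" for x
    by (simp add: V mv_simps Bt_def)
  have symV: "x \<bullet> (V *v z) = (V *v x) \<bullet> z" for x z
    unfolding Vv inner_add_left inner_add_right Bt Bt' Z ..
  define b where "b = Bt *v (Z *v a)"
  have Vs: "V *v s = b" by (simp add: s i b_def Bt_def)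
  have "a \<bullet> ((Z - Z ** B ** matrix_inv V ** transpose B ** Z) *v a) = a \<bullet> (Z *v a) - b \<bullet> s"
  proof -
    have "a \<bullet> (Z *v (B *v z)) = b \<bullet> z" for z
      unfolding b_def Z Bt' ..
    then show ?thesis by (simp add: mv_simps inner_diff_right s flip: Bt_def)
  qed
  moreover have "(v + s) \<bullet> (V *v (v + s)) = v \<bullet> (V *v v) + 2 * (v \<bullet> b) + b \<bullet> s"
    using symV[of s v] by (simp add: mv_simps inner_add_left inner_add_right Vs inner_commute)
  moreover have "(a + B *v v) \<bullet> (Z *v (a + B *v v)) = a \<bullet> (Z *v a) + 2 * (v \<bullet> b) + (v \<bullet> (V *v v) - v \<bullet> v)"
  proof -
    have "v \<bullet> (V *v v) - v \<bullet> v = (B *v v) \<bullet> (Z *v (B *v v))"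
      by (simp add: Vv inner_add_right Bt)
    moreover have "v \<bullet> b = (B *v v) \<bullet> (Z *v a)" "v \<bullet> b = a \<bullet> (Z *v (B *v v))"
      unfolding b_def Bt using Z[of a "B *v v"] by (simp_all add: inner_commute)
    ultimately show ?thesis
      by (simp add: mv_simps inner_add_left inner_add_right)
  qed
  ultimately show ?thesis by simp
qed


lemma joint_quadratic_identity:
  fixes A X Z :: "real^'n^'n" and B :: "real^'m^'n"
  assumes symX: "transpose X = X" and symZ: "transpose Z = Z"
    and W: "W = mat 1 - transpose B ** X ** B" and invW: "invertible W"
    and V: "V = mat 1 + transpose B ** Z ** B" and invV: "invertible V"
    and M: "M = transpose A ** (X + X ** B ** matrix_inv W ** transpose B ** X) ** A
      + transpose A ** (Z - Z ** B ** matrix_inv V ** transpose B ** Z) ** A"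
    and y: "y = A *v x + B *v v" and s: "s = matrix_inv V *v (transpose B *v (Z *v (A *v x)))"
  shows "y \<bullet> ((Z + X) *v y) + (v - transpose B *v (X *v y)) \<bullet> (matrix_inv W *v (v - transpose B *v (X *v y)))
    = x \<bullet> (M *v x) + (v + s) \<bullet> (V *v (v + s))"
proof -
  have "y - B *v v = A *v x" by (simp add: y)
  then have 1: "v \<bullet> v + (A *v x) \<bullet> ((X + X ** B ** matrix_inv W ** transpose B ** X) *v (A *v x)) =
    y \<bullet> (X *v y) + (v - transpose B *v (X *v y)) \<bullet> (matrix_inv W *v (v - transpose B *v (X *v y)))"
    using riccati_quadratic_identity[OF symX W invW refl, of v y] by simp
  have 2: "v \<bullet> v + y \<bullet> (Z *v y) =
    (A *v x) \<bullet> ((Z - Z ** B ** matrix_inv V ** transpose B ** Z) *v (A *v x)) + (v + s) \<bullet> (V *v (v + s))"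
    unfolding y by (rule feedback_quadratic_identity[OF symZ V invV s])
  have "x \<bullet> (transpose A *v z) = (A *v x) \<bullet> z" for z by (rule inner_transpose_mv)
  then have 3: "x \<bullet> (M *v x) = (A *v x) \<bullet> ((X + X ** B ** matrix_inv W ** transpose B ** X) *v (A *v x))
    + (A *v x) \<bullet> ((Z - Z ** B ** matrix_inv V ** transpose B ** Z) *v (A *v x))"
    unfolding M by (simp only: matrix_vector_mult_add_rdistrib matrix_vector_mul_assoc[symmetric] inner_add_right)
  have "y \<bullet> ((Z + X) *v y) = y \<bullet> (Z *v y) + y \<bullet> (X *v y)" by (simp add: mv_simps inner_add_right)
  with 1 2 3 show ?thesis by linarith
qed


text \<open>The left-hand side of \<open>joint_quadratic_identity\<close> is positive unless \<open>y\<close> and \<open>v\<close> vanish, that is,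
  unless \<open>x\<close> and \<open>v\<close> vanish.  On the right-hand side, choosing \<open>v\<close> to annihilate the second square gives
  the claim on \<open>M\<close>, and \<open>x = 0\<close> gives the one on \<open>V\<close>.\<close>

lemma joint_quadratic_pos_def:
  fixes A X Z :: "real^'n^'n" and B :: "real^'m^'n"
  assumes symX: "transpose X = X" and symZ: "transpose Z = Z" and symM: "transpose M = M"
    and W: "W = mat 1 - transpose B ** X ** B" and posW: "pos_def W"
    and V: "V = mat 1 + transpose B ** Z ** B" and invV: "invertible V" and A: "invertible A"
    and M: "M = transpose A ** (X + X ** B ** matrix_inv W ** transpose B ** X) ** A
      + transpose A ** (Z - Z ** B ** matrix_inv V ** transpose B ** Z) ** A"
    and pos: "pos_def (Z + X)"
  shows "pos_def M" "pos_def V"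
proof -
  let ?s = "\<lambda>x. matrix_inv V *v (transpose B *v (Z *v (A *v x)))"
  have posWi: "pos_def (matrix_inv W)" by (rule pos_def_matrix_inv[OF posW])
  have q: "0 < x \<bullet> (M *v x) + (v + ?s x) \<bullet> (V *v (v + ?s x))" if "x \<noteq> 0 \<or> v \<noteq> 0" for x v
  proof -
    define y where "y = A *v x + B *v v"
    let ?d = "v - transpose B *v (X *v y)"
    have "x \<bullet> (M *v x) + (v + ?s x) \<bullet> (V *v (v + ?s x))
        = y \<bullet> ((Z + X) *v y) + ?d \<bullet> (matrix_inv W *v ?d)"
      by (rule joint_quadratic_identity[OF symX symZ W pos_def_invertible[OF posW] V invV M y_def refl, symmetric])
    moreover have "0 < y \<bullet> ((Z + X) *v y) + ?d \<bullet> (matrix_inv W *v ?d)"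
    proof (cases "y = 0")
      case True
      have "v \<noteq> 0"
      proof
        assume "v = 0"
        then have "A *v x = 0" using True by (simp add: y_def)
        then have "x = 0" using matrix_inv_vector(2)[OF A, of x] by simp
        with that \<open>v = 0\<close> show False by simp
      qed
      then have "0 < v \<bullet> (matrix_inv W *v v)" using posWi by (simp add: pos_def_def)
      with True show ?thesis by simp
    next
      case False
      then have "0 < y \<bullet> ((Z + X) *v y)" using pos by (simp add: pos_def_def)
      with pos_def_nonneg[OF posWi, of ?d] show ?thesis by linarith
    qed
    ultimately show ?thesis by simp
  qed
  show "pos_def M"
    unfolding pos_def_def
  proof (intro conjI allI impI symM)
    fix x :: "real^'n" assume "x \<noteq> 0"
    then show "0 < x \<bullet> (M *v x)" using q[of x "- ?s x"] by simp
  qed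
  show "pos_def V"
    unfolding pos_def_def
  proof (intro conjI allI impI)
    have "transpose (X + Y) = transpose X + transpose Y" for X Y :: "real^'m^'m"
      by (simp add: transpose_def vec_eq_iff)
    then show "transpose V = V"
      by (simp add: V matrix_transpose_mul symZ matrix_mul_assoc)
    fix v :: "real^'m" assume "v \<noteq> 0"
    then show "0 < v \<bullet> (V *v v)" using q[of 0 v] by simp
  qed
qed

text \<open>By \<open>joint_quadratic_identity\<close> both sides have the same exponent, so they agree up to a constant
  factor.  Both are probability densities in \<open>(x, v)\<close>, so this factor is \<open>1\<close>; this also
  settles the relation between the determinants.\<close>

theorem gaussian_time_reversal:
  fixes A X Z :: "real^'n^'n" and B :: "real^'m^'n"
  assumes symX: "transpose X = X" and symZ: "transpose Z = Z" and symM: "transpose M = M"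
    and W: "W = mat 1 - transpose B ** X ** B" and posW: "pos_def W"
    and V: "V = mat 1 + transpose B ** Z ** B" and invV: "invertible V" and A: "invertible A"
    and M: "M = transpose A ** (X + X ** B ** matrix_inv W ** transpose B ** X) ** A
      + transpose A ** (Z - Z ** B ** matrix_inv V ** transpose B ** Z) ** A"
    and pos: "pos_def (Z + X)"
  shows "\<bar>det A\<bar> * (gaussian_density 0 (matrix_inv (Z + X)) (A *v x + B *v v)
      * gaussian_density (transpose B *v (X *v (A *v x + B *v v))) W v)
    = gaussian_density 0 (matrix_inv M) x
      * gaussian_density (- (matrix_inv V *v (transpose B *v (Z *v (A *v x))))) (matrix_inv V) v"
proof -
  note pd = joint_quadratic_pos_def[OF symX symZ symM W posW V invV A M pos]
  let ?b = "\<lambda>y. transpose B *v (X *v y)"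
  let ?K = "\<lambda>x. - (matrix_inv V *v (transpose B *v (Z *v (A *v x))))"
  define g where "g = (\<lambda>y v. gaussian_density 0 (matrix_inv (Z + X)) y * gaussian_density (?b y) W v)"
  define h where "h = (\<lambda>x v. gaussian_density 0 (matrix_inv M) x * gaussian_density (?K x) (matrix_inv V) v)"
  define c1 where "c1 = sqrt ((2 * pi) ^ CARD('n) * det (matrix_inv (Z + X))) * sqrt ((2 * pi) ^ CARD('m) * det W)"
  define c2 where "c2 = sqrt ((2 * pi) ^ CARD('n) * det (matrix_inv M)) * sqrt ((2 * pi) ^ CARD('m) * det (matrix_inv V))"
  define c where "c = c1 / (c2 * \<bar>det A\<bar>)"
  note pdi = pos_def_matrix_inv[OF pos] pos_def_matrix_inv[OF pd(1)] pos_def_matrix_inv[OF pd(2)]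
  note dets = pos_def_det_pos[OF pdi(1)] pos_def_det_pos[OF pdi(2)] pos_def_det_pos[OF pdi(3)] pos_def_det_pos[OF posW]
  have c12: "0 < c1" "0 < c2"
    using dets by (simp_all add: c1_def c2_def)
  have detA: "0 < \<bar>det A\<bar>" using A by (simp add: invertible_det_nz)
  have c: "0 < c" using c12 detA by (simp add: c_def)
  have gnn: "0 \<le> g y v" for y v
    using gaussian_density_nonneg[OF pdi(1)] gaussian_density_nonneg[OF posW] by (simp add: g_def)
  have eq: "h x v = c * (\<bar>det A\<bar> * g (A *v x + B *v v) v)" for x v
  proof -
    let ?y = "A *v x + B *v v"
    have "?y \<bullet> ((Z + X) *v ?y) + (v - ?b ?y) \<bullet> (matrix_inv W *v (v - ?b ?y))
        = x \<bullet> (M *v x) + (v - ?K x) \<bullet> (V *v (v - ?K x))"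
      using joint_quadratic_identity[OF symX symZ W pos_def_invertible[OF posW] V invV M refl refl, of x v]
      by simp
    then have "exp (- (?y \<bullet> ((Z + X) *v ?y)) / 2) * exp (- ((v - ?b ?y) \<bullet> (matrix_inv W *v (v - ?b ?y))) / 2)
        = exp (- (x \<bullet> (M *v x)) / 2) * exp (- ((v - ?K x) \<bullet> (V *v (v - ?K x))) / 2)"
      unfolding mult_exp_exp by simp
    moreover have "matrix_inv (matrix_inv (Z + X)) = Z + X" "matrix_inv (matrix_inv M) = M" "matrix_inv (matrix_inv V) = V"
      using invertible_matrix_inv_self(2) pos_def_invertible pos pd by blast+
    ultimately have "c2 * h x v = c1 * g ?y v"
      using dets unfolding h_def g_def gaussian_density_def c1_def c2_def
      by simp
    then show ?thesis using c12 detA by (simp add: c_def field_simps)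
  qed
  have meas: "(\<lambda>(y, v). ennreal (g y v)) \<in> borel_measurable (lborel \<Otimes>\<^sub>M lborel)"
    unfolding g_def by measurable
  have meas': "(\<lambda>(x, v). ennreal (g (A *v x + B *v v) v)) \<in> borel_measurable (lborel \<Otimes>\<^sub>M lborel)"
    unfolding g_def by measurable
  have "1 = (\<integral>\<^sup>+ y. ennreal (gaussian_density 0 (matrix_inv (Z + X)) y) * (\<integral>\<^sup>+ v. ennreal (gaussian_density (?b y) W v) \<partial>lborel) \<partial>lborel)"
    by (simp add: nn_integral_gaussian[OF pdi(1)] nn_integral_gaussian[OF posW])
  also have "\<dots> = (\<integral>\<^sup>+ y. (\<integral>\<^sup>+ v. ennreal (g y v) \<partial>lborel) \<partial>lborel)"
    by (subst nn_integral_cmult[symmetric], simp)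
      (simp add: g_def ennreal_mult gaussian_density_nonneg[OF pdi(1)] gaussian_density_nonneg[OF posW])
  also have "\<dots> = (\<integral>\<^sup>+ v. (\<integral>\<^sup>+ y. ennreal (g y v) \<partial>lborel) \<partial>lborel)"
    by (rule lborel_pair.Fubini'[OF meas, symmetric])
  also have "\<dots> = (\<integral>\<^sup>+ v. ennreal \<bar>det A\<bar> * (\<integral>\<^sup>+ x. ennreal (g (A *v x + B *v v) v) \<partial>lborel) \<partial>lborel)"
  proof (rule nn_integral_cong)
    fix v :: "real^'m"
    have [measurable]: "(\<lambda>y. ennreal (g y v)) \<in> borel_measurable borel" unfolding g_def by measurable
    have "(\<integral>\<^sup>+ y. ennreal (g y v) \<partial>lborel) = (\<integral>\<^sup>+ y. ennreal (g (B *v v + y) v) \<partial>lborel)"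
      by (rule nn_integral_lborel_add[symmetric]) measurable
    also have "\<dots> = ennreal \<bar>det A\<bar> * (\<integral>\<^sup>+ x. ennreal (g (B *v v + A *v x) v) \<partial>lborel)"
      by (rule nn_integral_lborel_matrix[OF _ A]) measurable
    finally show "(\<integral>\<^sup>+ y. ennreal (g y v) \<partial>lborel) = ennreal \<bar>det A\<bar> * (\<integral>\<^sup>+ x. ennreal (g (A *v x + B *v v) v) \<partial>lborel)"
      by (simp add: add.commute)
  qed
  also have "\<dots> = ennreal \<bar>det A\<bar> * (\<integral>\<^sup>+ v. (\<integral>\<^sup>+ x. ennreal (g (A *v x + B *v v) v) \<partial>lborel) \<partial>lborel)"
    by (rule nn_integral_cmult) (unfold g_def, measurable)
  also have "\<dots> = ennreal \<bar>det A\<bar> * (\<integral>\<^sup>+ x. (\<integral>\<^sup>+ v. ennreal (g (A *v x + B *v v) v) \<partial>lborel) \<partial>lborel)"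
    by (simp only: lborel_pair.Fubini'[OF meas'])
  also have "\<dots> = (\<integral>\<^sup>+ x. ennreal \<bar>det A\<bar> * (\<integral>\<^sup>+ v. ennreal (g (A *v x + B *v v) v) \<partial>lborel) \<partial>lborel)"
    by (rule nn_integral_cmult[symmetric]) (unfold g_def, measurable)
  also have "\<dots> = (\<integral>\<^sup>+ x. (\<integral>\<^sup>+ v. ennreal (\<bar>det A\<bar> * g (A *v x + B *v v) v) \<partial>lborel) \<partial>lborel)"
    by (subst nn_integral_cmult[symmetric], unfold g_def, measurable) (simp add: ennreal_mult gnn[unfolded g_def])
  finally have one: "(\<integral>\<^sup>+ x. (\<integral>\<^sup>+ v. ennreal (\<bar>det A\<bar> * g (A *v x + B *v v) v) \<partial>lborel) \<partial>lborel) = 1" by simp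
  have "1 = (\<integral>\<^sup>+ x. ennreal (gaussian_density 0 (matrix_inv M) x) * (\<integral>\<^sup>+ v. ennreal (gaussian_density (?K x) (matrix_inv V) v) \<partial>lborel) \<partial>lborel)"
    by (simp add: nn_integral_gaussian[OF pdi(2)] nn_integral_gaussian[OF pdi(3)])
  also have "\<dots> = (\<integral>\<^sup>+ x. (\<integral>\<^sup>+ v. ennreal (h x v) \<partial>lborel) \<partial>lborel)"
    by (subst nn_integral_cmult[symmetric], simp)
      (simp add: h_def ennreal_mult gaussian_density_nonneg[OF pdi(2)] gaussian_density_nonneg[OF pdi(3)])
  also have "\<dots> = (\<integral>\<^sup>+ x. ennreal c * (\<integral>\<^sup>+ v. ennreal (\<bar>det A\<bar> * g (A *v x + B *v v) v) \<partial>lborel) \<partial>lborel)"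
  proof (rule nn_integral_cong)
    fix x
    have "(\<lambda>v. ennreal (\<bar>det A\<bar> * g (A *v x + B *v v) v)) \<in> borel_measurable lborel"
      unfolding g_def by measurable
    then show "(\<integral>\<^sup>+ v. ennreal (h x v) \<partial>lborel) = ennreal c * (\<integral>\<^sup>+ v. ennreal (\<bar>det A\<bar> * g (A *v x + B *v v) v) \<partial>lborel)"
      unfolding eq using c by (subst nn_integral_cmult[symmetric]) (simp_all add: ennreal_mult gnn)
  qed
  also have "\<dots> = ennreal c * (\<integral>\<^sup>+ x. (\<integral>\<^sup>+ v. ennreal (\<bar>det A\<bar> * g (A *v x + B *v v) v) \<partial>lborel) \<partial>lborel)"
    by (rule nn_integral_cmult) (unfold g_def, measurable)
  finally have "ennreal c = 1" using one by simp
  then have "c = 1" using c by (simp add: ennreal_eq_1)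
  with eq[of x v] show ?thesis by (simp add: h_def g_def)
qed


text \<open>The same joint law of the pair \<open>(x, y)\<close>, once sampled from \<open>x\<close> forwards and once from \<open>y\<close>
  backwards.\<close>

lemma nn_integral_gaussian_time_reversal:
  fixes A X Z :: "real^'n^'n" and B :: "real^'m^'n"
  assumes symX: "transpose X = X" and symZ: "transpose Z = Z" and symM: "transpose M = M"
    and W: "W = mat 1 - transpose B ** X ** B" and posW: "pos_def W"
    and V: "V = mat 1 + transpose B ** Z ** B" and invV: "invertible V" and A: "invertible A"
    and M: "M = transpose A ** (X + X ** B ** matrix_inv W ** transpose B ** X) ** A
      + transpose A ** (Z - Z ** B ** matrix_inv V ** transpose B ** Z) ** A"
    and pos: "pos_def (Z + X)"
    and F [measurable]: "(\<lambda>(x, y). F x y) \<in> borel_measurable (borel \<Otimes>\<^sub>M borel)"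
  shows "(\<integral>\<^sup>+ x. ennreal (gaussian_density 0 (matrix_inv M) x) * (\<integral>\<^sup>+ v.
        ennreal (gaussian_density (- (matrix_inv V *v (transpose B *v (Z *v (A *v x))))) (matrix_inv V) v)
          * F x (A *v x + B *v v) \<partial>lborel) \<partial>lborel)
    = (\<integral>\<^sup>+ y. ennreal (gaussian_density 0 (matrix_inv (Z + X)) y) * (\<integral>\<^sup>+ v.
        ennreal (gaussian_density (transpose B *v (X *v y)) W v)
          * F (matrix_inv A *v y - (matrix_inv A ** B) *v v) y \<partial>lborel) \<partial>lborel)"
    (is "?L = ?R")
proof -
  note pd = joint_quadratic_pos_def[OF symX symZ symM W posW V invV A M pos]
  note pdi = pos_def_matrix_inv[OF pos] pos_def_matrix_inv[OF pd(1)] pos_def_matrix_inv[OF pd(2)]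
  note nn = gaussian_density_nonneg[OF pdi(1)] gaussian_density_nonneg[OF pdi(2)]
    gaussian_density_nonneg[OF pdi(3)] gaussian_density_nonneg[OF posW]
  note rev = gaussian_time_reversal[OF symX symZ symM W posW V invV A M pos]
  define g where "g = (\<lambda>y v. gaussian_density 0 (matrix_inv (Z + X)) y * gaussian_density (transpose B *v (X *v y)) W v)"
  define h where "h = (\<lambda>x v. gaussian_density 0 (matrix_inv M) x
    * gaussian_density (- (matrix_inv V *v (transpose B *v (Z *v (A *v x))))) (matrix_inv V) v)"
  have gnn: "0 \<le> g y v" for y v by (simp add: g_def nn)
  have gh: "h x v = \<bar>det A\<bar> * g (A *v x + B *v v) v" for x v
    unfolding g_def h_def by (rule rev[symmetric])
  have F' [measurable (raw)]: "(\<lambda>x. F (a x) (b x)) \<in> borel_measurable N"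
    if [measurable]: "a \<in> N \<rightarrow>\<^sub>M borel" "b \<in> N \<rightarrow>\<^sub>M borel" for a b and N :: "'z measure"
    using measurable_compose[OF measurable_Pair[OF that] F] by simp
  let ?x = "\<lambda>y v. matrix_inv A *v y - (matrix_inv A ** B) *v v"
  have x: "?x (A *v x + B *v v) v = x" for x v
    by (simp add: mv_simps matrix_inv_vector[OF A])
  have "?L = (\<integral>\<^sup>+ x. (\<integral>\<^sup>+ v. ennreal (h x v) * F x (A *v x + B *v v) \<partial>lborel) \<partial>lborel)"
    by (subst nn_integral_cmult[symmetric], measurable) (simp add: h_def ennreal_mult nn mult.assoc)
  also have "\<dots> = (\<integral>\<^sup>+ v. (\<integral>\<^sup>+ x. ennreal (h x v) * F x (A *v x + B *v v) \<partial>lborel) \<partial>lborel)"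
    by (rule lborel_pair.Fubini') (unfold h_def, measurable)
  also have "\<dots> = (\<integral>\<^sup>+ v. (\<integral>\<^sup>+ y. ennreal (g y v) * F (?x y v) y \<partial>lborel) \<partial>lborel)"
  proof (rule nn_integral_cong)
    fix v :: "real^'m"
    have [measurable]: "(\<lambda>y. ennreal (g y v)) \<in> borel_measurable borel" unfolding g_def by measurable
    let ?f = "\<lambda>y. ennreal (g y v) * F (?x y v) y"
    have "(\<integral>\<^sup>+ y. ?f y \<partial>lborel) = (\<integral>\<^sup>+ y. ?f (B *v v + y) \<partial>lborel)"
      by (rule nn_integral_lborel_add[symmetric]) measurable
    also have "\<dots> = ennreal \<bar>det A\<bar> * (\<integral>\<^sup>+ x. ?f (B *v v + A *v x) \<partial>lborel)"
      by (rule nn_integral_lborel_matrix[OF _ A]) measurable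
    also have "\<dots> = (\<integral>\<^sup>+ x. ennreal \<bar>det A\<bar> * ?f (A *v x + B *v v) \<partial>lborel)"
      by (subst nn_integral_cmult[symmetric], measurable) (simp add: add.commute)
    also have "\<dots> = (\<integral>\<^sup>+ x. ennreal (h x v) * F x (A *v x + B *v v) \<partial>lborel)"
      by (simp add: x gh ennreal_mult gnn mult.assoc)
    finally show "(\<integral>\<^sup>+ x. ennreal (h x v) * F x (A *v x + B *v v) \<partial>lborel) = (\<integral>\<^sup>+ y. ?f y \<partial>lborel)"
      by simp
  qed
  also have "\<dots> = (\<integral>\<^sup>+ y. (\<integral>\<^sup>+ v. ennreal (g y v) * F (?x y v) y \<partial>lborel) \<partial>lborel)"
    by (rule lborel_pair.Fubini'[symmetric]) (unfold g_def, measurable)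
  also have "\<dots> = ?R"
  proof (rule nn_integral_cong)
    fix y :: "real^'n"
    show "(\<integral>\<^sup>+ v. ennreal (g y v) * F (?x y v) y \<partial>lborel) = ennreal (gaussian_density 0 (matrix_inv (Z + X)) y) *
        (\<integral>\<^sup>+ v. ennreal (gaussian_density (transpose B *v (X *v y)) W v) * F (?x y v) y \<partial>lborel)"
      by (subst nn_integral_cmult[symmetric], measurable) (simp add: g_def ennreal_mult nn mult.assoc)
  qed
  finally show ?thesis .
qed

lemma ln_gaussian_density:
  fixes C :: "real^'d^'d"
  assumes "pos_def C"
  shows "- ln (gaussian_density \<mu> C x) =
    (x - \<mu>) \<bullet> (matrix_inv C *v (x - \<mu>)) / 2 + ln (sqrt ((2 * pi) ^ CARD('d) * det C))"
  using pos_def_det_pos[OF assms] by (simp add: gaussian_density_def ln_div)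

lemma gaussian_entropy_integrable:
  fixes C :: "real^'d^'d"
  assumes C: "pos_def C"
  shows "integrable lborel (\<lambda>x. gaussian_density \<mu> C x * ln (gaussian_density \<mu> C x))"
proof -
  interpret prob_space "gaussian_measure 0 C" by (rule prob_space_gaussian_measure[OF C])
  have ln: "ln (gaussian_density 0 C x) = - (x \<bullet> (matrix_inv C *v x) / 2 + ln (sqrt ((2 * pi) ^ CARD('d) * det C)))" for x
    using ln_gaussian_density[OF C, of 0 x] by simp
  have "integrable (gaussian_measure 0 C) (\<lambda>x. ln (gaussian_density 0 C x))"
    unfolding ln using integrable_gaussian_quadratic_form[OF C, of "matrix_inv C"] by simp
  then have *: "integrable lborel (\<lambda>x. gaussian_density 0 C x * ln (gaussian_density 0 C x))"
    by (subst (asm) integrable_density) (auto simp: gaussian_density_nonneg[OF C])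
  have "integrable (distr lborel borel ((+) \<mu>)) (\<lambda>x. gaussian_density \<mu> C x * ln (gaussian_density \<mu> C x))"
    by (subst integrable_distr_eq)
      (use * gaussian_density_translate[of 0 \<mu> C] in \<open>simp_all add: add.commute\<close>)
  then show ?thesis by (simp add: lborel_distr_plus)
qed

lemma diff_entropy_gaussian_translate:
  fixes C :: "real^'d^'d"
  shows "diff_entropy (gaussian_density \<mu> C) = diff_entropy (gaussian_density 0 C)"
proof -
  let ?f = "\<lambda>x. gaussian_density \<mu> C x * ln (gaussian_density \<mu> C x)"
  have "(\<integral>x. ?f x \<partial>lborel) = (\<integral>x. ?f x \<partial>distr lborel borel ((+) \<mu>))"
    by (simp add: lborel_distr_plus)
  also have "\<dots> = (\<integral>x. gaussian_density 0 C x * ln (gaussian_density 0 C x) \<partial>lborel)"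
    by (subst integral_distr) (use gaussian_density_translate[of 0 \<mu> C] in \<open>simp_all add: add.commute\<close>)
  finally show ?thesis by (simp add: diff_entropy_def)
qed

text \<open>The constant does not depend on the mean, so the bound controls the energy of a Gaussian control
  whose mean depends on the state.\<close>

lemma gaussian_norm_moment_bound:
  fixes C :: "real^'d^'d"
  assumes C: "pos_def C"
  obtains c where "0 \<le> c" "\<And>\<mu>. (\<integral>\<^sup>+ x. ennreal (gaussian_density \<mu> C x) * ennreal ((norm x)\<^sup>2) \<partial>lborel) \<le> ennreal (2 * (norm \<mu>)\<^sup>2 + c)"
proof
  define m where "m = (\<integral>x. x \<bullet> (mat 1 *v x) \<partial>gaussian_measure 0 C)"
  show "0 \<le> 2 * m" by (simp add: m_def)
  fix \<mu> :: "real^'d"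
  interpret prob_space "gaussian_measure 0 C" by (rule prob_space_gaussian_measure[OF C])
  have int: "integrable (gaussian_measure 0 C) (\<lambda>x. 2 * (norm \<mu>)\<^sup>2 + 2 * (x \<bullet> (mat 1 *v x)))"
    using integrable_gaussian_quadratic_form[OF C, of "mat 1"] by simp
  have "(\<integral>\<^sup>+ x. ennreal (gaussian_density \<mu> C x) * ennreal ((norm x)\<^sup>2) \<partial>lborel)
      = (\<integral>\<^sup>+ x. ennreal (gaussian_density \<mu> C (\<mu> + x)) * ennreal ((norm (\<mu> + x))\<^sup>2) \<partial>lborel)"
    by (rule nn_integral_lborel_add[symmetric]) measurable
  also have "\<dots> = (\<integral>\<^sup>+ x. ennreal ((norm (\<mu> + x))\<^sup>2) \<partial>gaussian_measure 0 C)"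
    using gaussian_density_translate[of 0 \<mu> C]
    by (subst nn_integral_density) (simp_all add: add.commute)
  also have "\<dots> \<le> (\<integral>\<^sup>+ x. ennreal (2 * (norm \<mu>)\<^sup>2 + 2 * (x \<bullet> (mat 1 *v x))) \<partial>gaussian_measure 0 C)"
  proof (intro nn_integral_mono ennreal_leI)
    fix x :: "real^'d"
    have "(norm (\<mu> + x))\<^sup>2 + (norm (\<mu> - x))\<^sup>2 = 2 * (norm \<mu>)\<^sup>2 + 2 * (norm x)\<^sup>2"
      by (simp add: power2_norm_eq_inner inner_add_left inner_add_right inner_diff_left inner_diff_right)
    then show "(norm (\<mu> + x))\<^sup>2 \<le> 2 * (norm \<mu>)\<^sup>2 + 2 * (x \<bullet> (mat 1 *v x))"
      using inner_ge_zero[of "\<mu> - x"] unfolding power2_norm_eq_inner matrix_vector_mul_lid by linarith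
  qed
  also have "\<dots> = ennreal (\<integral>x. 2 * (norm \<mu>)\<^sup>2 + 2 * (x \<bullet> (mat 1 *v x)) \<partial>gaussian_measure 0 C)"
    by (rule nn_integral_eq_integral[OF int]) simp
  also have "(\<integral>x. 2 * (norm \<mu>)\<^sup>2 + 2 * (x \<bullet> (mat 1 *v x)) \<partial>gaussian_measure 0 C) = 2 * (norm \<mu>)\<^sup>2 + 2 * m"
    using integrable_gaussian_quadratic_form[OF C, of "mat 1"] prob_space by (simp add: m_def)
  finally show "(\<integral>\<^sup>+ x. ennreal (gaussian_density \<mu> C x) * ennreal ((norm x)\<^sup>2) \<partial>lborel) \<le> ennreal (2 * (norm \<mu>)\<^sup>2 + 2 * m)" .
qed

section \<open>Laws of controlled paths\<close>

text \<open>The integrand of the relative entropy, with the term \<open>b - a\<close> added.  It integrates to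
  the usual relative entropy for probability densities and is nonnegative pointwise, so its
  integral always makes sense in the extended nonnegative reals.\<close>

definition kl :: "real \<Rightarrow> real \<Rightarrow> real" where
  "kl a b = a * ln a - a * ln b - a + b"

lemma kl_nonneg:
  assumes "0 \<le> a" "0 < b" shows "0 \<le> kl a b"
proof (cases "a = 0")
  case False
  with assms have a: "0 < a" by simp
  have "ln (b / a) \<le> b / a - 1" using a assms by (intro ln_le_minus_one) simp
  then have "a * ln (b / a) \<le> a * (b / a - 1)" using a by (simp add: mult_left_mono)
  then show ?thesis using a assms by (simp add: kl_def ln_div algebra_simps)
qed (use assms in \<open>simp add: kl_def\<close>)

lemma kl_eq_0_imp_eq:
  assumes "0 \<le> a" "0 < b" "kl a b = 0" shows "a = b"
proof (cases "a = 0")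
  case False
  with assms have a: "0 < a" by simp
  have "a * ln (b / a) = a * (b / a - 1)"
    using a assms by (simp add: kl_def ln_div algebra_simps)
  then have "ln (b / a) = b / a - 1" using a by (simp only: mult_cancel_left) auto
  then have "b / a = 1" using a assms by (intro ln_eq_minus_one) auto
  then show ?thesis using a by simp
qed (use assms in \<open>simp add: kl_def\<close>)

lemma kl_self: "kl b b = 0" by (simp add: kl_def)

lemma borel_measurable_kl [measurable (raw)]:
  assumes [measurable]: "f \<in> borel_measurable M" "g \<in> borel_measurable M"
  shows "(\<lambda>x. kl (f x) (g x)) \<in> borel_measurable M"
  unfolding kl_def by measurable

abbreviation path_space :: "nat set \<Rightarrow> ('n::finite, 'm::finite) path measure" where
  "path_space I \<equiv> lborel \<Otimes>\<^sub>M (\<Pi>\<^sub>M k\<in>I. lborel)"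

definition extend_path :: "nat \<Rightarrow> ('n::finite, 'm::finite) path \<times> (real^'m) \<Rightarrow> ('n, 'm) path" where
  "extend_path j = (\<lambda>(\<omega>, v). (fst \<omega>, (snd \<omega>)(j := v)))"

lemma extend_path_simps [simp]:
  "fst (extend_path j (\<omega>, v)) = fst \<omega>"
  "snd (extend_path j (\<omega>, v)) k = (if k = j then v else snd \<omega> k)"
  by (simp_all add: extend_path_def)

lemma measurable_extend_path [measurable]:
  "extend_path j \<in> path_space I \<Otimes>\<^sub>M lborel \<rightarrow>\<^sub>M path_space (insert j I)"
proof -
  have "(\<lambda>x. (snd (fst x))(j := snd x)) \<in> path_space I \<Otimes>\<^sub>M lborel \<rightarrow>\<^sub>M (\<Pi>\<^sub>M k\<in>insert j I. lborel)"
    using measurable_compose[OF _ measurable_add_dim[of j I "\<lambda>_. lborel"],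
        of "\<lambda>x. (snd (fst x), snd x)" "path_space I \<Otimes>\<^sub>M lborel"] by simp
  then show ?thesis
    unfolding extend_path_def by (simp add: split_beta')
qed

text \<open>This holds for all times, including those outside of \<open>I\<close>: there the control is the constant
  \<^const>\<open>undefined\<close> on the whole space.  States are thereby measurable on every space of partial paths.\<close>

lemma borel_measurable_control [measurable]:
  fixes I :: "nat set"
  shows "(\<lambda>\<omega>. snd \<omega> k :: real^'m) \<in> borel_measurable (path_space I :: ('n::finite, 'm::finite) path measure)"
proof (cases "k \<in> I")
  case True
  then have "(\<lambda>w. w k) \<in> borel_measurable (\<Pi>\<^sub>M k\<in>I. lborel)"
    using measurable_component_singleton[of k I "\<lambda>_. lborel"] by simp
  then show ?thesis by (rule measurable_compose[OF measurable_snd])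
next
  case False
  then have eq: "snd \<omega> k = undefined" if "\<omega> \<in> space (path_space I :: ('n, 'm) path measure)" for \<omega>
    using that by (auto simp: space_pair_measure space_PiM PiE_def extensional_def)
  show ?thesis by (subst measurable_cong[OF eq]) simp_all
qed

lemma nn_integral_path_space_insert:
  fixes F :: "('n::finite, 'm::finite) path \<Rightarrow> ennreal"
  assumes I: "finite I" "j \<notin> I" and F [measurable]: "F \<in> borel_measurable (path_space (insert j I))"
  shows "(\<integral>\<^sup>+ \<omega>. F \<omega> \<partial>path_space (insert j I))
    = (\<integral>\<^sup>+ x. F (extend_path j x) \<partial>(path_space I \<Otimes>\<^sub>M lborel))"
proof -
  interpret P: product_sigma_finite "\<lambda>_ :: nat. lborel :: (real^'m) measure" ..
  interpret I: sigma_finite_measure "\<Pi>\<^sub>M k\<in>I. (lborel :: (real^'m) measure)"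
    by (rule P.sigma_finite) (rule I)
  interpret J: sigma_finite_measure "\<Pi>\<^sub>M k\<in>insert j I. (lborel :: (real^'m) measure)"
    by (rule P.sigma_finite) (use I in simp)
  have "(\<integral>\<^sup>+ \<omega>. F \<omega> \<partial>path_space (insert j I))
      = (\<integral>\<^sup>+ z. (\<integral>\<^sup>+ w. F (z, w) \<partial>(\<Pi>\<^sub>M k\<in>insert j I. lborel)) \<partial>lborel)"
    by (rule J.nn_integral_fst[symmetric]) measurable
  also have "\<dots> = (\<integral>\<^sup>+ z. (\<integral>\<^sup>+ w. (\<integral>\<^sup>+ v. F (z, w(j := v)) \<partial>lborel) \<partial>(\<Pi>\<^sub>M k\<in>I. lborel)) \<partial>lborel)"
    using I by (intro nn_integral_cong P.product_nn_integral_insert) auto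
  also have "\<dots> = (\<integral>\<^sup>+ z. (\<integral>\<^sup>+ w. (\<integral>\<^sup>+ v. F (extend_path j ((z, w), v)) \<partial>lborel) \<partial>(\<Pi>\<^sub>M k\<in>I. lborel)) \<partial>lborel)"
    by (simp add: extend_path_def)
  also have "\<dots> = (\<integral>\<^sup>+ \<omega>. (\<integral>\<^sup>+ v. F (extend_path j (\<omega>, v)) \<partial>lborel) \<partial>path_space I)"
    by (rule I.nn_integral_fst[of "\<lambda>\<omega>. \<integral>\<^sup>+ v. F (extend_path j (\<omega>, v)) \<partial>lborel"]) measurable
  also have "\<dots> = (\<integral>\<^sup>+ x. F (extend_path j x) \<partial>(path_space I \<Otimes>\<^sub>M lborel))"
    by (rule lborel.nn_integral_fst) measurable
  finally show ?thesis .
qed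

lemma distr_extend_path:
  assumes I: "finite I" "j \<notin> I"
  shows "distr (path_space I \<Otimes>\<^sub>M lborel) (path_space (insert j I)) (extend_path j)
    = path_space (insert j I)"
proof (rule measure_eqI)
  let ?D = "distr (path_space I \<Otimes>\<^sub>M lborel) (path_space (insert j I)) (extend_path j)"
  fix A assume "A \<in> sets ?D"
  then have [measurable]: "A \<in> sets (path_space (insert j I))" by simp
  have "emeasure ?D A = (\<integral>\<^sup>+ x. indicator A x \<partial>?D)"
    by (rule nn_integral_indicator[symmetric]) measurable
  also have "\<dots> = (\<integral>\<^sup>+ x. indicator A (extend_path j x) \<partial>(path_space I \<Otimes>\<^sub>M lborel))"
    by (rule nn_integral_distr) measurable
  also have "\<dots> = (\<integral>\<^sup>+ \<omega>. indicator A \<omega> \<partial>path_space (insert j I))"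
    by (rule nn_integral_path_space_insert[OF I, symmetric]) measurable
  also have "\<dots> = emeasure (path_space (insert j I)) A"
    by (rule nn_integral_indicator) measurable
  finally show "emeasure ?D A = emeasure (path_space (insert j I)) A" .
qed simp

text \<open>The forward and the backward process differ in the order in which the controls are drawn.  The
  rank \<open>r\<close> records this order: the state in which the control at time \<open>k\<close> is applied does not depend
  on controls of the same or a higher rank.\<close>

locale causal_process =
  fixes N :: nat and f :: "real^'n \<Rightarrow> real"
    and X :: "nat \<Rightarrow> ('n::finite, 'm::finite) path \<Rightarrow> real^'n"
    and p :: "('n, 'm) policy" and r :: "nat \<Rightarrow> int"
  assumes f_measurable [measurable]: "f \<in> borel_measurable borel"
    and f_nonneg: "\<And>x. 0 \<le> f x"
    and f_total: "(\<integral>\<^sup>+ x. ennreal (f x) \<partial>lborel) = 1"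
    and policy: "is_policy N p"
    and X_measurable [measurable]: "\<And>k I. X k \<in> borel_measurable (path_space I)"
    and causal: "\<And>j k \<omega> v. k < N \<Longrightarrow> r k \<le> r j \<Longrightarrow> X k (extend_path j (\<omega>, v)) = X k \<omega>"
begin

lemma p_measurable: "k < N \<Longrightarrow> (\<lambda>x. p k (fst x) (snd x)) \<in> borel_measurable (borel \<Otimes>\<^sub>M borel)"
  using policy by (simp add: is_policy_def split_beta')

lemma p_measurable' [measurable (raw)]:
  assumes "k < N" "g \<in> M \<rightarrow>\<^sub>M borel" "h \<in> M \<rightarrow>\<^sub>M borel"
  shows "(\<lambda>x. p k (g x) (h x)) \<in> borel_measurable M"
  using measurable_compose[OF measurable_Pair[OF assms(2,3)] p_measurable[OF assms(1)]] by simp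

lemma p_nonneg: "k < N \<Longrightarrow> 0 \<le> p k x v"
  using policy by (simp add: is_policy_def)

lemma p_total: "k < N \<Longrightarrow> (\<integral>\<^sup>+ v. ennreal (p k x v) \<partial>lborel) = 1"
  using policy by (simp add: is_policy_def)

text \<open>The law of the partial path with the controls at times in \<open>I\<close>.  It is meaningful if \<open>I\<close> contains
  every time of lower rank than one of its members.\<close>

definition law :: "nat set \<Rightarrow> ('n, 'm) path measure" where
  "law I = density (path_space I) (\<lambda>\<omega>. ennreal (f (fst \<omega>) * (\<Prod>k\<in>I. p k (X k \<omega>) (snd \<omega> k))))"

lemma path_law_eq: "path_law N f X p = law {..<N}"
  by (simp add: path_law_def law_def)

lemma sets_law [measurable_cong]: "sets (law I) = sets (path_space I)"
  by (simp add: law_def)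

lemma law_density_measurable:
  assumes "I \<subseteq> {..<N}"
  shows "(\<lambda>\<omega>. ennreal (f (fst \<omega>) * (\<Prod>k\<in>I. p k (X k \<omega>) (snd \<omega> k)))) \<in> borel_measurable (path_space I)"
proof -
  have "(\<lambda>\<omega>. \<Prod>k\<in>I. p k (X k \<omega>) (snd \<omega> k)) \<in> borel_measurable (path_space I)"
    using assms by (intro borel_measurable_prod p_measurable') auto
  then show ?thesis by measurable
qed

text \<open>A control of top rank influences no other factor of the density, so it is drawn last: from
  the policy, given the partial path.\<close>

lemma law_insert:
  assumes I: "finite I" "j \<notin> I" "insert j I \<subseteq> {..<N}" and top: "\<And>i. i \<in> I \<Longrightarrow> r i \<le> r j"
  shows "law (insert j I) =
    distr (density (law I \<Otimes>\<^sub>M lborel) (\<lambda>(\<omega>, v). ennreal (p j (X j \<omega>) v)))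
      (path_space (insert j I)) (extend_path j)"
proof -
  have j: "j < N" and IN: "I \<subseteq> {..<N}" using I by auto
  let ?d = "\<lambda>I \<omega>. ennreal (f (fst \<omega>) * (\<Prod>k\<in>I. p k (X k \<omega>) (snd \<omega> k)))"
  note [measurable] = law_density_measurable[OF IN] law_density_measurable[OF I(3)]
  note [measurable (raw)] = p_measurable'[OF j]
  have d: "?d (insert j I) (extend_path j x) = ?d I (fst x) * (case x of (\<omega>, v) \<Rightarrow> ennreal (p j (X j \<omega>) v))" for x
  proof -
    obtain \<omega> v where x: "x = (\<omega>, v)" by (cases x)
    have "(\<Prod>k\<in>I. p k (X k (extend_path j (\<omega>, v))) (snd (extend_path j (\<omega>, v)) k)) = (\<Prod>k\<in>I. p k (X k \<omega>) (snd \<omega> k))"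
    proof (rule prod.cong)
      fix k assume k: "k \<in> I"
      then have "X k (extend_path j (\<omega>, v)) = X k \<omega>" using IN top by (auto simp: causal)
      moreover have "snd (extend_path j (\<omega>, v)) k = snd \<omega> k" using k I(2) by (auto simp: extend_path_def)
      ultimately show "p k (X k (extend_path j (\<omega>, v))) (snd (extend_path j (\<omega>, v)) k) = p k (X k \<omega>) (snd \<omega> k)"
        by simp
    qed simp
    moreover have "X j (extend_path j (\<omega>, v)) = X j \<omega>" using j by (simp add: causal)
    moreover have "fst (extend_path j (\<omega>, v)) = fst \<omega>" "snd (extend_path j (\<omega>, v)) j = v"
      by (simp_all add: extend_path_def)
    ultimately show ?thesis
      using I(1,2) p_nonneg[OF j]
      by (simp add: x ennreal_mult'[OF p_nonneg[OF j], symmetric] mult_ac)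
  qed
  have "law I \<Otimes>\<^sub>M (lborel :: (real^'m) measure) = density (path_space I) (?d I) \<Otimes>\<^sub>M density lborel (\<lambda>_. 1)"
    by (simp add: law_def density_1)
  also have "\<dots> = density (path_space I \<Otimes>\<^sub>M lborel) (\<lambda>(\<omega>, v). ?d I \<omega> * 1)"
    by (rule pair_measure_density) (simp_all add: density_1 sigma_finite_lborel)
  finally have pair: "law I \<Otimes>\<^sub>M (lborel :: (real^'m) measure) = density (path_space I \<Otimes>\<^sub>M lborel) (\<lambda>x. ?d I (fst x))"
    by (simp add: split_beta')
  have "law (insert j I)
      = density (distr (path_space I \<Otimes>\<^sub>M lborel) (path_space (insert j I)) (extend_path j)) (?d (insert j I))"
    unfolding law_def by (simp only: distr_extend_path[OF I(1,2)])
  also have "\<dots> = distr (density (path_space I \<Otimes>\<^sub>M lborel) (\<lambda>x. ?d (insert j I) (extend_path j x)))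
      (path_space (insert j I)) (extend_path j)"
    by (rule density_distr) measurable
  also have "density (path_space I \<Otimes>\<^sub>M lborel) (\<lambda>x. ?d (insert j I) (extend_path j x))
      = density (law I \<Otimes>\<^sub>M lborel) (\<lambda>(\<omega>, v). ennreal (p j (X j \<omega>) v))"
    unfolding pair d by (rule density_density_eq[symmetric]) measurable
  finally show ?thesis .
qed

lemma nn_integral_law_insert:
  assumes I: "finite I" "j \<notin> I" "insert j I \<subseteq> {..<N}" and top: "\<And>i. i \<in> I \<Longrightarrow> r i \<le> r j"
    and [measurable]: "F \<in> borel_measurable (path_space (insert j I))"
  shows "(\<integral>\<^sup>+ \<omega>. F \<omega> \<partial>law (insert j I))
    = (\<integral>\<^sup>+ \<omega>. (\<integral>\<^sup>+ v. ennreal (p j (X j \<omega>) v) * F (extend_path j (\<omega>, v)) \<partial>lborel) \<partial>law I)"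
proof -
  have j: "j < N" using I by auto
  note [measurable (raw)] = p_measurable'[OF j]
  have "(\<integral>\<^sup>+ \<omega>. F \<omega> \<partial>law (insert j I))
      = (\<integral>\<^sup>+ x. (case x of (\<omega>, v) \<Rightarrow> ennreal (p j (X j \<omega>) v)) * F (extend_path j x) \<partial>(law I \<Otimes>\<^sub>M lborel))"
  proof -
    have "(\<integral>\<^sup>+ \<omega>. F \<omega> \<partial>law (insert j I))
      = (\<integral>\<^sup>+ x. F (extend_path j x) \<partial>density (law I \<Otimes>\<^sub>M lborel) (\<lambda>(\<omega>, v). ennreal (p j (X j \<omega>) v)))"
      by (subst law_insert[OF I top], assumption) (rule nn_integral_distr, measurable)
    then show ?thesis by (simp add: nn_integral_density)
  qed
  also have "\<dots> = (\<integral>\<^sup>+ \<omega>. (\<integral>\<^sup>+ v. ennreal (p j (X j \<omega>) v) * F (extend_path j (\<omega>, v)) \<partial>lborel) \<partial>law I)"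
    by (subst lborel.nn_integral_fst[symmetric]) simp_all
  finally show ?thesis .
qed

lemma nn_integral_law_insert_indep:
  assumes I: "finite I" "j \<notin> I" "insert j I \<subseteq> {..<N}" and top: "\<And>i. i \<in> I \<Longrightarrow> r i \<le> r j"
    and F: "F \<in> borel_measurable (path_space (insert j I))"
    and indep: "\<And>\<omega> v. F (extend_path j (\<omega>, v)) = F \<omega>"
  shows "(\<integral>\<^sup>+ \<omega>. F \<omega> \<partial>law (insert j I)) = (\<integral>\<^sup>+ \<omega>. F \<omega> \<partial>law I)"
proof -
  have j: "j < N" using I by auto
  note [measurable (raw)] = p_measurable'[OF j]
  have "(\<integral>\<^sup>+ v. ennreal (p j (X j \<omega>) v) * F \<omega> \<partial>lborel) = F \<omega>" for \<omega>
    by (subst nn_integral_multc) (simp_all add: p_total[OF j])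
  then show ?thesis
    by (simp add: nn_integral_law_insert[OF I top F] indep)
qed

lemma law_total:
  assumes "finite I" "I \<subseteq> {..<N}"
  shows "(\<integral>\<^sup>+ \<omega>. 1 \<partial>law I) = 1"
  using assms
proof (induction I rule: finite_ranking_induct[where f = r])
  case empty
  interpret P: product_sigma_finite "\<lambda>_ :: nat. lborel :: (real^'m) measure" ..
  interpret E: sigma_finite_measure "\<Pi>\<^sub>M k\<in>({} :: nat set). (lborel :: (real^'m) measure)"
    by (rule P.sigma_finite) simp
  have "(\<integral>\<^sup>+ \<omega>. 1 \<partial>law {}) = (\<integral>\<^sup>+ \<omega>. ennreal (f (fst \<omega>)) \<partial>(path_space {} :: ('n, 'm) path measure))"
    unfolding law_def by (subst nn_integral_density) simp_all
  also have "\<dots> = (\<integral>\<^sup>+ z. (\<integral>\<^sup>+ w. ennreal (f z) \<partial>(\<Pi>\<^sub>M k\<in>({} :: nat set). (lborel :: (real^'m) measure))) \<partial>lborel)"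
    by (subst E.nn_integral_fst[symmetric]) simp_all
  also have "\<dots> = 1" by (simp add: f_total space_PiM emeasure_PiM_empty PiM_empty)
  finally show ?case .
next
  case (insert j I)
  show ?case
  proof (cases "j \<in> I")
    case True
    then have "insert j I = I" by auto
    then show ?thesis using insert by simp
  next
    case False
    have "(\<integral>\<^sup>+ \<omega>. 1 \<partial>law (insert j I)) = (\<integral>\<^sup>+ \<omega>. 1 \<partial>law I)"
      by (rule nn_integral_law_insert_indep) (use insert False in auto)
    then show ?thesis using insert by simp
  qed
qed

lemma prob_space_law: "finite I \<Longrightarrow> I \<subseteq> {..<N} \<Longrightarrow> prob_space (law I)"
  using law_total[of I] by (intro prob_spaceI) simp

text \<open>The controls in \<open>D\<close> are drawn after those in \<open>K\<close>, so they can be integrated out, the last one first.\<close>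

lemma nn_integral_law_marginal:
  assumes "finite D" "finite K" "K \<inter> D = {}" "K \<union> D \<subseteq> {..<N}"
    and "\<And>i j. i \<in> K \<Longrightarrow> j \<in> D \<Longrightarrow> r i \<le> r j"
    and F: "\<And>I. F \<in> borel_measurable (path_space I)"
    and indep: "\<And>j \<omega> v. j \<in> D \<Longrightarrow> F (extend_path j (\<omega>, v)) = F \<omega>"
  shows "(\<integral>\<^sup>+ \<omega>. F \<omega> \<partial>law (K \<union> D)) = (\<integral>\<^sup>+ \<omega>. F \<omega> \<partial>law K)"
  using assms
proof (induction D rule: finite_ranking_induct[where f = r])
  case (insert j D)
  show ?case
  proof (cases "j \<in> D")
    case True
    then have "insert j D = D" by auto
    then show ?thesis using insert by simp
  next
    case False
    have "(\<integral>\<^sup>+ \<omega>. F \<omega> \<partial>law (insert j (K \<union> D))) = (\<integral>\<^sup>+ \<omega>. F \<omega> \<partial>law (K \<union> D))"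
      by (rule nn_integral_law_insert_indep) (use insert False in auto)
    also have "\<dots> = (\<integral>\<^sup>+ \<omega>. F \<omega> \<partial>law K)" using insert by simp
    finally show ?thesis by simp
  qed
qed simp

text \<open>Controls drawn later are integrated out, then the control at time \<open>k\<close> itself, and finally the later
  ones are added back, as the result depends on the state only.\<close>

lemma nn_integral_law_disintegrate:
  assumes k: "k < N" and [measurable]: "G \<in> borel_measurable (borel \<Otimes>\<^sub>M borel)"
  shows "(\<integral>\<^sup>+ \<omega>. G (X k \<omega>, snd \<omega> k) \<partial>law {..<N})
    = (\<integral>\<^sup>+ \<omega>. (\<integral>\<^sup>+ v. ennreal (p k (X k \<omega>) v) * G (X k \<omega>, v) \<partial>lborel) \<partial>law {..<N})"
proof -
  note [measurable (raw)] = p_measurable'[OF k]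
  let ?K = "{i. i < N \<and> r i < r k}"
  let ?D = "{..<N} - insert k ?K"
  let ?E = "{..<N} - ?K"
  have N1: "{..<N} = insert k ?K \<union> ?D" and N2: "{..<N} = ?K \<union> ?E" using k by auto
  have "(\<integral>\<^sup>+ \<omega>. G (X k \<omega>, snd \<omega> k) \<partial>law {..<N}) = (\<integral>\<^sup>+ \<omega>. G (X k \<omega>, snd \<omega> k) \<partial>law (insert k ?K))"
    by (subst N1, rule nn_integral_law_marginal)
      (use k in \<open>auto simp: causal not_less intro: less_imp_le\<close>)
  also have "\<dots> = (\<integral>\<^sup>+ \<omega>. (\<integral>\<^sup>+ v. ennreal (p k (X k \<omega>) v) *
      G (X k (extend_path k (\<omega>, v)), snd (extend_path k (\<omega>, v)) k) \<partial>lborel) \<partial>law ?K)"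
    by (rule nn_integral_law_insert) (use k in auto)
  also have "\<dots> = (\<integral>\<^sup>+ \<omega>. (\<integral>\<^sup>+ v. ennreal (p k (X k \<omega>) v) * G (X k \<omega>, v) \<partial>lborel) \<partial>law ?K)"
    using k by (simp add: causal)
  also have "\<dots> = (\<integral>\<^sup>+ \<omega>. (\<integral>\<^sup>+ v. ennreal (p k (X k \<omega>) v) * G (X k \<omega>, v) \<partial>lborel) \<partial>law {..<N})"
    by (subst N2, rule nn_integral_law_marginal[symmetric]) (use k in \<open>auto simp: causal not_less\<close>)
  finally show ?thesis .
qed

end

section \<open>The chain rule for relative entropy\<close>

context causal_process
begin

text \<open>It transfers the assumption on the entropies, which concerns the full path, to the partial
  paths over which the induction in \<open>relative_entropy_sum\<close> runs.\<close>

lemma AE_law_insert_imp: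
  assumes I: "finite I" "j \<notin> I" "insert j I \<subseteq> {..<N}" and top: "\<And>i. i \<in> I \<Longrightarrow> r i \<le> r j"
    and k: "k \<in> insert j I" and [measurable]: "Measurable.pred borel Q"
    and AE: "AE \<omega> in law (insert j I). Q (X k \<omega>)"
  shows "AE \<omega> in law I. Q (X k \<omega>)"
proof -
  let ?F = "\<lambda>\<omega>. if Q (X k \<omega>) then 0 else 1 :: ennreal"
  have kN: "k < N" "r k \<le> r j" using k I top by auto
  have "(\<integral>\<^sup>+ \<omega>. ?F \<omega> \<partial>law I) = (\<integral>\<^sup>+ \<omega>. ?F \<omega> \<partial>law (insert j I))"
    by (rule nn_integral_law_insert_indep[OF I top, symmetric]) (use kN in \<open>auto simp: causal\<close>)
  also have "\<dots> = (\<integral>\<^sup>+ \<omega>. 0 \<partial>law (insert j I))"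
    by (rule nn_integral_cong_AE) (use AE in auto)
  finally have "(\<integral>\<^sup>+ \<omega>. ?F \<omega> \<partial>law I) = 0" by simp
  then have "AE \<omega> in law I. ?F \<omega> = 0"
    by (subst nn_integral_0_iff_AE[symmetric]) simp_all
  then show ?thesis by eventually_elim (auto split: if_splits)
qed

text \<open>Given the partial path over \<open>I\<close>, the terms collected in \<open>R\<close> are constant.  If the total
  is integrable, then by Fubini's theorem the sum of the cross entropy integrand and \<open>G\<close> is integrable
  in the last control, almost surely.  After completing the integrand to \<^const>\<open>kl\<close>, both summands
  are nonnegative, and their integral is the new nonnegative remainder.\<close>

lemma relative_entropy_peel:
  assumes w: "is_policy N w" and w_pos: "\<And>k x v. k < N \<Longrightarrow> 0 < w k x v"
    and I: "finite I" "j \<notin> I" "insert j I \<subseteq> {..<N}" and top: "\<And>i. i \<in> I \<Longrightarrow> r i \<le> r j"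
    and ent: "AE \<omega> in law I. integrable lborel (\<lambda>v. p j (X j \<omega>) v * ln (p j (X j \<omega>) v))"
    and R [measurable]: "R \<in> borel_measurable (path_space I)"
    and R_indep: "\<And>\<omega> v. R (extend_path j (\<omega>, v)) = R \<omega>"
    and G [measurable]: "G \<in> borel_measurable (path_space (insert j I))"
    and G_nonneg: "\<And>\<omega>. 0 \<le> G \<omega>"
    and int: "integrable (law (insert j I))
      (\<lambda>\<omega>. R \<omega> + (- ln (w j (X j \<omega>) (snd \<omega> j)) - diff_entropy (p j (X j \<omega>))) + G \<omega>)"
      (is "integrable _ ?F")
  shows "\<exists>G'. G' \<in> borel_measurable (path_space I) \<and> (\<forall>\<omega>. 0 \<le> G' \<omega>) \<and>
    integrable (law I) (\<lambda>\<omega>. R \<omega> + G' \<omega>) \<and>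
    (\<integral>\<omega>. R \<omega> + G' \<omega> \<partial>law I) = (\<integral>\<omega>. ?F \<omega> \<partial>law (insert j I)) \<and>
    (\<integral>\<^sup>+ \<omega>. ennreal (G' \<omega>) \<partial>law I) =
      (\<integral>\<^sup>+ \<omega>. (\<integral>\<^sup>+ v. ennreal (kl (p j (X j \<omega>) v) (w j (X j \<omega>) v)) \<partial>lborel) \<partial>law I)
      + (\<integral>\<^sup>+ \<omega>. ennreal (G \<omega>) \<partial>law (insert j I))"
proof -
  have j: "j < N" and IN: "I \<subseteq> {..<N}" using I by auto
  note [measurable (raw)] = p_measurable'[OF j]
  have w_meas: "(\<lambda>x. w j (fst x) (snd x)) \<in> borel_measurable (borel \<Otimes>\<^sub>M borel)"
    using w j by (simp add: is_policy_def split_beta')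
  have [measurable (raw)]: "(\<lambda>x. w j (g x) (h x)) \<in> borel_measurable M"
    if "g \<in> M \<rightarrow>\<^sub>M borel" "h \<in> M \<rightarrow>\<^sub>M borel" for g h and M :: "'z measure"
    using measurable_compose[OF measurable_Pair[OF that] w_meas] by simp
  have w_total: "(\<integral>\<^sup>+ v. ennreal (w j x v) \<partial>lborel) = 1" for x using w j by (simp add: is_policy_def)
  have w_nn: "0 \<le> w j x v" for x v using w_pos[OF j, of x v] by simp
  have kl_nn: "0 \<le> kl (p j x v) (w j x v)" for x v
    using p_nonneg[OF j] w_pos[OF j] by (rule kl_nonneg)
  have int_p: "integrable lborel (p j x)" "(\<integral>v. p j x v \<partial>lborel) = 1"
    and int_w: "integrable lborel (w j x)" "(\<integral>v. w j x v \<partial>lborel) = 1" for x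
  proof -
    have "has_bochner_integral lborel (p j x) 1"
      by (rule has_bochner_integral_nn_integral) (use p_total[OF j] p_nonneg[OF j] in auto)
    then show "integrable lborel (p j x)" "(\<integral>v. p j x v \<partial>lborel) = 1"
      by (auto simp: has_bochner_integral_iff)
    have "has_bochner_integral lborel (w j x) 1"
      by (rule has_bochner_integral_nn_integral) (use w_total w_nn in auto)
    then show "integrable lborel (w j x)" "(\<integral>v. w j x v \<partial>lborel) = 1"
      by (auto simp: has_bochner_integral_iff)
  qed
  let ?e = "extend_path j"
  interpret L: prob_space "law I" by (rule prob_space_law[OF I(1) IN])
  interpret LL: pair_sigma_finite "law I" "lborel :: (real^'m) measure" ..
  define D where "D = density (law I \<Otimes>\<^sub>M (lborel :: (real^'m) measure)) (\<lambda>(\<omega>, v). ennreal (p j (X j \<omega>) v))"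
  have D: "D = density (law I \<Otimes>\<^sub>M lborel) (\<lambda>x. ennreal (p j (X j (fst x)) (snd x)))"
    by (simp add: D_def split_beta')
  have law: "law (insert j I) = distr D (path_space (insert j I)) ?e"
    unfolding D_def by (rule law_insert[OF I top])
  have F_meas: "?F \<in> borel_measurable (path_space (insert j I))"
    using borel_measurable_integrable[OF int] by (simp add: measurable_cong_sets[OF sets_law refl])
  have e_meas: "?e \<in> D \<rightarrow>\<^sub>M path_space (insert j I)"
    unfolding D_def by measurable
  have Fe_meas [measurable]: "(\<lambda>x. ?F (?e x)) \<in> borel_measurable (law I \<Otimes>\<^sub>M lborel)"
    by (rule measurable_compose[OF _ F_meas]) measurable
  define H where "H = (\<lambda>x. p j (X j (fst x)) (snd x) * ?F (?e x))"
  have "integrable D (\<lambda>x. ?F (?e x))"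
    using int unfolding law by (subst (asm) integrable_distr_eq[OF e_meas F_meas])
  then have intH: "integrable (law I \<Otimes>\<^sub>M lborel) H"
    unfolding D H_def
    by (subst (asm) integrable_density) (auto simp: p_nonneg[OF j])
  have "(\<integral>\<omega>. ?F \<omega> \<partial>law (insert j I)) = (\<integral>x. ?F (?e x) \<partial>D)"
    unfolding law by (rule integral_distr[OF e_meas F_meas])
  also have "\<dots> = (\<integral>x. H x \<partial>(law I \<Otimes>\<^sub>M lborel))"
    unfolding D H_def
    by (subst integral_density) (auto simp: p_nonneg[OF j])
  also have "\<dots> = (\<integral>\<omega>. (\<integral>v. H (\<omega>, v) \<partial>lborel) \<partial>law I)"
    by (rule LL.integral_fst'[OF intH, symmetric])
  finally have intF: "(\<integral>\<omega>. ?F \<omega> \<partial>law (insert j I)) = (\<integral>\<omega>. (\<integral>v. H (\<omega>, v) \<partial>lborel) \<partial>law I)" .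
  have Ge_meas [measurable]: "(\<lambda>x. G (?e x)) \<in> borel_measurable (law I \<Otimes>\<^sub>M lborel)"
    by (rule measurable_compose[OF _ G]) measurable
  have Ge_meas' [measurable]: "(\<lambda>v. G (?e (\<omega>, v))) \<in> borel_measurable lborel" if "\<omega> \<in> space (law I)" for \<omega>
    using measurable_compose[OF measurable_Pair1'[OF that] Ge_meas] .
  define E where "E = (\<lambda>\<omega> v. kl (p j (X j \<omega>) v) (w j (X j \<omega>) v) + p j (X j \<omega>) v * G (?e (\<omega>, v)))"
  have E_nn: "0 \<le> E \<omega> v" for \<omega> v
    using kl_nn p_nonneg[OF j] G_nonneg by (simp add: E_def)
  have E_meas [measurable]: "(\<lambda>x. E (fst x) (snd x)) \<in> borel_measurable (law I \<Otimes>\<^sub>M lborel)"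
    unfolding E_def by measurable
  define G' where "G' = (\<lambda>\<omega>. enn2real (\<integral>\<^sup>+ v. ennreal (E \<omega> v) \<partial>lborel))"
  have G'_meas: "G' \<in> borel_measurable (law I)"
    unfolding G'_def using E_meas by (simp add: split_beta')
  have "AE \<omega> in law I. integrable lborel (\<lambda>v. H (\<omega>, v))"
    using LL.AE_integrable_fst'[OF intH] .
  with ent have main: "AE \<omega> in law I. integrable lborel (E \<omega>) \<and> (\<integral>v. H (\<omega>, v) \<partial>lborel) = R \<omega> + (\<integral>v. E \<omega> v \<partial>lborel)"
  proof (eventually_elim, intro conjI)
    fix \<omega>
    assume plp: "integrable lborel (\<lambda>v. p j (X j \<omega>) v * ln (p j (X j \<omega>) v))"
      and H: "integrable lborel (\<lambda>v. H (\<omega>, v))"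
    let ?x = "X j \<omega>"
    let ?c = "R \<omega> - diff_entropy (p j ?x)"
    have X: "X j (?e (\<omega>, v)) = ?x" for v using j by (simp add: causal)
    \<comment> \<open>The definition of H is solved for E, because each term on the right is known to be integrable in v.\<close>
    have E: "E \<omega> v = H (\<omega>, v) - ?c * p j ?x v + p j ?x v * ln (p j ?x v) - p j ?x v + w j ?x v" for v
      by (simp add: E_def H_def kl_def X R_indep algebra_simps)
    show "integrable lborel (E \<omega>)"
      unfolding E by (intro Bochner_Integration.integrable_add Bochner_Integration.integrable_diff
          integrable_mult_right H plp int_p int_w)
    have "(\<integral>v. E \<omega> v \<partial>lborel)
        = (\<integral>v. H (\<omega>, v) \<partial>lborel) - ?c + (\<integral>v. p j ?x v * ln (p j ?x v) \<partial>lborel) - 1 + 1"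
      unfolding E using H plp int_p[of ?x] int_w[of ?x] by simp
    then show "(\<integral>v. H (\<omega>, v) \<partial>lborel) = R \<omega> + (\<integral>v. E \<omega> v \<partial>lborel)"
      by (simp add: diff_entropy_def)
  qed
  then have G'_eq: "AE \<omega> in law I. ennreal (G' \<omega>) = (\<integral>\<^sup>+ v. ennreal (E \<omega> v) \<partial>lborel) \<and>
      (\<integral>v. H (\<omega>, v) \<partial>lborel) = R \<omega> + G' \<omega>"
  proof eventually_elim
    case (elim \<omega>)
    then have "(\<integral>\<^sup>+ v. ennreal (E \<omega> v) \<partial>lborel) = ennreal (\<integral>v. E \<omega> v \<partial>lborel)"
      by (intro nn_integral_eq_integral) (auto simp: E_nn)
    moreover have "0 \<le> (\<integral>v. E \<omega> v \<partial>lborel)" by (simp add: E_nn)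
    ultimately show ?case using elim by (simp add: G'_def)
  qed
  show ?thesis
  proof (intro exI[of _ G'] conjI allI)
    show "G' \<in> borel_measurable (path_space I)"
      using G'_meas by (simp add: measurable_cong_sets[OF sets_law refl])
    show "0 \<le> G' \<omega>" for \<omega> by (simp add: G'_def)
    have RG_meas: "(\<lambda>\<omega>. R \<omega> + G' \<omega>) \<in> borel_measurable (law I)"
      using G'_meas R by (simp add: measurable_cong_sets[OF sets_law refl])
    have inner_meas: "(\<lambda>\<omega>. \<integral>v. H (\<omega>, v) \<partial>lborel) \<in> borel_measurable (law I)"
      using borel_measurable_integrable[OF LL.integrable_fst'[OF intH]] .
    have eq: "AE \<omega> in law I. (\<integral>v. H (\<omega>, v) \<partial>lborel) = R \<omega> + G' \<omega>"
      using G'_eq by eventually_elim auto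
    show "integrable (law I) (\<lambda>\<omega>. R \<omega> + G' \<omega>)"
      using LL.integrable_fst'[OF intH] integrable_cong_AE[OF inner_meas RG_meas eq] by simp
    show "(\<integral>\<omega>. R \<omega> + G' \<omega> \<partial>law I) = (\<integral>\<omega>. ?F \<omega> \<partial>law (insert j I))"
      unfolding intF using integral_cong_AE[OF inner_meas RG_meas eq] by simp
    have "(\<integral>\<^sup>+ \<omega>. ennreal (G' \<omega>) \<partial>law I) = (\<integral>\<^sup>+ \<omega>. (\<integral>\<^sup>+ v. ennreal (E \<omega> v) \<partial>lborel) \<partial>law I)"
      by (rule nn_integral_cong_AE) (use G'_eq in \<open>eventually_elim, auto\<close>)
    also have "\<dots> = (\<integral>\<^sup>+ \<omega>. (\<integral>\<^sup>+ v. ennreal (kl (p j (X j \<omega>) v) (w j (X j \<omega>) v)) \<partial>lborel)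
        + (\<integral>\<^sup>+ v. ennreal (p j (X j \<omega>) v) * ennreal (G (?e (\<omega>, v))) \<partial>lborel) \<partial>law I)"
    proof (rule nn_integral_cong)
      fix \<omega> assume \<omega>: "\<omega> \<in> space (law I)"
      note [measurable] = Ge_meas'[OF \<omega>]
      have "ennreal (E \<omega> v) = ennreal (kl (p j (X j \<omega>) v) (w j (X j \<omega>) v)) + ennreal (p j (X j \<omega>) v) * ennreal (G (?e (\<omega>, v)))" for v
        using kl_nn p_nonneg[OF j] G_nonneg by (simp add: E_def ennreal_mult)
      then show "(\<integral>\<^sup>+ v. ennreal (E \<omega> v) \<partial>lborel) = (\<integral>\<^sup>+ v. ennreal (kl (p j (X j \<omega>) v) (w j (X j \<omega>) v)) \<partial>lborel)
        + (\<integral>\<^sup>+ v. ennreal (p j (X j \<omega>) v) * ennreal (G (?e (\<omega>, v))) \<partial>lborel)"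
        by (simp add: nn_integral_add)
    qed
    also have "\<dots> = (\<integral>\<^sup>+ \<omega>. (\<integral>\<^sup>+ v. ennreal (kl (p j (X j \<omega>) v) (w j (X j \<omega>) v)) \<partial>lborel) \<partial>law I)
        + (\<integral>\<^sup>+ \<omega>. (\<integral>\<^sup>+ v. ennreal (p j (X j \<omega>) v) * ennreal (G (?e (\<omega>, v))) \<partial>lborel) \<partial>law I)"
      by (rule nn_integral_add) measurable
    also have "(\<integral>\<^sup>+ \<omega>. (\<integral>\<^sup>+ v. ennreal (p j (X j \<omega>) v) * ennreal (G (?e (\<omega>, v))) \<partial>lborel) \<partial>law I)
        = (\<integral>\<^sup>+ \<omega>. ennreal (G \<omega>) \<partial>law (insert j I))"
      by (rule nn_integral_law_insert[OF I top, symmetric]) measurable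
    finally show "(\<integral>\<^sup>+ \<omega>. ennreal (G' \<omega>) \<partial>law I) =
      (\<integral>\<^sup>+ \<omega>. (\<integral>\<^sup>+ v. ennreal (kl (p j (X j \<omega>) v) (w j (X j \<omega>) v)) \<partial>lborel) \<partial>law I)
      + (\<integral>\<^sup>+ \<omega>. ennreal (G \<omega>) \<partial>law (insert j I))" .
  qed
qed

lemma diff_entropy_measurable:
  assumes k: "k < N"
  shows "(\<lambda>x. diff_entropy (p k x)) \<in> borel_measurable borel"
proof -
  note [measurable (raw)] = p_measurable'[OF k]
  have "(\<lambda>(x, v). p k x v * ln (p k x v)) \<in> borel_measurable (borel \<Otimes>\<^sub>M lborel)" by measurable
  then show ?thesis
    unfolding diff_entropy_def by (intro borel_measurable_uminus lborel.borel_measurable_lebesgue_integral)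
qed

lemma integrable_entropy_pred:
  assumes k: "k < N"
  shows "Measurable.pred borel (\<lambda>x. integrable lborel (\<lambda>v. p k x v * ln (p k x v)))"
proof -
  note [measurable (raw)] = p_measurable'[OF k]
  have "(\<lambda>(x, v). p k x v * ln (p k x v)) \<in> borel_measurable (borel \<Otimes>\<^sub>M lborel)" by measurable
  then show ?thesis by (intro lborel.borel_measurable_lebesgue_integrable)
qed

text \<open>The chain rule for relative entropy, under integrability of the total only.  The nonnegative
  remainder \<open>G\<close> makes it inductive: it collects the contributions of the controls that have
  been integrated out.\<close>

theorem relative_entropy_sum:
  assumes w: "is_policy N w" and w_pos: "\<And>k x v. k < N \<Longrightarrow> 0 < w k x v"
    and "finite I" "I \<subseteq> {..<N}"
    and "\<And>k. k \<in> I \<Longrightarrow> AE \<omega> in law I. integrable lborel (\<lambda>v. p k (X k \<omega>) v * ln (p k (X k \<omega>) v))"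
    and "\<And>\<omega>. 0 \<le> G \<omega>" and "G \<in> borel_measurable (path_space I)"
    and "integrable (law I)
      (\<lambda>\<omega>. (\<Sum>k\<in>I. - ln (w k (X k \<omega>) (snd \<omega> k)) - diff_entropy (p k (X k \<omega>))) + G \<omega>)"
  shows "0 \<le> (\<integral>\<omega>. (\<Sum>k\<in>I. - ln (w k (X k \<omega>) (snd \<omega> k)) - diff_entropy (p k (X k \<omega>))) + G \<omega> \<partial>law I)
    \<and> ennreal (\<integral>\<omega>. (\<Sum>k\<in>I. - ln (w k (X k \<omega>) (snd \<omega> k)) - diff_entropy (p k (X k \<omega>))) + G \<omega> \<partial>law I)
    = (\<Sum>k\<in>I. \<integral>\<^sup>+ \<omega>. (\<integral>\<^sup>+ v. ennreal (kl (p k (X k \<omega>) v) (w k (X k \<omega>) v)) \<partial>lborel) \<partial>law I)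
      + (\<integral>\<^sup>+ \<omega>. ennreal (G \<omega>) \<partial>law I)"
  using assms(3-)
proof (induction I arbitrary: G rule: finite_ranking_induct[where f = r])
  case empty
  then show ?case by (simp add: nn_integral_eq_integral)
next
  case (insert j I)
  show ?case
  proof (cases "j \<in> I")
    case True
    then have eq: "insert j I = I" by auto
    show ?thesis unfolding eq by (rule insert.IH) (use insert.prems in \<open>simp_all only: eq\<close>)
  next
    case False
    have j: "j < N" and IN: "I \<subseteq> {..<N}" and JN: "insert j I \<subseteq> {..<N}" using insert by auto
    note I = insert.hyps(1) False JN
    have top: "\<And>i. i \<in> I \<Longrightarrow> r i \<le> r j" by (rule insert.hyps(2))
    let ?t = "\<lambda>k \<omega>. - ln (w k (X k \<omega>) (snd \<omega> k)) - diff_entropy (p k (X k \<omega>))"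
    let ?KL = "\<lambda>k \<omega>. \<integral>\<^sup>+ v. ennreal (kl (p k (X k \<omega>) v) (w k (X k \<omega>) v)) \<partial>lborel"
    let ?R = "\<lambda>\<omega>. \<Sum>k\<in>I. ?t k \<omega>"
    have w_meas: "(\<lambda>x. w k (fst x) (snd x)) \<in> borel_measurable (borel \<Otimes>\<^sub>M borel)" if "k < N" for k
      using w that by (simp add: is_policy_def split_beta')
    have w_meas': "(\<lambda>x. w k (g x) (h x)) \<in> borel_measurable M"
      if "k < N" "g \<in> M \<rightarrow>\<^sub>M borel" "h \<in> M \<rightarrow>\<^sub>M borel" for k g h and M :: "'z measure"
      using measurable_compose[OF measurable_Pair[OF that(2,3)] w_meas[OF that(1)]] by simp
    have t_meas: "?t k \<in> borel_measurable (path_space J)" if "k < N" for k J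
    proof -
      note [measurable (raw)] = w_meas'[OF that]
      note [measurable] = diff_entropy_measurable[OF that]
      show ?thesis by measurable
    qed
    have t_indep: "?t k (extend_path j (\<omega>, v)) = ?t k \<omega>" if "k \<in> I" for k \<omega> v
      using that IN top[OF that] False by (auto simp: causal)
    have AEI: "AE \<omega> in law I. integrable lborel (\<lambda>v. p k (X k \<omega>) v * ln (p k (X k \<omega>) v))"
      if "k \<in> insert j I" for k
      using AE_law_insert_imp[OF I top that integrable_entropy_pred, OF _ _ insert.prems(2)[OF that]] that JN by auto
    have split: "(\<Sum>k\<in>insert j I. ?t k \<omega>) + G \<omega> = ?R \<omega> + ?t j \<omega> + G \<omega>" for \<omega>
      using insert.hyps(1) False by simp
    have "\<exists>G'. G' \<in> borel_measurable (path_space I) \<and> (\<forall>\<omega>. 0 \<le> G' \<omega>) \<and>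
      integrable (law I) (\<lambda>\<omega>. ?R \<omega> + G' \<omega>) \<and>
      (\<integral>\<omega>. ?R \<omega> + G' \<omega> \<partial>law I) = (\<integral>\<omega>. ?R \<omega> + ?t j \<omega> + G \<omega> \<partial>law (insert j I)) \<and>
      (\<integral>\<^sup>+ \<omega>. ennreal (G' \<omega>) \<partial>law I) = (\<integral>\<^sup>+ \<omega>. ?KL j \<omega> \<partial>law I) + (\<integral>\<^sup>+ \<omega>. ennreal (G \<omega>) \<partial>law (insert j I))"
    proof (rule relative_entropy_peel[OF w w_pos I top, of ?R G])
      show "AE \<omega> in law I. integrable lborel (\<lambda>v. p j (X j \<omega>) v * ln (p j (X j \<omega>) v))"
        by (rule AEI) simp
      show "?R \<in> borel_measurable (path_space I)"
        using IN by (intro borel_measurable_sum t_meas) auto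
      show "?R (extend_path j (\<omega>, v)) = ?R \<omega>" for \<omega> v
        by (intro sum.cong t_indep) auto
      show "G \<in> borel_measurable (path_space (insert j I))" "\<And>\<omega>. 0 \<le> G \<omega>" using insert.prems by auto
      show "integrable (law (insert j I)) (\<lambda>\<omega>. ?R \<omega> + ?t j \<omega> + G \<omega>)"
        using insert.prems(5) unfolding split .
    qed
    then obtain G' where G': "G' \<in> borel_measurable (path_space I)" "\<And>\<omega>. 0 \<le> G' \<omega>"
      "integrable (law I) (\<lambda>\<omega>. ?R \<omega> + G' \<omega>)"
      "(\<integral>\<omega>. ?R \<omega> + G' \<omega> \<partial>law I) = (\<integral>\<omega>. ?R \<omega> + ?t j \<omega> + G \<omega> \<partial>law (insert j I))"
      "(\<integral>\<^sup>+ \<omega>. ennreal (G' \<omega>) \<partial>law I) = (\<integral>\<^sup>+ \<omega>. ?KL j \<omega> \<partial>law I) + (\<integral>\<^sup>+ \<omega>. ennreal (G \<omega>) \<partial>law (insert j I))"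
      by blast
    have KL: "(\<integral>\<^sup>+ \<omega>. ?KL k \<omega> \<partial>law I) = (\<integral>\<^sup>+ \<omega>. ?KL k \<omega> \<partial>law (insert j I))" if "k \<in> insert j I" for k
    proof (rule nn_integral_law_insert_indep[OF I top, symmetric])
      have k: "k < N" using that JN by auto
      note [measurable (raw)] = w_meas'[OF k] p_measurable'[OF k]
      show "?KL k \<in> borel_measurable (path_space (insert j I))" by measurable
      show "?KL k (extend_path j (\<omega>, v)) = ?KL k \<omega>" for \<omega> v
        using that top k by (auto simp: causal)
    qed
    have "0 \<le> (\<integral>\<omega>. ?R \<omega> + G' \<omega> \<partial>law I) \<and> ennreal (\<integral>\<omega>. ?R \<omega> + G' \<omega> \<partial>law I)
        = (\<Sum>k\<in>I. \<integral>\<^sup>+ \<omega>. ?KL k \<omega> \<partial>law I) + (\<integral>\<^sup>+ \<omega>. ennreal (G' \<omega>) \<partial>law I)"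
      by (rule insert.IH) (use IN AEI G' in auto)
    from this[unfolded G'(4,5)] show ?thesis
      unfolding split using insert.hyps(1) False
      by (simp add: KL add_ac)
  qed
qed

end

section \<open>Optimal backward steering\<close>

text \<open>Here \<open>A\<close>, \<open>Q\<close> stand for the transformed data \<open>A - B S\<^sup>T\<close>, \<open>Q - S S\<^sup>T\<close>, and \<open>Z\<close> for \<open>\<Pi>\<close>.  The
  sign in the recursion of \<open>H\<close> is absorbed into \<open>I - B\<^sup>T H B\<close>, the covariance of the optimal policy.\<close>

locale riccati_pair =
  fixes N :: nat and A Q Z H :: "nat \<Rightarrow> real^'n^'n" and B :: "nat \<Rightarrow> real^'m^'n"
  assumes A_inv: "\<And>k. k < N \<Longrightarrow> invertible (A k)"
    and Z_sym: "\<And>k. k \<le> N \<Longrightarrow> transpose (Z k) = Z k"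
    and H_sym: "\<And>k. k \<le> N \<Longrightarrow> transpose (H k) = H k"
    and V_inv: "\<And>k. k < N \<Longrightarrow> invertible (mat 1 + transpose (B k) ** Z (Suc k) ** B k)"
    and W_inv: "\<And>k. k < N \<Longrightarrow> invertible (mat 1 - transpose (B k) ** H (Suc k) ** B k)"
    and Z_rec: "\<And>k. k < N \<Longrightarrow> Z k = transpose (A k) ** (Z (Suc k) - Z (Suc k) ** B k
      ** matrix_inv (mat 1 + transpose (B k) ** Z (Suc k) ** B k) ** transpose (B k) ** Z (Suc k)) ** A k + Q k"
    and H_rec: "\<And>k. k < N \<Longrightarrow> H k = transpose (A k) ** (H (Suc k) + H (Suc k) ** B k
      ** matrix_inv (mat 1 - transpose (B k) ** H (Suc k) ** B k) ** transpose (B k) ** H (Suc k)) ** A k - Q k"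
begin

definition V where "V k = mat 1 + transpose (B k) ** Z (Suc k) ** B k"
definition W where "W k = mat 1 - transpose (B k) ** H (Suc k) ** B k"
text \<open>The matrices \<open>A\<^sup>-\<^sup>T J A\<^sup>-\<^sup>1\<close> and \<open>A\<^sup>-\<^sup>T P A\<^sup>-\<^sup>1\<close>, written without the inverse of \<open>A\<close>.\<close>

definition Jt where "Jt k = H (Suc k) + H (Suc k) ** B k ** matrix_inv (W k) ** transpose (B k) ** H (Suc k)"
definition Pt where "Pt k = Z (Suc k) - Z (Suc k) ** B k ** matrix_inv (V k) ** transpose (B k) ** Z (Suc k)"

lemma J_eq: "k < N \<Longrightarrow> H k + Q k = transpose (A k) ** Jt k ** A k"
  using H_rec[of k] by (simp add: Jt_def W_def)

lemma P_eq: "k < N \<Longrightarrow> Z k - Q k = transpose (A k) ** Pt k ** A k"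
  using Z_rec[of k] by (simp add: Pt_def V_def)

lemma congruence_cancel:
  assumes "k < N"
  shows "transpose (matrix_inv (A k)) ** (transpose (A k) ** Y ** A k) ** matrix_inv (A k) = Y"
proof -
  have A: "invertible (A k)" by (rule A_inv[OF assms])
  have "transpose (matrix_inv (A k)) ** transpose (A k) = transpose (A k ** matrix_inv (A k))"
    by (simp add: matrix_transpose_mul)
  then have "transpose (matrix_inv (A k)) ** transpose (A k) = mat 1"
    by (simp add: invertible_matrix_inv[OF A])
  then show ?thesis
    by (simp add: matrix_mul_assoc) (simp add: matrix_mul_assoc[symmetric] invertible_matrix_inv[OF A])
qed

lemma J_dual:
  assumes k: "k < N"
  shows "transpose (matrix_inv (A k)) ** (H k + Q k) ** matrix_inv (A k) = Jt k"
    and "invertible (mat 1 + transpose (B k) ** Jt k ** B k)"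
    and "matrix_inv (mat 1 + transpose (B k) ** Jt k ** B k) = W k"
    and "H (Suc k) = Jt k - Jt k ** B k ** W k ** transpose (B k) ** Jt k"
  using riccati_duality[OF W_def W_inv[OF k, folded W_def] Jt_def]
  by (auto simp: J_eq[OF k] congruence_cancel[OF k])

text \<open>This is the duality for the matrix \<open>- Z\<close>, whose transform is \<open>- Pt\<close>.\<close>

lemma P_dual:
  assumes k: "k < N"
  shows "transpose (matrix_inv (A k)) ** (Z k - Q k) ** matrix_inv (A k) = Pt k"
    and "invertible (mat 1 - transpose (B k) ** Pt k ** B k)"
    and "matrix_inv (mat 1 - transpose (B k) ** Pt k ** B k) = V k"
    and "Z (Suc k) = Pt k + Pt k ** B k ** V k ** transpose (B k) ** Pt k"
proof -
  have V: "V k = mat 1 - transpose (B k) ** (- Z (Suc k)) ** B k"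
    by (simp add: V_def matrix_eq mv_simps)
  have Pt: "- Pt k = - Z (Suc k) + (- Z (Suc k)) ** B k ** matrix_inv (V k) ** transpose (B k) ** (- Z (Suc k))"
    by (simp add: Pt_def matrix_eq mv_simps)
  have e: "mat 1 + transpose (B k) ** (- Pt k) ** B k = mat 1 - transpose (B k) ** Pt k ** B k"
    by (simp add: matrix_eq mv_simps)
  note d = riccati_duality[OF V V_inv[OF k, folded V_def] Pt]
  show "transpose (matrix_inv (A k)) ** (Z k - Q k) ** matrix_inv (A k) = Pt k"
    by (simp add: P_eq[OF k] congruence_cancel[OF k])
  show "invertible (mat 1 - transpose (B k) ** Pt k ** B k)"
    "matrix_inv (mat 1 - transpose (B k) ** Pt k ** B k) = V k"
    using d(1,2) by (simp_all add: e)
  show "Z (Suc k) = Pt k + Pt k ** B k ** V k ** transpose (B k) ** Pt k"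
    unfolding matrix_eq
  proof
    fix x
    have "(- Z (Suc k)) *v x = (- Pt k - - Pt k ** B k ** V k ** transpose (B k) ** - Pt k) *v x"
      using d(3) by simp
    then have "- (Z (Suc k) *v x) = - ((Pt k + Pt k ** B k ** V k ** transpose (B k) ** Pt k) *v x)"
      by (simp add: mv_simps)
    then show "Z (Suc k) *v x = (Pt k + Pt k ** B k ** V k ** transpose (B k) ** Pt k) *v x" by simp
  qed
qed

end

lemma bwd_state_step:
  "k < N \<Longrightarrow> bwd_state N A B k \<omega> =
    matrix_inv (A k) *v bwd_state N A B (Suc k) \<omega> - (matrix_inv (A k) ** B k) *v snd \<omega> k"
  by (subst bwd_state.simps) simp

lemma bwd_state_end: "N \<le> k \<Longrightarrow> bwd_state N A B k \<omega> = fst \<omega>"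
  by (subst bwd_state.simps) simp

lemma borel_measurable_bwd_state [measurable]:
  "bwd_state N A B k \<in> borel_measurable (path_space I)"
proof (induction "N - k" arbitrary: k)
  case 0
  then have "bwd_state N A B k = (\<lambda>\<omega>. fst \<omega>)" by (auto simp: bwd_state_end)
  then show ?case by simp
next
  case (Suc m)
  then have k: "k < N" and "m = N - Suc k" by auto
  then have [measurable]: "bwd_state N A B (Suc k) \<in> borel_measurable (path_space I)" using Suc by blast
  have "bwd_state N A B k = (\<lambda>\<omega>. matrix_inv (A k) *v bwd_state N A B (Suc k) \<omega>
      - (matrix_inv (A k) ** B k) *v snd \<omega> k)"
    using k by (auto simp: bwd_state_step)
  then show ?case by simp
qed

lemma bwd_state_extend_path:
  "j < k \<Longrightarrow> bwd_state N A B k (extend_path j (\<omega>, v)) = bwd_state N A B k \<omega>"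
proof (induction "N - k" arbitrary: k)
  case 0
  then show ?case by (simp add: bwd_state_end)
next
  case (Suc m)
  then have k: "k < N" and m: "m = N - Suc k" by auto
  show ?case
    unfolding bwd_state_step[OF k] using Suc.hyps(1)[OF m] Suc.prems by simp
qed

lemma borel_measurable_fwd_state [measurable]:
  "fwd_state A B k \<in> borel_measurable (path_space I)"
proof (induction k)
  case 0
  have "fwd_state A B 0 = (\<lambda>\<omega>. fst \<omega>)" by auto
  then show ?case by simp
next
  case (Suc k)
  note [measurable] = Suc
  have "fwd_state A B (Suc k) = (\<lambda>\<omega>. A k *v fwd_state A B k \<omega> + B k *v snd \<omega> k)" by auto
  then show ?case by simp
qed

lemma fwd_state_extend_path:
  "k \<le> j \<Longrightarrow> fwd_state A B k (extend_path j (\<omega>, v)) = fwd_state A B k \<omega>"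
  by (induction k) auto

lemma causal_process_bwd:
  assumes "pos_def \<Sigma>" "is_policy N q"
  shows "causal_process N (gaussian_density 0 \<Sigma>) (\<lambda>k. bwd_state N A B (Suc k)) q (\<lambda>k. - int k)"
  by standard (use assms in \<open>auto simp: nn_integral_gaussian bwd_state_extend_path\<close>)

lemma causal_process_fwd:
  assumes "pos_def \<Sigma>" "is_policy N q"
  shows "causal_process N (gaussian_density 0 \<Sigma>) (fwd_state A B) q int"
  by standard (use assms in \<open>auto simp: nn_integral_gaussian fwd_state_extend_path\<close>)

lemma (in causal_process) nn_integral_law_initial:
  assumes [measurable]: "F \<in> borel_measurable borel"
  shows "(\<integral>\<^sup>+ \<omega>. F (fst \<omega>) \<partial>law {..<N}) = (\<integral>\<^sup>+ x. ennreal (f x) * F x \<partial>lborel)"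
proof -
  interpret P: product_sigma_finite "\<lambda>_ :: nat. lborel :: (real^'m) measure" ..
  interpret E: sigma_finite_measure "\<Pi>\<^sub>M k\<in>({} :: nat set). (lborel :: (real^'m) measure)"
    by (rule P.sigma_finite) simp
  have "(\<integral>\<^sup>+ \<omega>. F (fst \<omega>) \<partial>law {..<N}) = (\<integral>\<^sup>+ \<omega>. F (fst \<omega>) \<partial>law {})"
    using nn_integral_law_marginal[of "{..<N}" "{}" "\<lambda>\<omega>. F (fst \<omega>)"] by simp
  also have "\<dots> = (\<integral>\<^sup>+ \<omega>. ennreal (f (fst \<omega>)) * F (fst \<omega>) \<partial>(path_space {} :: ('n, 'm) path measure))"
    unfolding law_def by (subst nn_integral_density) simp_all
  also have "\<dots> = (\<integral>\<^sup>+ z. (\<integral>\<^sup>+ w. ennreal (f z) * F z \<partial>(\<Pi>\<^sub>M k\<in>({} :: nat set). (lborel :: (real^'m) measure))) \<partial>lborel)"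
    by (subst E.nn_integral_fst[symmetric]) simp_all
  also have "\<dots> = (\<integral>\<^sup>+ x. ennreal (f x) * F x \<partial>lborel)"
    by (simp add: space_PiM PiM_empty)
  finally show ?thesis .
qed

lemma distr_eq_densityI:
  fixes X :: "'w \<Rightarrow> 'a::euclidean_space"
  assumes [measurable]: "X \<in> borel_measurable M" "g \<in> borel_measurable borel"
    and eq: "\<And>F :: 'a \<Rightarrow> ennreal. F \<in> borel_measurable borel \<Longrightarrow>
      (\<integral>\<^sup>+ \<omega>. F (X \<omega>) \<partial>M) = (\<integral>\<^sup>+ x. ennreal (g x) * F x \<partial>lborel)"
  shows "distr M borel X = density lborel (\<lambda>x. ennreal (g x))"
proof (rule measure_eqI)
  fix S assume "S \<in> sets (distr M borel X)"
  then have [measurable]: "S \<in> sets borel" by simp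
  have "emeasure (distr M borel X) S = (\<integral>\<^sup>+ x. indicator S x \<partial>distr M borel X)" by simp
  also have "\<dots> = (\<integral>\<^sup>+ \<omega>. indicator S (X \<omega>) \<partial>M)" by (rule nn_integral_distr) measurable
  also have "\<dots> = emeasure (density lborel (\<lambda>x. ennreal (g x))) S"
    by (simp add: eq emeasure_density)
  finally show "emeasure (distr M borel X) S = emeasure (density lborel (\<lambda>x. ennreal (g x))) S" .
qed simp

lemma nn_integral_distr_density:
  fixes X :: "'w \<Rightarrow> 'a::euclidean_space"
  assumes D: "distr M borel X = density lborel (\<lambda>x. ennreal (g x))"
    and [measurable]: "X \<in> borel_measurable M" "g \<in> borel_measurable borel" "F \<in> borel_measurable borel"
  shows "(\<integral>\<^sup>+ \<omega>. F (X \<omega>) \<partial>M) = (\<integral>\<^sup>+ x. ennreal (g x) * F x \<partial>lborel)"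
proof -
  have "(\<integral>\<^sup>+ \<omega>. F (X \<omega>) \<partial>M) = (\<integral>\<^sup>+ x. F x \<partial>distr M borel X)" by (simp add: nn_integral_distr)
  then show ?thesis by (simp add: D nn_integral_density)
qed

lemma is_policy_gaussian:
  assumes "\<And>k. k < N \<Longrightarrow> pos_def (C k)" and [measurable]: "\<And>k. m k \<in> borel_measurable borel"
  shows "is_policy N (\<lambda>k x. gaussian_density (m k x) (C k))"
  using assms(1) by (auto simp: is_policy_def nn_integral_gaussian)

locale gaussian_steering = riccati_pair N A Q Z H B
  for N and A Q Z H :: "nat \<Rightarrow> real^'n^'n" and B :: "nat \<Rightarrow> real^'m^'n" +
  fixes \<Sigma>0 \<Sigma>N :: "real^'n^'n"
  assumes \<Sigma>0: "pos_def \<Sigma>0" "matrix_inv \<Sigma>0 = Z 0 + H 0"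
    and \<Sigma>N: "pos_def \<Sigma>N" "matrix_inv \<Sigma>N = Z N + H N"
    and W_pos: "\<And>k. k < N \<Longrightarrow> pos_def (W k)"
begin

definition \<Sigma> where "\<Sigma> k = matrix_inv (Z k + H k)"

definition opt_policy :: "('n, 'm) policy" where
  "opt_policy = (\<lambda>k \<xi>. gaussian_density (transpose (B k) *v (H (Suc k) *v \<xi>)) (W k))"

lemma precision_rec:
  "k < N \<Longrightarrow> Z k + H k = transpose (A k) ** Jt k ** A k + transpose (A k) ** Pt k ** A k"
  using J_eq[of k] P_eq[of k] by (simp add: algebra_simps)

lemma precision_sym: "k \<le> N \<Longrightarrow> transpose (Z k + H k) = Z k + H k"
  using Z_sym[of k] H_sym[of k] by (simp add: transpose_def vec_eq_iff)

text \<open>The induction starts from the prescribed covariance at the final time and goes backwards.\<close>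

lemma precision_pos_def: "k \<le> N \<Longrightarrow> pos_def (Z k + H k)"
proof (induction rule: inc_induct)
  case base
  show ?case using \<Sigma>N pos_def_matrix_inv by metis
next
  case (step k)
  show ?case
    by (rule joint_quadratic_pos_def(1)[OF H_sym Z_sym precision_sym W_def W_pos V_def V_inv[folded V_def] A_inv
          precision_rec[unfolded Jt_def Pt_def]])
      (use step in auto)
qed

lemma V_pos: "k < N \<Longrightarrow> pos_def (V k)"
  by (rule joint_quadratic_pos_def(2)[OF H_sym Z_sym precision_sym W_def W_pos V_def V_inv[folded V_def] A_inv
        precision_rec[unfolded Jt_def Pt_def]])
    (use precision_pos_def in auto)

lemma \<Sigma>_pos: "k \<le> N \<Longrightarrow> pos_def (\<Sigma> k)"
  unfolding \<Sigma>_def by (intro pos_def_matrix_inv precision_pos_def)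

lemma \<Sigma>_0: "\<Sigma> 0 = \<Sigma>0" and \<Sigma>_N: "\<Sigma> N = \<Sigma>N"
  unfolding \<Sigma>_def \<Sigma>0(2)[symmetric] \<Sigma>N(2)[symmetric]
  using \<Sigma>0(1) \<Sigma>N(1) by (simp_all add: invertible_matrix_inv_self pos_def_invertible)

text \<open>In terms of \<open>\<Sigma>\<close>: the optimal backward policy reverses, in the sense of Bayes, the forward step
  that starts in \<open>N(0, \<Sigma> k)\<close> and has the control distribution on the left-hand side.\<close>

lemma time_reversal:
  assumes k: "k < N" and F: "(\<lambda>(x, y). F x y) \<in> borel_measurable (borel \<Otimes>\<^sub>M borel)"
  shows "(\<integral>\<^sup>+ x. ennreal (gaussian_density 0 (\<Sigma> k) x) * (\<integral>\<^sup>+ v.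
        ennreal (gaussian_density (- (matrix_inv (V k) *v (transpose (B k) *v (Z (Suc k) *v (A k *v x))))) (matrix_inv (V k)) v)
          * F x (A k *v x + B k *v v) \<partial>lborel) \<partial>lborel)
    = (\<integral>\<^sup>+ y. ennreal (gaussian_density 0 (\<Sigma> (Suc k)) y) * (\<integral>\<^sup>+ v. ennreal (opt_policy k y v)
          * F (matrix_inv (A k) *v y - (matrix_inv (A k) ** B k) *v v) y \<partial>lborel) \<partial>lborel)"
  unfolding \<Sigma>_def opt_policy_def
  by (rule nn_integral_gaussian_time_reversal[OF H_sym Z_sym precision_sym W_def W_pos V_def V_inv[folded V_def] A_inv
        precision_rec[unfolded Jt_def Pt_def] precision_pos_def F])
    (use k in auto)

lemma opt_policy: "is_policy N opt_policy"
  unfolding opt_policy_def using W_pos by (intro is_policy_gaussian) auto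

lemma opt_policy_pos: "k < N \<Longrightarrow> 0 < opt_policy k x v"
  unfolding opt_policy_def using W_pos by (intro gaussian_density_pos) auto

text \<open>Backward induction.  In \<open>time_reversal\<close> the integrand is chosen to depend on the earlier state only;
  the control on the forward side then integrates to one and leaves the Gaussian law of that state.\<close>

lemma bwd_state_law:
  assumes "k \<le> N"
  shows "distr (bwd_law N A B \<Sigma>N opt_policy) borel (bwd_state N A B k) = gaussian_measure 0 (\<Sigma> k)"
proof -
  interpret L: causal_process N "gaussian_density 0 \<Sigma>N" "\<lambda>k. bwd_state N A B (Suc k)" opt_policy "\<lambda>k. - int k"
    by (rule causal_process_bwd[OF \<Sigma>N(1) opt_policy])
  have law: "bwd_law N A B \<Sigma>N opt_policy = L.law {..<N}"
    unfolding bwd_law_def by (rule L.path_law_eq)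
  have meas [measurable]: "bwd_state N A B k \<in> borel_measurable (L.law {..<N})" for k
    by measurable
  show ?thesis
    unfolding law using assms
  proof (induction rule: inc_induct)
    case base
    show ?case
    proof (rule distr_eq_densityI)
      fix F :: "real^'n \<Rightarrow> ennreal" assume "F \<in> borel_measurable borel"
      then show "(\<integral>\<^sup>+ \<omega>. F (bwd_state N A B N \<omega>) \<partial>L.law {..<N})
          = (\<integral>\<^sup>+ x. ennreal (gaussian_density 0 (\<Sigma> N) x) * F x \<partial>lborel)"
        using L.nn_integral_law_initial[of F] by (simp add: bwd_state_end \<Sigma>_N)
    qed measurable
  next
    case (step k)
    show ?case
    proof (rule distr_eq_densityI)
      fix F :: "real^'n \<Rightarrow> ennreal" assume F [measurable]: "F \<in> borel_measurable borel"
      note [measurable (raw)] = L.p_measurable'[OF step(2)]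
      let ?x = "\<lambda>y v. matrix_inv (A k) *v y - (matrix_inv (A k) ** B k) *v v"
      let ?G = "\<lambda>(y, v). F (?x y v)"
      have "(\<integral>\<^sup>+ \<omega>. F (bwd_state N A B k \<omega>) \<partial>L.law {..<N})
          = (\<integral>\<^sup>+ \<omega>. ?G (bwd_state N A B (Suc k) \<omega>, snd \<omega> k) \<partial>L.law {..<N})"
        by (simp add: bwd_state_step[OF step(2)])
      also have "\<dots> = (\<integral>\<^sup>+ \<omega>. (\<integral>\<^sup>+ v. ennreal (opt_policy k (bwd_state N A B (Suc k) \<omega>) v)
          * ?G (bwd_state N A B (Suc k) \<omega>, v) \<partial>lborel) \<partial>L.law {..<N})"
        by (rule L.nn_integral_law_disintegrate[OF step(2)]) measurable
      also have "\<dots> = (\<integral>\<^sup>+ y. ennreal (gaussian_density 0 (\<Sigma> (Suc k)) y) *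
          (\<integral>\<^sup>+ v. ennreal (opt_policy k y v) * F (?x y v) \<partial>lborel) \<partial>lborel)"
        unfolding prod.case by (rule nn_integral_distr_density[OF step.IH]) measurable
      also have "\<dots> = (\<integral>\<^sup>+ x. ennreal (gaussian_density 0 (\<Sigma> k) x) * (\<integral>\<^sup>+ v.
          ennreal (gaussian_density (- (matrix_inv (V k) *v (transpose (B k) *v (Z (Suc k) *v (A k *v x))))) (matrix_inv (V k)) v)
            * F x \<partial>lborel) \<partial>lborel)"
        by (rule time_reversal[OF step(2), symmetric]) measurable
      also have "\<dots> = (\<integral>\<^sup>+ x. ennreal (gaussian_density 0 (\<Sigma> k) x) * F x \<partial>lborel)"
        using V_pos[OF step(2)] by (simp add: nn_integral_multc nn_integral_gaussian pos_def_matrix_inv)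
      finally show "(\<integral>\<^sup>+ \<omega>. F (bwd_state N A B k \<omega>) \<partial>L.law {..<N})
          = (\<integral>\<^sup>+ x. ennreal (gaussian_density 0 (\<Sigma> k) x) * F x \<partial>lborel)" .
    qed measurable
  qed
qed

text \<open>The cross term \<open>S\<close> only shifts the control: \<open>v = u + S\<^sup>T x\<close> has the mean \<open>K x\<close>, and
  \<open>A0 x + B u = A x + B v\<close>.  After this substitution the step is the one in \<open>time_reversal\<close>.\<close>

lemma fwd_state_law:
  assumes A0: "\<And>k. k < N \<Longrightarrow> A k = A0 k - B k ** transpose (S k)"
    and pol: "pol = (\<lambda>k x. gaussian_density
      (- (matrix_inv (V k) ** (transpose (B k) ** Z (Suc k) ** A0 k + transpose (S k))) *v x) (matrix_inv (V k)))"
    and "k \<le> N"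
  shows "distr (fwd_law N A0 B \<Sigma>0 pol) borel (fwd_state A0 B k) = gaussian_measure 0 (\<Sigma> k)"
proof -
  have policy: "is_policy N pol"
    unfolding pol using V_pos by (intro is_policy_gaussian) (auto intro: pos_def_matrix_inv)
  interpret L: causal_process N "gaussian_density 0 \<Sigma>0" "fwd_state A0 B" pol int
    by (rule causal_process_fwd[OF \<Sigma>0(1) policy])
  have law: "fwd_law N A0 B \<Sigma>0 pol = L.law {..<N}"
    unfolding fwd_law_def by (rule L.path_law_eq)
  have meas [measurable]: "fwd_state A0 B k \<in> borel_measurable (L.law {..<N})" for k
    by measurable
  show ?thesis
    unfolding law using assms(3)
  proof (induction k)
    case 0
    show ?case
    proof (rule distr_eq_densityI)
      fix F :: "real^'n \<Rightarrow> ennreal" assume "F \<in> borel_measurable borel"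
      then show "(\<integral>\<^sup>+ \<omega>. F (fwd_state A0 B 0 \<omega>) \<partial>L.law {..<N})
          = (\<integral>\<^sup>+ x. ennreal (gaussian_density 0 (\<Sigma> 0) x) * F x \<partial>lborel)"
        using L.nn_integral_law_initial[of F] by (simp add: \<Sigma>_0)
    qed measurable
  next
    case (Suc k)
    then have k: "k < N" by simp
    note IH = Suc.IH[OF less_imp_le[OF k]]
    show ?case
    proof (rule distr_eq_densityI)
      fix F :: "real^'n \<Rightarrow> ennreal" assume F [measurable]: "F \<in> borel_measurable borel"
      note [measurable (raw)] = L.p_measurable'[OF k]
      let ?G = "\<lambda>(x, u). F (A0 k *v x + B k *v u)"
      let ?m = "\<lambda>x. - (matrix_inv (V k) *v (transpose (B k) *v (Z (Suc k) *v (A k *v x))))"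
      have "(\<integral>\<^sup>+ \<omega>. F (fwd_state A0 B (Suc k) \<omega>) \<partial>L.law {..<N})
          = (\<integral>\<^sup>+ \<omega>. ?G (fwd_state A0 B k \<omega>, snd \<omega> k) \<partial>L.law {..<N})" by simp
      also have "\<dots> = (\<integral>\<^sup>+ \<omega>. (\<integral>\<^sup>+ u. ennreal (pol k (fwd_state A0 B k \<omega>) u)
          * ?G (fwd_state A0 B k \<omega>, u) \<partial>lborel) \<partial>L.law {..<N})"
        by (rule L.nn_integral_law_disintegrate[OF k]) measurable
      also have "\<dots> = (\<integral>\<^sup>+ x. ennreal (gaussian_density 0 (\<Sigma> k) x) *
          (\<integral>\<^sup>+ u. ennreal (pol k x u) * F (A0 k *v x + B k *v u) \<partial>lborel) \<partial>lborel)"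
        unfolding prod.case by (rule nn_integral_distr_density[OF IH]) measurable
      also have "\<dots> = (\<integral>\<^sup>+ x. ennreal (gaussian_density 0 (\<Sigma> k) x) *
          (\<integral>\<^sup>+ v. ennreal (gaussian_density (?m x) (matrix_inv (V k)) v) * F (A k *v x + B k *v v) \<partial>lborel) \<partial>lborel)"
      proof (rule nn_integral_cong, rule arg_cong2[where f = "(*)", OF refl])
        fix x :: "real^'n"
        let ?c = "- (transpose (S k) *v x)"
        have A0x: "A0 k *v x = A k *v x + B k *v (transpose (S k) *v x)"
          by (simp add: A0[OF k] mv_simps)
        have V: "matrix_inv (V k) *v (transpose (B k) *v (Z (Suc k) *v (B k *v s)) + s) = s" for s
        proof -
          have "transpose (B k) *v (Z (Suc k) *v (B k *v s)) + s = V k *v s"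
            by (simp add: V_def mv_simps)
          then show ?thesis by (simp add: matrix_inv_vector V_inv[OF k, folded V_def])
        qed
        have "- (matrix_inv (V k) ** (transpose (B k) ** Z (Suc k) ** A0 k + transpose (S k))) *v x
            = - (matrix_inv (V k) *v (transpose (B k) *v (Z (Suc k) *v (A k *v x)) +
                (transpose (B k) *v (Z (Suc k) *v (B k *v (transpose (S k) *v x))) + transpose (S k) *v x)))"
          by (simp add: mv_simps A0x)
        also have "\<dots> = ?m x + ?c" using V[of "transpose (S k) *v x"] by (simp add: matrix_vector_right_distrib algebra_simps)
        finally have mean: "- (matrix_inv (V k) ** (transpose (B k) ** Z (Suc k) ** A0 k + transpose (S k))) *v x = ?m x + ?c" .
        have "(\<integral>\<^sup>+ u. ennreal (pol k x u) * F (A0 k *v x + B k *v u) \<partial>lborel)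
            = (\<integral>\<^sup>+ v. ennreal (pol k x (?c + v)) * F (A0 k *v x + B k *v (?c + v)) \<partial>lborel)"
          by (rule nn_integral_lborel_add[symmetric]) measurable
        also have "\<dots> = (\<integral>\<^sup>+ v. ennreal (gaussian_density (?m x) (matrix_inv (V k)) v) * F (A k *v x + B k *v v) \<partial>lborel)"
        proof (intro nn_integral_cong arg_cong2[where f = "(*)"])
          fix v
          show "ennreal (pol k x (?c + v)) = ennreal (gaussian_density (?m x) (matrix_inv (V k)) v)"
            unfolding pol mean using gaussian_density_translate[of "?m x" ?c "matrix_inv (V k)" v]
            by (simp add: add.commute)
          show "F (A0 k *v x + B k *v (?c + v)) = F (A k *v x + B k *v v)"
            by (simp add: A0x mv_simps)
        qed
        finally show "(\<integral>\<^sup>+ u. ennreal (pol k x u) * F (A0 k *v x + B k *v u) \<partial>lborel)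
            = (\<integral>\<^sup>+ v. ennreal (gaussian_density (?m x) (matrix_inv (V k)) v) * F (A k *v x + B k *v v) \<partial>lborel)" .
      qed
      also have "\<dots> = (\<integral>\<^sup>+ y. ennreal (gaussian_density 0 (\<Sigma> (Suc k)) y) *
          (\<integral>\<^sup>+ v. ennreal (opt_policy k y v) * F y \<partial>lborel) \<partial>lborel)"
        by (rule time_reversal[OF k]) measurable
      also have "\<dots> = (\<integral>\<^sup>+ y. ennreal (gaussian_density 0 (\<Sigma> (Suc k)) y) * F y \<partial>lborel)"
        unfolding opt_policy_def using W_pos[OF k] by (simp add: nn_integral_multc nn_integral_gaussian)
      finally show "(\<integral>\<^sup>+ \<omega>. F (fwd_state A0 B (Suc k) \<omega>) \<partial>L.law {..<N})
          = (\<integral>\<^sup>+ x. ennreal (gaussian_density 0 (\<Sigma> (Suc k)) x) * F x \<partial>lborel)" .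
    qed measurable
  qed
qed

definition log_norm where
  "log_norm k = ln (sqrt ((2 * pi) ^ CARD('m) * det (W k)))"

text \<open>The exponent of the optimal Gaussian policy is exactly the square that remains when the
  running cost is completed with the quadratic form of \<open>J = H + Q\<close>.\<close>

lemma stage_cost_identity:
  assumes k: "k < N"
  defines "\<xi> \<equiv> bwd_state N A B"
  shows "(norm (snd \<omega> k))\<^sup>2 / 2 + (\<xi> k \<omega> \<bullet> ((H k + Q k) *v \<xi> k \<omega>)) / 2
    = (\<xi> (Suc k) \<omega> \<bullet> (H (Suc k) *v \<xi> (Suc k) \<omega>)) / 2
      - ln (opt_policy k (\<xi> (Suc k) \<omega>) (snd \<omega> k)) - log_norm k"
proof -
  let ?y = "\<xi> (Suc k) \<omega>" and ?v = "snd \<omega> k"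
  have "A k *v \<xi> k \<omega> = ?y - B k *v ?v"
    unfolding \<xi>_def bwd_state_step[OF k] by (simp add: mv_simps matrix_inv_vector[OF A_inv[OF k]])
  then have "\<xi> k \<omega> \<bullet> ((H k + Q k) *v \<xi> k \<omega>) = (?y - B k *v ?v) \<bullet> (Jt k *v (?y - B k *v ?v))"
    by (simp only: J_eq[OF k] matrix_vector_mul_assoc[symmetric] inner_transpose_mv)
  moreover have "?v \<bullet> ?v + (?y - B k *v ?v) \<bullet> (Jt k *v (?y - B k *v ?v)) = ?y \<bullet> (H (Suc k) *v ?y)
      + (?v - transpose (B k) *v (H (Suc k) *v ?y)) \<bullet> (matrix_inv (W k) *v (?v - transpose (B k) *v (H (Suc k) *v ?y)))"
    by (rule riccati_quadratic_identity[OF H_sym W_def W_inv[folded W_def] Jt_def]) (use k in auto)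
  ultimately show ?thesis
    using ln_gaussian_density[OF W_pos[OF k], of "transpose (B k) *v (H (Suc k) *v ?y)" ?v]
    unfolding opt_policy_def log_norm_def power2_norm_eq_inner by argo
qed

lemma path_cost_identity:
  defines "\<xi> \<equiv> bwd_state N A B"
  shows "bwd_path_cost N A B Q q \<omega> =
    (\<Sum>k<N. - ln (opt_policy k (\<xi> (Suc k) \<omega>) (snd \<omega> k)) - diff_entropy (q k (\<xi> (Suc k) \<omega>)))
    + (\<xi> N \<omega> \<bullet> ((H N + Q N) *v \<xi> N \<omega>)) / 2 - (\<xi> 0 \<omega> \<bullet> ((H 0 + Q 0) *v \<xi> 0 \<omega>)) / 2 - (\<Sum>k<N. log_norm k)"
proof -
  define E where "E k = (\<xi> k \<omega> \<bullet> ((H k + Q k) *v \<xi> k \<omega>)) / 2" for k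
  have "bwd_path_cost N A B Q q \<omega> = (\<Sum>k<N. (\<xi> (Suc k) \<omega> \<bullet> (Q (Suc k) *v \<xi> (Suc k) \<omega>)) / 2
      + (norm (snd \<omega> k))\<^sup>2 / 2 - diff_entropy (q k (\<xi> (Suc k) \<omega>)))"
    unfolding bwd_path_cost_def \<xi>_def One_nat_def by (subst sum.atLeast1_atMost_eq) simp
  also have "\<dots> = (\<Sum>k<N. - ln (opt_policy k (\<xi> (Suc k) \<omega>) (snd \<omega> k)) - diff_entropy (q k (\<xi> (Suc k) \<omega>))
      + (E (Suc k) - E k) - log_norm k)"
  proof (rule sum.cong)
    fix k assume "k \<in> {..<N}"
    then have k: "k < N" by simp
    show "(\<xi> (Suc k) \<omega> \<bullet> (Q (Suc k) *v \<xi> (Suc k) \<omega>)) / 2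
      + (norm (snd \<omega> k))\<^sup>2 / 2 - diff_entropy (q k (\<xi> (Suc k) \<omega>)) =
      - ln (opt_policy k (\<xi> (Suc k) \<omega>) (snd \<omega> k)) - diff_entropy (q k (\<xi> (Suc k) \<omega>))
      + (E (Suc k) - E k) - log_norm k"
      using stage_cost_identity[OF k, of \<omega>]
      unfolding E_def \<xi>_def matrix_vector_mult_add_rdistrib inner_add_right by argo
  qed simp
  also have "\<dots> = (\<Sum>k<N. - ln (opt_policy k (\<xi> (Suc k) \<omega>) (snd \<omega> k)) - diff_entropy (q k (\<xi> (Suc k) \<omega>)))
      + (E N - E 0) - (\<Sum>k<N. log_norm k)"
    by (simp only: sum_lessThan_telescope[of E, symmetric] sum_subtractf sum.distrib)
  finally show ?thesis by (simp add: E_def)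
qed

text \<open>The part of the expected cost on which the policy has no influence, as both end states have
  prescribed distributions; it turns out to be the optimal cost.\<close>

definition boundary_cost where
  "boundary_cost = (\<integral>x. x \<bullet> ((H N + Q N) *v x) \<partial>gaussian_measure 0 \<Sigma>N) / 2
    - (\<integral>x. x \<bullet> ((H 0 + Q 0) *v x) \<partial>gaussian_measure 0 \<Sigma>0) / 2 - (\<Sum>k<N. log_norm k)"

abbreviation policy_divergence :: "('n, 'm) policy \<Rightarrow> nat \<Rightarrow> real^'n \<Rightarrow> ennreal" where
  "policy_divergence q k x \<equiv> \<integral>\<^sup>+ v. ennreal (kl (q k x v) (opt_policy k x v)) \<partial>lborel"

text \<open>Up to a constant, the path cost differs from the sum of the entropy terms by quadratic forms of the end states,
  which are integrable because these states are Gaussian.  So integrability of the path cost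
  passes to that sum, as \<open>relative_entropy_sum\<close> requires.\<close>

lemma bwd_cost_decomposition:
  assumes adm: "bwd_admissible N A B Q \<Sigma>0 \<Sigma>N q"
  shows "boundary_cost \<le> bwd_cost N A B Q \<Sigma>N q"
    and "ennreal (bwd_cost N A B Q \<Sigma>N q - boundary_cost) =
      (\<Sum>k<N. \<integral>\<^sup>+ \<omega>. policy_divergence q k (bwd_state N A B (Suc k) \<omega>) \<partial>bwd_law N A B \<Sigma>N q)"
proof -
  have q: "is_policy N q" and dist: "distributed (bwd_law N A B \<Sigma>N q) lborel (bwd_state N A B 0) (gaussian_density 0 \<Sigma>0)"
    and ent: "AE \<omega> in bwd_law N A B \<Sigma>N q. \<forall>k<N. integrable lborel
          (\<lambda>v. q k (bwd_state N A B (Suc k) \<omega>) v * ln (q k (bwd_state N A B (Suc k) \<omega>) v))"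
    and int: "integrable (bwd_law N A B \<Sigma>N q) (bwd_path_cost N A B Q q)"
    using adm by (auto simp: bwd_admissible_def)
  interpret L: causal_process N "gaussian_density 0 \<Sigma>N" "\<lambda>k. bwd_state N A B (Suc k)" q "\<lambda>k. - int k"
    by (rule causal_process_bwd[OF \<Sigma>N(1) q])
  have law: "bwd_law N A B \<Sigma>N q = L.law {..<N}"
    unfolding bwd_law_def by (rule L.path_law_eq)
  interpret prob_space "L.law {..<N}" by (rule L.prob_space_law) auto
  let ?\<xi> = "bwd_state N A B"
  have meas [measurable]: "?\<xi> k \<in> borel_measurable (L.law {..<N})" for k by measurable
  have D0: "distr (L.law {..<N}) borel (?\<xi> 0) = gaussian_measure 0 \<Sigma>0"
  proof -
    have "distr (L.law {..<N}) borel (?\<xi> 0) = distr (L.law {..<N}) lborel (?\<xi> 0)"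
      by (rule distr_cong) simp_all
    then show ?thesis using dist by (simp add: distributed_def law)
  qed
  have DN: "distr (L.law {..<N}) borel (?\<xi> N) = gaussian_measure 0 \<Sigma>N"
  proof (rule distr_eq_densityI)
    fix F :: "real^'n \<Rightarrow> ennreal" assume "F \<in> borel_measurable borel"
    then show "(\<integral>\<^sup>+ \<omega>. F (?\<xi> N \<omega>) \<partial>L.law {..<N}) = (\<integral>\<^sup>+ x. ennreal (gaussian_density 0 \<Sigma>N x) * F x \<partial>lborel)"
      using L.nn_integral_law_initial[of F] by (simp add: bwd_state_end)
  qed measurable
  let ?E = "\<lambda>k \<omega>. ?\<xi> k \<omega> \<bullet> ((H k + Q k) *v ?\<xi> k \<omega>)"
  have E0: "integrable (L.law {..<N}) (?E 0)"
    "(\<integral>\<omega>. ?E 0 \<omega> \<partial>L.law {..<N}) = (\<integral>x. x \<bullet> ((H 0 + Q 0) *v x) \<partial>gaussian_measure 0 \<Sigma>0)"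
    using integrable_gaussian_quadratic_form[OF \<Sigma>0(1), of "H 0 + Q 0"] unfolding D0[symmetric]
    by (simp_all add: integrable_distr_eq integral_distr)
  have EN: "integrable (L.law {..<N}) (?E N)"
    "(\<integral>\<omega>. ?E N \<omega> \<partial>L.law {..<N}) = (\<integral>x. x \<bullet> ((H N + Q N) *v x) \<partial>gaussian_measure 0 \<Sigma>N)"
    using integrable_gaussian_quadratic_form[OF \<Sigma>N(1), of "H N + Q N"] unfolding DN[symmetric]
    by (simp_all add: integrable_distr_eq integral_distr)
  let ?T = "\<lambda>\<omega>. \<Sum>k<N. - ln (opt_policy k (?\<xi> (Suc k) \<omega>) (snd \<omega> k)) - diff_entropy (q k (?\<xi> (Suc k) \<omega>))"
  have T: "?T \<omega> = bwd_path_cost N A B Q q \<omega> - ?E N \<omega> / 2 + ?E 0 \<omega> / 2 + (\<Sum>k<N. log_norm k)" for \<omega>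
    unfolding path_cost_identity by simp
  have intT: "integrable (L.law {..<N}) ?T"
    unfolding T using int E0(1) EN(1) by (simp add: law)
  have "(\<integral>\<omega>. ?T \<omega> \<partial>L.law {..<N}) = bwd_cost N A B Q \<Sigma>N q - boundary_cost"
    unfolding T bwd_cost_def boundary_cost_def law using int E0 EN prob_space by (simp add: law)
  moreover have "0 \<le> (\<integral>\<omega>. ?T \<omega> + 0 \<partial>L.law {..<N}) \<and> ennreal (\<integral>\<omega>. ?T \<omega> + 0 \<partial>L.law {..<N})
    = (\<Sum>k<N. \<integral>\<^sup>+ \<omega>. policy_divergence q k (?\<xi> (Suc k) \<omega>) \<partial>L.law {..<N}) + (\<integral>\<^sup>+ \<omega>. ennreal 0 \<partial>L.law {..<N})"
  proof (rule L.relative_entropy_sum[OF opt_policy opt_policy_pos])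
    fix k assume "k \<in> {..<N}"
    then show "AE \<omega> in L.law {..<N}. integrable lborel
        (\<lambda>v. q k (?\<xi> (Suc k) \<omega>) v * ln (q k (?\<xi> (Suc k) \<omega>) v))"
      using ent[unfolded law] by (auto elim!: eventually_mono)
  qed (use intT in auto)
  ultimately show "boundary_cost \<le> bwd_cost N A B Q \<Sigma>N q"
    "ennreal (bwd_cost N A B Q \<Sigma>N q - boundary_cost) =
      (\<Sum>k<N. \<integral>\<^sup>+ \<omega>. policy_divergence q k (?\<xi> (Suc k) \<omega>) \<partial>bwd_law N A B \<Sigma>N q)"
    by (simp_all add: law)
qed

text \<open>All states are Gaussian by \<open>bwd_state_law\<close>, and the controls are Gaussian with a mean that is linear
  in the state, so all quadratic terms of the cost are integrable.  The entropies do not depend on the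
  state.\<close>

lemma opt_policy_admissible: "bwd_admissible N A B Q \<Sigma>0 \<Sigma>N opt_policy"
proof -
  interpret L: causal_process N "gaussian_density 0 \<Sigma>N" "\<lambda>k. bwd_state N A B (Suc k)" opt_policy "\<lambda>k. - int k"
    by (rule causal_process_bwd[OF \<Sigma>N(1) opt_policy])
  have law: "bwd_law N A B \<Sigma>N opt_policy = L.law {..<N}"
    unfolding bwd_law_def by (rule L.path_law_eq)
  interpret prob_space "L.law {..<N}" by (rule L.prob_space_law) auto
  let ?\<xi> = "bwd_state N A B"
  have meas [measurable]: "?\<xi> k \<in> borel_measurable (L.law {..<N})" for k by measurable
  have smeas [measurable]: "(\<lambda>\<omega>. snd \<omega> k) \<in> borel_measurable (L.law {..<N})" for k by measurable
  note D = bwd_state_law[unfolded law]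
  have quad: "integrable (L.law {..<N}) (\<lambda>\<omega>. ?\<xi> k \<omega> \<bullet> (M *v ?\<xi> k \<omega>))" if "k \<le> N" for k M
    using integrable_gaussian_quadratic_form[OF \<Sigma>_pos[OF that], of M] unfolding D[OF that, symmetric]
    by (simp add: integrable_distr_eq)
  have control: "integrable (L.law {..<N}) (\<lambda>\<omega>. (norm (snd \<omega> k))\<^sup>2)" if k: "k < N" for k
  proof (rule integrableI_nonneg)
    obtain c where c: "0 \<le> c" "\<And>\<mu>. (\<integral>\<^sup>+ v. ennreal (gaussian_density \<mu> (W k) v) * ennreal ((norm v)\<^sup>2) \<partial>lborel)
        \<le> ennreal (2 * (norm \<mu>)\<^sup>2 + c)"
      using gaussian_norm_moment_bound[OF W_pos[OF k]] by blast
    let ?b = "\<lambda>y. transpose (B k) *v (H (Suc k) *v y)"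
    have b: "(norm (?b y))\<^sup>2 = y \<bullet> ((transpose (transpose (B k) ** H (Suc k)) ** (transpose (B k) ** H (Suc k))) *v y)" for y
      by (simp only: matrix_vector_mul_assoc[symmetric] inner_transpose_mv power2_norm_eq_inner)
    have int_b: "integrable (L.law {..<N}) (\<lambda>\<omega>. 2 * (norm (?b (?\<xi> (Suc k) \<omega>)))\<^sup>2 + c)"
      unfolding b using quad[of "Suc k"] k by simp
    have "(\<integral>\<^sup>+ \<omega>. ennreal ((norm (snd \<omega> k))\<^sup>2) \<partial>L.law {..<N})
        = (\<integral>\<^sup>+ \<omega>. (\<integral>\<^sup>+ v. ennreal (opt_policy k (?\<xi> (Suc k) \<omega>) v) * ennreal ((norm v)\<^sup>2) \<partial>lborel) \<partial>L.law {..<N})"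
      using L.nn_integral_law_disintegrate[OF k, of "\<lambda>(x, v). ennreal ((norm v)\<^sup>2)"] by simp
    also have "\<dots> \<le> (\<integral>\<^sup>+ \<omega>. ennreal (2 * (norm (?b (?\<xi> (Suc k) \<omega>)))\<^sup>2 + c) \<partial>L.law {..<N})"
      unfolding opt_policy_def by (intro nn_integral_mono c(2))
    also have "\<dots> = ennreal (\<integral>\<omega>. 2 * (norm (?b (?\<xi> (Suc k) \<omega>)))\<^sup>2 + c \<partial>L.law {..<N})"
      by (rule nn_integral_eq_integral[OF int_b]) (use c(1) in simp)
    also have "\<dots> < \<infinity>" by simp
    finally show "(\<integral>\<^sup>+ \<omega>. ennreal ((norm (snd \<omega> k))\<^sup>2) \<partial>L.law {..<N}) < \<infinity>" .
  qed simp_all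
  have "distr (L.law {..<N}) lborel (?\<xi> 0) = distr (L.law {..<N}) borel (?\<xi> 0)"
    by (rule distr_cong) simp_all
  then have dist: "distributed (L.law {..<N}) lborel (?\<xi> 0) (gaussian_density 0 \<Sigma>0)"
    using D[of 0] by (simp add: distributed_def \<Sigma>_0)
  have ent: "diff_entropy (opt_policy k x) = diff_entropy (gaussian_density 0 (W k))" for k x
    unfolding opt_policy_def by (rule diff_entropy_gaussian_translate)
  have "integrable (L.law {..<N}) (bwd_path_cost N A B Q opt_policy)"
    unfolding bwd_path_cost_def[abs_def] ent
    by (intro Bochner_Integration.integrable_sum Bochner_Integration.integrable_diff
        Bochner_Integration.integrable_add integrable_divide_zero integrable_const quad control) auto
  moreover have "integrable lborel (\<lambda>v. opt_policy k x v * ln (opt_policy k x v))" if "k < N" for k x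
    unfolding opt_policy_def by (rule gaussian_entropy_integrable[OF W_pos[OF that]])
  ultimately show ?thesis
    using opt_policy dist by (simp add: bwd_admissible_def law)
qed

text \<open>The optimal policy has divergence zero, so its cost is the lower bound.  A policy of the same
  cost has zero expected divergence at every time, and a vanishing integral of the pointwise nonnegative
  \<^const>\<open>kl\<close> forces the densities to agree almost everywhere.\<close>

theorem opt_policy_unique_optimal: "bwd_unique_optimal N A B Q \<Sigma>0 \<Sigma>N opt_policy"
proof -
  have "ennreal (bwd_cost N A B Q \<Sigma>N opt_policy - boundary_cost) = 0"
    unfolding bwd_cost_decomposition(2)[OF opt_policy_admissible] by (simp add: kl_self)
  then have opt_cost: "bwd_cost N A B Q \<Sigma>N opt_policy = boundary_cost"
    using bwd_cost_decomposition(1)[OF opt_policy_admissible] by (simp add: ennreal_eq_0_iff)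
  have opt: "bwd_optimal N A B Q \<Sigma>0 \<Sigma>N opt_policy"
    unfolding bwd_optimal_def opt_cost using opt_policy_admissible bwd_cost_decomposition(1) by blast
  have "AE x in distr (bwd_law N A B \<Sigma>N q) borel (bwd_state N A B (Suc k)). AE v in lborel. q k x v = opt_policy k x v"
    if q: "bwd_optimal N A B Q \<Sigma>0 \<Sigma>N q" and k: "k < N" for q k
  proof -
    have adm: "bwd_admissible N A B Q \<Sigma>0 \<Sigma>N q" using q by (simp add: bwd_optimal_def)
    then have pol: "is_policy N q" by (simp add: bwd_admissible_def)
    interpret L: causal_process N "gaussian_density 0 \<Sigma>N" "\<lambda>k. bwd_state N A B (Suc k)" q "\<lambda>k. - int k"
      by (rule causal_process_bwd[OF \<Sigma>N(1) pol])
    have law: "bwd_law N A B \<Sigma>N q = L.law {..<N}"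
      unfolding bwd_law_def by (rule L.path_law_eq)
    note [measurable (raw)] = L.p_measurable'[OF k]
    have [measurable]: "bwd_state N A B (Suc k) \<in> borel_measurable (L.law {..<N})" by measurable
    have klm: "(\<lambda>(x, v). ennreal (kl (q k x v) (opt_policy k x v))) \<in> borel_measurable (borel \<Otimes>\<^sub>M lborel)"
      unfolding opt_policy_def by measurable
    then have [measurable]: "policy_divergence q k \<in> borel_measurable borel"
      using lborel.borel_measurable_nn_integral[OF klm] by simp
    have klx: "(\<lambda>v. kl (q k x v) (opt_policy k x v)) \<in> borel_measurable lborel" for x
      unfolding opt_policy_def by measurable
    have "bwd_cost N A B Q \<Sigma>N q \<le> boundary_cost"
      using q opt_policy_admissible unfolding bwd_optimal_def opt_cost[symmetric] by blast
    then have "(\<Sum>k<N. \<integral>\<^sup>+ \<omega>. policy_divergence q k (bwd_state N A B (Suc k) \<omega>) \<partial>bwd_law N A B \<Sigma>N q) = 0"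
      unfolding bwd_cost_decomposition(2)[OF adm, symmetric] by (simp add: ennreal_eq_0_iff)
    then have "(\<integral>\<^sup>+ \<omega>. policy_divergence q k (bwd_state N A B (Suc k) \<omega>) \<partial>L.law {..<N}) = 0"
      using k by (simp add: law)
    then have "AE \<omega> in L.law {..<N}. policy_divergence q k (bwd_state N A B (Suc k) \<omega>) = 0"
      by (subst (asm) nn_integral_0_iff_AE) simp_all
    then have "AE x in distr (L.law {..<N}) borel (bwd_state N A B (Suc k)). policy_divergence q k x = 0"
      by (subst AE_distr_iff) simp_all
    then show ?thesis
      unfolding law
    proof eventually_elim
      case (elim x)
      then have "AE v in lborel. ennreal (kl (q k x v) (opt_policy k x v)) = 0"
        using klx[of x] by (subst (asm) nn_integral_0_iff_AE) simp_all
      then show ?case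
      proof eventually_elim
        case (elim v)
        note pn = L.p_nonneg[OF k, of x v] opt_policy_pos[OF k, of x v]
        have "kl (q k x v) (opt_policy k x v) = 0"
          using elim kl_nonneg[OF pn] by (simp add: ennreal_eq_0_iff)
        then show ?case by (rule kl_eq_0_imp_eq[OF pn])
      qed
    qed
  qed
  with opt show ?thesis by (simp add: bwd_unique_optimal_def)
qed

end

section \<open>Duality, optimality and equality of the state distributions\<close>

theorem proposition7:
  fixes N :: nat
    and A Q :: "nat \<Rightarrow> real^'n^'n"
    and B S :: "nat \<Rightarrow> real^'m^'n"
    and Abar Qbar \<Pi>r H J P :: "nat \<Rightarrow> real^'n^'n"
    and \<Sigma>0 \<Sigma>N :: "real^'n^'n"
    and \<omega>s \<pi>s :: "('n::finite, 'm::finite) policy"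
  assumes "0 < N"
    and "\<forall>k<N. transpose (Q k) = Q k"
    and Abar_def: "\<forall>k<N. Abar k = A k - B k ** transpose (S k)"
    and Qbar_def: "\<forall>k<N. Qbar k = Q k - S k ** transpose (S k)" "Qbar N = 0"
    and "\<forall>k<N. pos_semidef (Qbar k)"
    and "pos_def \<Sigma>0" "pos_def \<Sigma>N"
    and "\<forall>k<N. invertible (Abar k)"
    and "\<forall>k\<le>N. transpose (\<Pi>r k) = \<Pi>r k"
    and "\<forall>k\<le>N. transpose (H k) = H k"
    and "\<forall>k<N. invertible (mat 1 + transpose (B k) ** \<Pi>r (k+1) ** B k) \<and>
       \<Pi>r k = transpose (Abar k) ** \<Pi>r (k+1) ** Abar k
         - transpose (Abar k) ** \<Pi>r (k+1) ** B k
             ** matrix_inv (mat 1 + transpose (B k) ** \<Pi>r (k+1) ** B k)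
             ** transpose (B k) ** \<Pi>r (k+1) ** Abar k
         + Qbar k"
    and "\<forall>k<N. invertible (- mat 1 + transpose (B k) ** H (k+1) ** B k) \<and>
       H k = transpose (Abar k) ** H (k+1) ** Abar k
         - transpose (Abar k) ** H (k+1) ** B k
             ** matrix_inv (- mat 1 + transpose (B k) ** H (k+1) ** B k)
             ** transpose (B k) ** H (k+1) ** Abar k
         - Qbar k"
    and J_def: "\<forall>k\<le>N. J k = H k + Qbar k"
    and P_def: "\<forall>k\<le>N. P k = \<Pi>r k - Qbar k"
    and \<omega>s_def: "\<omega>s = (\<lambda>k \<xi>. gaussian_density
          (transpose (B k) *v (H (k+1) *v \<xi>))
          (mat 1 - transpose (B k) ** H (k+1) ** B k))"
    and \<pi>s_def: "\<pi>s = (\<lambda>k x. gaussian_density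
          (- (matrix_inv (mat 1 + transpose (B k) ** \<Pi>r (k+1) ** B k)
               ** (transpose (B k) ** \<Pi>r (k+1) ** A k + transpose (S k))) *v x)
          (matrix_inv (mat 1 + transpose (B k) ** \<Pi>r (k+1) ** B k)))"
  shows
    "(\<forall>k<N.
        invertible (mat 1 + transpose (B k) ** transpose (matrix_inv (Abar k)) ** J k
                      ** matrix_inv (Abar k) ** B k) \<and>
        J (k+1) = transpose (matrix_inv (Abar k)) ** J k ** matrix_inv (Abar k)
          - transpose (matrix_inv (Abar k)) ** J k ** matrix_inv (Abar k) ** B k
              ** matrix_inv (mat 1 + transpose (B k) ** transpose (matrix_inv (Abar k)) ** J k
                               ** matrix_inv (Abar k) ** B k)
              ** transpose (B k) ** transpose (matrix_inv (Abar k)) ** J k ** matrix_inv (Abar k)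
          + Qbar (k+1))
     \<and> (\<forall>k<N.
        invertible (- mat 1 + transpose (B k) ** transpose (matrix_inv (Abar k)) ** P k
                      ** matrix_inv (Abar k) ** B k) \<and>
        P (k+1) = transpose (matrix_inv (Abar k)) ** P k ** matrix_inv (Abar k)
          - transpose (matrix_inv (Abar k)) ** P k ** matrix_inv (Abar k) ** B k
              ** matrix_inv (- mat 1 + transpose (B k) ** transpose (matrix_inv (Abar k)) ** P k
                               ** matrix_inv (Abar k) ** B k)
              ** transpose (B k) ** transpose (matrix_inv (Abar k)) ** P k ** matrix_inv (Abar k)
          - Qbar (k+1))
     \<and> (\<forall>k<N.
        invertible (mat 1 - transpose (B k) ** transpose (matrix_inv (Abar k)) ** P k
                      ** matrix_inv (Abar k) ** B k) \<and>
        mat 1 + transpose (B k) ** \<Pi>r (k+1) ** B k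
          = matrix_inv (mat 1 - transpose (B k) ** transpose (matrix_inv (Abar k)) ** P k
                          ** matrix_inv (Abar k) ** B k))
     \<and> (\<forall>k<N.
        mat 1 - transpose (B k) ** H (k+1) ** B k
          = matrix_inv (mat 1 + transpose (B k) ** transpose (matrix_inv (Abar k)) ** J k
                          ** matrix_inv (Abar k) ** B k))
     \<and> (matrix_inv \<Sigma>0 = \<Pi>r 0 + H 0 \<and> matrix_inv \<Sigma>N = \<Pi>r N + H N \<longrightarrow>
          matrix_inv \<Sigma>0 = J 0 + P 0 \<and> matrix_inv \<Sigma>N = J N + P N
          \<and> ((\<forall>k<N. pos_def (mat 1 - transpose (B k) ** H (k+1) ** B k)) \<longrightarrow>
               bwd_unique_optimal N Abar B Qbar \<Sigma>0 \<Sigma>N \<omega>s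
               \<and> (\<forall>k<N. pos_def (matrix_inv (mat 1 + transpose (B k) ** \<Pi>r (k+1) ** B k)))
               \<and> (\<forall>k\<le>N.
                    distr (bwd_law N Abar B \<Sigma>N \<omega>s) borel (bwd_state N Abar B k)
                      = distr (fwd_law N A B \<Sigma>0 \<pi>s) borel (fwd_state A B k)
                    \<and> pos_def (second_moment (fwd_law N A B \<Sigma>0 \<pi>s) (fwd_state A B k))
                    \<and> distributed (bwd_law N Abar B \<Sigma>N \<omega>s) lborel (bwd_state N Abar B k)
                        (gaussian_density 0
                          (second_moment (fwd_law N A B \<Sigma>0 \<pi>s) (fwd_state A B k))))))"
proof -
  have W_eq: "mat 1 - transpose (B k) ** H (k+1) ** B k = - (- mat 1 + transpose (B k) ** H (k+1) ** B k)" for k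
    by simp
  have W_inv: "invertible (mat 1 - transpose (B k) ** H (k+1) ** B k)"
    "matrix_inv (mat 1 - transpose (B k) ** H (k+1) ** B k)
      = - matrix_inv (- mat 1 + transpose (B k) ** H (k+1) ** B k)" if "k < N" for k
    unfolding W_eq using matrix_inv_uminus assms(13) that by blast+
  interpret R: riccati_pair N Abar Qbar \<Pi>r H B
  proof
    fix k assume k: "k < N"
    show "invertible (Abar k)" using assms(9) k by blast
    show "invertible (mat 1 + transpose (B k) ** \<Pi>r (Suc k) ** B k)"
      using assms(12) k by simp
    show "invertible (mat 1 - transpose (B k) ** H (Suc k) ** B k)"
      using W_inv(1)[OF k] by simp
    have "\<Pi>r k = transpose (Abar k) ** \<Pi>r (k+1) ** Abar k
         - transpose (Abar k) ** \<Pi>r (k+1) ** B k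
             ** matrix_inv (mat 1 + transpose (B k) ** \<Pi>r (k+1) ** B k)
             ** transpose (B k) ** \<Pi>r (k+1) ** Abar k + Qbar k"
      using assms(12) k by blast
    also have "\<dots> = transpose (Abar k) ** (\<Pi>r (Suc k) - \<Pi>r (Suc k) ** B k
        ** matrix_inv (mat 1 + transpose (B k) ** \<Pi>r (Suc k) ** B k) ** transpose (B k) ** \<Pi>r (Suc k)) ** Abar k + Qbar k"
      by (simp add: matrix_eq mv_simps)
    finally show "\<Pi>r k = \<dots>" .
    have "H k = transpose (Abar k) ** H (k+1) ** Abar k
         - transpose (Abar k) ** H (k+1) ** B k
             ** matrix_inv (- mat 1 + transpose (B k) ** H (k+1) ** B k)
             ** transpose (B k) ** H (k+1) ** Abar k - Qbar k"
      using assms(13) k by blast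
    also have "\<dots> = transpose (Abar k) ** (H (Suc k) + H (Suc k) ** B k
        ** matrix_inv (mat 1 - transpose (B k) ** H (Suc k) ** B k) ** transpose (B k) ** H (Suc k)) ** Abar k - Qbar k"
      using W_inv(2)[OF k] by (simp add: matrix_eq mv_simps)
    finally show "H k = \<dots>" .
  qed (use assms(10,11) in auto)
  have V: "mat 1 + transpose (B k) ** \<Pi>r (k+1) ** B k = R.V k"
    and W: "mat 1 - transpose (B k) ** H (k+1) ** B k = R.W k" for k
    by (simp_all add: R.V_def R.W_def)
  have J: "transpose (matrix_inv (Abar k)) ** J k ** matrix_inv (Abar k) = R.Jt k"
    and P: "transpose (matrix_inv (Abar k)) ** P k ** matrix_inv (Abar k) = R.Pt k" if "k < N" for k
    using R.J_dual(1)[OF that] R.P_dual(1)[OF that] J_def P_def that by simp_all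
  note Js = J matrix_mul_assoc_subst[OF J] and Ps = P matrix_mul_assoc_subst[OF P]
  have minus: "- mat 1 + X = - (mat 1 - X)" for X :: "real^'m^'m" by simp
  have Jk: "invertible (mat 1 + transpose (B k) ** R.Jt k ** B k)
      \<and> J (k+1) = R.Jt k - R.Jt k ** B k ** matrix_inv (mat 1 + transpose (B k) ** R.Jt k ** B k)
          ** transpose (B k) ** R.Jt k + Qbar (k+1)"
    and Jinv: "R.W k = matrix_inv (mat 1 + transpose (B k) ** R.Jt k ** B k)" if k: "k < N" for k
    using R.J_dual(2,3,4)[OF k] J_def k by simp_all
  have Pk: "invertible (- mat 1 + transpose (B k) ** R.Pt k ** B k)
      \<and> P (k+1) = R.Pt k - R.Pt k ** B k ** matrix_inv (- mat 1 + transpose (B k) ** R.Pt k ** B k)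
          ** transpose (B k) ** R.Pt k - Qbar (k+1)"
    and Pinv: "invertible (mat 1 - transpose (B k) ** R.Pt k ** B k)
      \<and> R.V k = matrix_inv (mat 1 - transpose (B k) ** R.Pt k ** B k)" if k: "k < N" for k
  proof -
    note d = R.P_dual(2,3,4)[OF k]
    show "invertible (mat 1 - transpose (B k) ** R.Pt k ** B k)
      \<and> R.V k = matrix_inv (mat 1 - transpose (B k) ** R.Pt k ** B k)"
      using d by simp
    have "P (k+1) = \<Pi>r (Suc k) - Qbar (k+1)" using P_def k by simp
    then have "P (k+1) = R.Pt k - R.Pt k ** B k ** - R.V k ** transpose (B k) ** R.Pt k - Qbar (k+1)"
      unfolding d(3) by (simp add: matrix_eq mv_simps)
    then show "invertible (- mat 1 + transpose (B k) ** R.Pt k ** B k)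
      \<and> P (k+1) = R.Pt k - R.Pt k ** B k ** matrix_inv (- mat 1 + transpose (B k) ** R.Pt k ** B k)
          ** transpose (B k) ** R.Pt k - Qbar (k+1)"
      unfolding minus matrix_inv_uminus(2)[OF d(1)] d(2) using matrix_inv_uminus(1)[OF d(1)] by blast
  qed
  have main: "matrix_inv \<Sigma>0 = J 0 + P 0 \<and> matrix_inv \<Sigma>N = J N + P N
      \<and> ((\<forall>k<N. pos_def (R.W k)) \<longrightarrow>
           bwd_unique_optimal N Abar B Qbar \<Sigma>0 \<Sigma>N \<omega>s
           \<and> (\<forall>k<N. pos_def (matrix_inv (R.V k)))
           \<and> (\<forall>k\<le>N.
                distr (bwd_law N Abar B \<Sigma>N \<omega>s) borel (bwd_state N Abar B k)
                  = distr (fwd_law N A B \<Sigma>0 \<pi>s) borel (fwd_state A B k)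
                \<and> pos_def (second_moment (fwd_law N A B \<Sigma>0 \<pi>s) (fwd_state A B k))
                \<and> distributed (bwd_law N Abar B \<Sigma>N \<omega>s) lborel (bwd_state N Abar B k)
                    (gaussian_density 0
                      (second_moment (fwd_law N A B \<Sigma>0 \<pi>s) (fwd_state A B k)))))"
    if bd: "matrix_inv \<Sigma>0 = \<Pi>r 0 + H 0 \<and> matrix_inv \<Sigma>N = \<Pi>r N + H N"
  proof (intro conjI impI)
    show "matrix_inv \<Sigma>0 = J 0 + P 0" "matrix_inv \<Sigma>N = J N + P N"
      using bd J_def P_def by simp_all
    assume W_pos: "\<forall>k<N. pos_def (R.W k)"
    interpret G: gaussian_steering N Abar Qbar \<Pi>r H B \<Sigma>0 \<Sigma>N
      by standard (use assms(7,8) bd W_pos in auto)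
    have \<omega>s: "\<omega>s = G.opt_policy"
      unfolding \<omega>s_def G.opt_policy_def W by simp
    show "bwd_unique_optimal N Abar B Qbar \<Sigma>0 \<Sigma>N \<omega>s"
      unfolding \<omega>s by (rule G.opt_policy_unique_optimal)
    show "\<forall>k<N. pos_def (matrix_inv (R.V k))"
      using G.V_pos pos_def_matrix_inv by blast
    show "\<forall>k\<le>N. distr (bwd_law N Abar B \<Sigma>N \<omega>s) borel (bwd_state N Abar B k)
          = distr (fwd_law N A B \<Sigma>0 \<pi>s) borel (fwd_state A B k)
        \<and> pos_def (second_moment (fwd_law N A B \<Sigma>0 \<pi>s) (fwd_state A B k))
        \<and> distributed (bwd_law N Abar B \<Sigma>N \<omega>s) lborel (bwd_state N Abar B k)
            (gaussian_density 0 (second_moment (fwd_law N A B \<Sigma>0 \<pi>s) (fwd_state A B k)))"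
    proof (intro allI impI)
      fix k assume k: "k \<le> N"
      have bwd: "distr (bwd_law N Abar B \<Sigma>N \<omega>s) borel (bwd_state N Abar B k) = gaussian_measure 0 (G.\<Sigma> k)"
        unfolding \<omega>s by (rule G.bwd_state_law[OF k])
      have fwd: "distr (fwd_law N A B \<Sigma>0 \<pi>s) borel (fwd_state A B k) = gaussian_measure 0 (G.\<Sigma> k)"
        by (rule G.fwd_state_law[OF _ _ k, where S = S]) (use Abar_def in \<open>simp_all add: \<pi>s_def R.V_def\<close>)
      have "fwd_state A B k \<in> borel_measurable (fwd_law N A B \<Sigma>0 \<pi>s)"
        unfolding fwd_law_def path_law_def by measurable
      then have sm: "second_moment (fwd_law N A B \<Sigma>0 \<pi>s) (fwd_state A B k) = G.\<Sigma> k"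
        by (rule second_moment_gaussian[OF G.\<Sigma>_pos[OF k] _ fwd])
      have "bwd_state N Abar B k \<in> borel_measurable (bwd_law N Abar B \<Sigma>N \<omega>s)"
        unfolding bwd_law_def path_law_def by measurable
      moreover have "distr (bwd_law N Abar B \<Sigma>N \<omega>s) lborel (bwd_state N Abar B k)
          = distr (bwd_law N Abar B \<Sigma>N \<omega>s) borel (bwd_state N Abar B k)"
        by (rule distr_cong) simp_all
      ultimately have "distributed (bwd_law N Abar B \<Sigma>N \<omega>s) lborel (bwd_state N Abar B k)
            (gaussian_density 0 (G.\<Sigma> k))"
        by (simp add: distributed_def bwd)
      with G.\<Sigma>_pos[OF k] show "distr (bwd_law N Abar B \<Sigma>N \<omega>s) borel (bwd_state N Abar B k)
          = distr (fwd_law N A B \<Sigma>0 \<pi>s) borel (fwd_state A B k)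
        \<and> pos_def (second_moment (fwd_law N A B \<Sigma>0 \<pi>s) (fwd_state A B k))
        \<and> distributed (bwd_law N Abar B \<Sigma>N \<omega>s) lborel (bwd_state N Abar B k)
            (gaussian_density 0 (second_moment (fwd_law N A B \<Sigma>0 \<pi>s) (fwd_state A B k)))"
        by (simp only: sm bwd fwd simp_thms)
    qed
  qed
  show ?thesis
    unfolding V W
  proof (intro conjI, goal_cases)
    case 1
    show ?case by (intro allI impI, simp only: Js, rule Jk)
  next
    case 2
    show ?case by (intro allI impI, simp only: Ps, rule Pk)
  next
    case 3
    show ?case by (intro allI impI, simp only: Ps, rule Pinv)
  next
    case 4
    show ?case by (intro allI impI, simp only: Js, rule Jinv)
  next
    case 5
    show ?case by (intro impI main)
  qed
qed

end
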